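(* Let $\mathcal{O}=\{t_1,\dots,t_\mu\}$ be an order ideal in $\mathbb{T}^n$, and let $I(\mathbb{B}^{\mathrm{df}}_{\mathcal{O}})=I(\mathbb{B}_{\mathcal{O}})+I^{\mathrm{df}}_{\mathcal{O}}$. Define an ideal $J$ of $K[C]$ as follows. If the Hilbert function $\mathrm{HF}_{\mathcal{O}}$ is not symmetric, let $J=I(\mathbb{B}^{\mathrm{df}}_{\mathcal{O}})$. Otherwise, let $G^{\mathrm{hom}}=\{g_1^{\mathrm{hom}},\dots,g_\nu^{\mathrm{hom}}\}$ be the generic homogeneous $\mathcal{O}$-border prebasis and write $g_j^{\mathrm{hom}}=\sum_{i=1}^nh_{ij}x_i$ with $h_{ij}\in K[C][x_1,\dots,x_n]$ for $j=1,\dots,\nu$. Let $W$ be the $n\times\nu$ matrix with columns $(h_{1j},\dots,h_{nj})^{\mathrm{tr}}$, $j=1,\dots,\nu$. Let $k=\binom{\nu}{n}$ and let $f_1,\dots,f_k$ be the minors of order $n$ of $W$. Write the residue classes $\bar f_1,\dots,\bar f_k\in U^{\mathrm{hom}}_{\mathcal{O}}$ as $B^{\mathrm{hom}}_{\mathcal{O}}$-linear combinations $\bar f_j=\sum_{i=1}^\mu\bar a_{ij}t_i$ with $\bar a_{ij}\in B^{\mathrm{hom}}_{\mathcal{O}}$. For all $i,j$ choose $a_{ij}\in K[C^{\mathrm{hom}}]$ representing $\bar a_{ij}$ with respect to $B^{\mathrm{hom}}_{\mathcal{O}}\cong K[C^{\mathrm{hom}}]/\bar I(\mathbb{B}^{\mathrm{hom}}_{\mathcal{O}})$,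 and let $J=I(\mathbb{B}^{\mathrm{df}}_{\mathcal{O}})+\langle a_{ij}\mid 1\le i\le\mu,\ 1\le j\le k\rangle$. Then $J$ defines a closed subscheme $\mathrm{NonSCI}^{\mathrm{df}}_{\mathcal{O}}$ of $\mathbb{B}^{\mathrm{df}}_{\mathcal{O}}$ whose $K$-rational points represent exactly the 0-dimensional subschemes of $\mathbb{A}^n_K$ which have a degree filtered $\mathcal{O}$-border basis, but are not strict complete intersection schemes.
   Context: $K$ is an arbitrary field, $P=K[x_1,\dots,x_n]$, and $\mathbb{T}^n$ is the monoid of terms (power products) in $x_1,\dots,x_n$. An order ideal is a finite set $\mathcal{O}=\{t_1,\dots,t_\mu\}\subset\mathbb{T}^n$ with $\mu\ge 1$ containing every divisor in $\mathbb{T}^n$ of each of its elements; it is always ordered so that $\deg(t_1)\le\cdots\le\deg(t_\mu)$, hence $t_1=1$. Its border is $\partial\mathcal{O}=(x_1\mathcal{O}\cup\cdots\cup x_n\mathcal{O})\setminus\mathcal{O}=\{b_1,\dots,b_\nu\}$. Its Hilbert function is $\mathrm{HF}_{\mathcal{O}}=(h_0,h_1,\dots)$ with $h_i=\#\{j\mid\deg(t_j)=i\}$; it is symmetric if $h_i=h_{\rho-i}$ for $i=1,\dots,\rho$, where $\rho=\max\{i\ge 0\mid h_i>0\}=\deg(t_\mu)$. Let $C=\{c_{ij}\mid 1\le i\le\mu,\ 1\le j\le\nu\}$ be new indeterminates. The $r$-th generic multiplication matrix $\mathcal{A}_r=(a^{(r)}_{ij})\in\mathrm{Mat}_\mu(K[C])$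 has $a^{(r)}_{ij}=\delta_{im}$ if $x_rt_j=t_m$ and $a^{(r)}_{ij}=c_{im}$ if $x_rt_j=b_m$. $I(\mathbb{B}_{\mathcal{O}})\subseteq K[C]$ is generated by the entries of all commutators $\mathcal{A}_r\mathcal{A}_s-\mathcal{A}_s\mathcal{A}_r$, and the border basis scheme $\mathbb{B}_{\mathcal{O}}\subseteq\mathrm{Spec}(K[C])$ is the closed subscheme it defines. For a $K$-rational point $\Gamma=(\gamma_{ij})$ of $\mathbb{B}_{\mathcal{O}}$, let $I_\Gamma\subset P$ be generated by $b_j-\sum_i\gamma_{ij}t_i$; $\Gamma$ represents the 0-dimensional scheme $\mathbb{X}_\Gamma\subset\mathbb{A}^n_K$ with vanishing ideal $I_\Gamma$. $I^{\mathrm{df}}_{\mathcal{O}}\subseteq K[C]$ is generated by all $c_{ij}$ with $\deg(t_i)>\deg(b_j)$; $\mathbb{B}^{\mathrm{df}}_{\mathcal{O}}$ is the closed subscheme of $\mathbb{B}_{\mathcal{O}}$ defined by $I(\mathbb{B}_{\mathcal{O}})+I^{\mathrm{df}}_{\mathcal{O}}$. Homogeneous version: let $C^{\mathrm{hom}}=\{c_{ij}\mid\deg(t_i)=\deg(b_j)\}$. Let $\bar I(\mathbb{B}^{\mathrm{hom}}_{\mathcal{O}})\subseteq K[C^{\mathrm{hom}}]$ be the ideal obtained from $I(\mathbb{B}_{\mathcal{O}})$ by setting all indeterminates in $C\setminus C^{\mathrm{hom}}$ to zero, and $B^{\mathrm{hom}}_{\mathcal{O}}=K[C]/(I(\mathbb{B}_{\mathcal{O}})+\langle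 C\setminus C^{\mathrm{hom}}\rangle)\cong K[C^{\mathrm{hom}}]/\bar I(\mathbb{B}^{\mathrm{hom}}_{\mathcal{O}})$. The generic homogeneous $\mathcal{O}$-border prebasis consists of $g_j^{\mathrm{hom}}=b_j-\sum_{\{i\mid\deg(t_i)=\deg(b_j)\}}c_{ij}t_i$, and $U^{\mathrm{hom}}_{\mathcal{O}}=B^{\mathrm{hom}}_{\mathcal{O}}[x_1,\dots,x_n]/\langle G^{\mathrm{hom}}\rangle$, which is a free $B^{\mathrm{hom}}_{\mathcal{O}}$-module with basis $\mathcal{O}$ (the coordinates of an element can be computed by border division by $G^{\mathrm{hom}}$). For a 0-dimensional subscheme $\mathbb{X}\subset\mathbb{A}^n_K$ with vanishing ideal $I_{\mathbb{X}}$ put $R_{\mathbb{X}}=P/I_{\mathbb{X}}$ and let $F_iR_{\mathbb{X}}$ be the image of the polynomials of degree $\le i$ (including $0$). $\mathbb{X}$ has a degree filtered $\mathcal{O}$-border basis if for every $i\ge 0$ the residue classes of the elements of $\mathcal{O}$ of degree $\le i$ form a $K$-basis of $F_iR_{\mathbb{X}}$. Let $\mathrm{DF}(I_{\mathbb{X}})$ be the ideal generated by the top-degree homogeneous components of the non-zero elements of $I_{\mathbb{X}}$. $\mathbb{X}$ is a strict complete intersection scheme if $\mathrm{gr}_{\mathcal{F}}(R_{\mathbb{X}})\cong P/\mathrm{DF}(I_{\mathbb{X}})$ is a graded complete intersection, i.e. $\mathrm{DF}(I_{\mathbb{X}})$ can be generated by a homogeneous regular sequence of length $n$. Conventions: statements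 about $K$-rational points may be read for $L$-rational points for any field extension $L\supseteq K$; an ideal is said to define a subscheme up to radical. *)

theory Defs
  imports
    "HOL-Analysis.Determinants"
    "HOL-Library.Poly_Mapping"
    "HOL-Library.Set_Algebras"
begin

section \<open>Polynomial rings\<close>

text \<open>
  A term in the indeterminates \<open>x\<^sub>r\<close>, \<open>r :: 'n\<close>, is its exponent vector, so multiplication of terms
  is written additively and the term 1 is 0. With \<open>'n\<close> of cardinality n, the type
  \<open>('n, 'a) mpol\<close> is the polynomial ring in n indeterminates over \<open>'a\<close>; its ring
  structure is the convolution product of \<^theory>\<open>HOL-Library.Poly_Mapping\<close>.
\<close>

type_synonym 'n trm = "'n \<Rightarrow>\<^sub>0 nat"
type_synonym ('n, 'a) mpol = "'n trm \<Rightarrow>\<^sub>0 'a"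

definition var_trm :: "'n \<Rightarrow> 'n trm"
  where "var_trm x = Poly_Mapping.single x 1"

definition tdeg :: "'n::finite trm \<Rightarrow> nat"
  where "tdeg s = (\<Sum>x\<in>UNIV. Poly_Mapping.lookup s x)"

definition Const :: "'a \<Rightarrow> ('n, 'a::zero) mpol"
  where "Const a = Poly_Mapping.single 0 a"

definition Monom :: "'n trm \<Rightarrow> ('n, 'a::zero_neq_one) mpol"
  where "Monom s = Poly_Mapping.single s 1"

definition Indet :: "'n \<Rightarrow> ('n, 'a::zero_neq_one) mpol"
  where "Indet x = Monom (var_trm x)"

definition indets :: "('n, 'a::zero) mpol \<Rightarrow> 'n set"
  where "indets p = (\<Union>s\<in>Poly_Mapping.keys p. Poly_Mapping.keys s)"

text \<open>Evaluation at a point \<open>\<gamma>\<close> with coordinates in an extension \<open>\<phi> : 'a \<rightarrow> 'b\<close> of the coefficients.\<close>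

definition eval_at :: "('a \<Rightarrow> 'b) \<Rightarrow> ('n \<Rightarrow> 'b) \<Rightarrow> ('n, 'a::zero) mpol \<Rightarrow> 'b::comm_ring_1"
  where "eval_at \<phi> \<gamma> p =
    (\<Sum>s\<in>Poly_Mapping.keys p. \<phi> (Poly_Mapping.lookup p s) *
       (\<Prod>x\<in>Poly_Mapping.keys s. \<gamma> x ^ Poly_Mapping.lookup s x))"

definition field_embedding :: "('a::field \<Rightarrow> 'b::field) \<Rightarrow> bool"
  where "field_embedding \<phi> \<longleftrightarrow>
    \<phi> 1 = 1 \<and> (\<forall>x y. \<phi> (x + y) = \<phi> x + \<phi> y) \<and> (\<forall>x y. \<phi> (x * y) = \<phi> x * \<phi> y)"

section \<open>Ideals, degree forms, regular sequences\<close>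

text \<open>An ideal is a submodule of the ring regarded as a module over itself.\<close>

lemma module_times: "module ((*) :: 'a::comm_ring_1 \<Rightarrow> 'a \<Rightarrow> 'a)"
  by unfold_locales (simp_all add: algebra_simps)

definition is_ideal :: "'a::comm_ring_1 set \<Rightarrow> bool"
  where "is_ideal I \<longleftrightarrow> module.subspace (*) I"

definition ideal_gen :: "'a::comm_ring_1 set \<Rightarrow> 'a set"
  where "ideal_gen S = module.span (*) S"

definition homogeneous :: "('n::finite, 'a::zero) mpol \<Rightarrow> bool"
  where "homogeneous p \<longleftrightarrow> (\<exists>d. \<forall>s\<in>Poly_Mapping.keys p. tdeg s = d)"

definition pdeg :: "('n::finite, 'a::zero) mpol \<Rightarrow> nat"
  where "pdeg p = Max (tdeg ` Poly_Mapping.keys p)"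

definition deg_form :: "('n::finite, 'a::comm_ring_1) mpol \<Rightarrow> ('n, 'a) mpol"
  where "deg_form p =
    (\<Sum>s\<in>{s \<in> Poly_Mapping.keys p. tdeg s = pdeg p}.
       Poly_Mapping.single s (Poly_Mapping.lookup p s))"

definition DF :: "('n::finite, 'a::comm_ring_1) mpol set \<Rightarrow> ('n, 'a) mpol set"
  where "DF I = ideal_gen (deg_form ` (I - {0}))"

definition regular_sequence :: "'a::comm_ring_1 list \<Rightarrow> bool"
  where "regular_sequence fs \<longleftrightarrow>
    (\<forall>i<length fs. \<forall>g. g * fs ! i \<in> ideal_gen (set (take i fs))
        \<longrightarrow> g \<in> ideal_gen (set (take i fs)))
    \<and> 1 \<notin> ideal_gen (set fs)"

section \<open>Zero-dimensional subschemes of affine space\<close>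

text \<open>
  A 0-dimensional subscheme of affine n-space over a field is given by its vanishing ideal \<open>I\<close>:
  a proper ideal of the polynomial ring whose residue class ring is a finite-dimensional
  vector space.
\<close>

definition zero_dim_scheme :: "('n, 'k::field) mpol set \<Rightarrow> bool"
  where "zero_dim_scheme I \<longleftrightarrow> is_ideal I \<and> 1 \<notin> I \<and>
    (\<exists>S. finite S \<and> (\<forall>p. \<exists>c. p - (\<Sum>s\<in>S. Const (c s) * s) \<in> I))"

text \<open>
  The residue classes of the \<open>t\<^sub>j\<close> of degree at most i form a basis of \<open>F\<^sub>i R\<close>, the image of the
  polynomials of degree at most i (including 0): they generate it and are linearly independent.
\<close>

definition has_df_border_basis ::
    "('m::finite \<Rightarrow> 'n::finite trm) \<Rightarrow> ('n, 'k::field) mpol set \<Rightarrow> bool"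
  where "has_df_border_basis t I \<longleftrightarrow>
    (\<forall>i.
      (\<forall>p. (\<forall>s\<in>Poly_Mapping.keys p. tdeg s \<le> i) \<longrightarrow>
         (\<exists>c. p - (\<Sum>j\<in>{j. tdeg (t j) \<le> i}. Const (c j) * Monom (t j)) \<in> I)) \<and>
      (\<forall>c. (\<Sum>j\<in>{j. tdeg (t j) \<le> i}. Const (c j) * Monom (t j)) \<in> I \<longrightarrow>
         (\<forall>j. tdeg (t j) \<le> i \<longrightarrow> c j = 0)))"

definition strict_CI :: "('n::finite, 'k::field) mpol set \<Rightarrow> bool"
  where "strict_CI I \<longleftrightarrow>
    (\<exists>fs. length fs = CARD('n) \<and> (\<forall>f\<in>set fs. homogeneous f) \<and>
       regular_sequence fs \<and> DF I = ideal_gen (set fs))"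

section \<open>Order ideals\<close>

definition order_ideal :: "'n trm set \<Rightarrow> bool"
  where "order_ideal T \<longleftrightarrow> finite T \<and> T \<noteq> {} \<and> (\<forall>s s'. s + s' \<in> T \<longrightarrow> s \<in> T)"

definition border :: "'n trm set \<Rightarrow> 'n trm set"
  where "border T = (\<Union>r. (\<lambda>s. var_trm r + s) ` T) - T"

definition HF :: "'n::finite trm set \<Rightarrow> nat \<Rightarrow> nat"
  where "HF T i = card {s \<in> T. tdeg s = i}"

definition symmetric_HF :: "'n::finite trm set \<Rightarrow> bool"
  where "symmetric_HF T \<longleftrightarrow>
    (let \<rho> = Max {i. HF T i > 0} in \<forall>i\<in>{1..\<rho>}. HF T i = HF T (\<rho> - i))"

section \<open>Border basis schemes\<close>

text \<open>
  The enumerations \<open>t\<^sub>1, \<dots>, t\<^sub>\<mu>\<close> of the order ideal and \<open>b\<^sub>1, \<dots>, b\<^sub>\<nu>\<close> of its border are functions on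
  finite index types \<open>'m\<close> and \<open>'v\<close> of cardinality \<open>\<mu>\<close> and \<open>\<nu>\<close>. The indeterminate \<open>c\<^sub>i\<^sub>j\<close> of \<open>K[C]\<close>
  is indexed by the pair \<open>(i, j)\<close>.
\<close>

type_synonym ('m, 'v, 'k) KC = "('m \<times> 'v, 'k) mpol"

definition mult_matrix ::
    "('m::finite \<Rightarrow> 'n::finite trm) \<Rightarrow> ('v \<Rightarrow> 'n trm) \<Rightarrow> 'n \<Rightarrow> ('m, 'v, 'k::field) KC ^ 'm ^ 'm"
  where "mult_matrix t b r = (\<chi> i j.
    if \<exists>m. var_trm r + t j = t m
    then (if var_trm r + t j = t i then 1 else 0)
    else Indet (i, THE m. var_trm r + t j = b m))"

definition I_B ::
    "('m::finite \<Rightarrow> 'n::finite trm) \<Rightarrow> ('v \<Rightarrow> 'n trm) \<Rightarrow> ('m, 'v, 'k::field) KC set"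
  where "I_B t b = ideal_gen
    {(mult_matrix t b r ** mult_matrix t b s - mult_matrix t b s ** mult_matrix t b r) $ i $ j
      | r s i j. True}"

definition I_df ::
    "('m \<Rightarrow> 'n::finite trm) \<Rightarrow> ('v \<Rightarrow> 'n trm) \<Rightarrow> ('m, 'v, 'k::field) KC set"
  where "I_df t b = ideal_gen {Indet (i, j) | i j. tdeg (t i) > tdeg (b j)}"

definition I_B_df ::
    "('m::finite \<Rightarrow> 'n::finite trm) \<Rightarrow> ('v \<Rightarrow> 'n trm) \<Rightarrow> ('m, 'v, 'k::field) KC set"
  where "I_B_df t b = I_B t b + I_df t b"

text \<open>
  The points, with coordinates in the extension field \<open>\<phi> : K \<rightarrow> L\<close>, of the closed subscheme of
  \<open>Spec K[C]\<close> defined by \<open>J\<close>; \<open>\<phi> = id\<close> gives the K-rational points.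
\<close>

definition rational_points ::
    "('k \<Rightarrow> 'l) \<Rightarrow> ('m, 'v, 'k::field) KC set \<Rightarrow> ('m \<Rightarrow> 'v \<Rightarrow> 'l::field) set"
  where "rational_points \<phi> J = {\<Gamma>. \<forall>f\<in>J. eval_at \<phi> (\<lambda>(i, j). \<Gamma> i j) f = 0}"

definition I_point ::
    "('m::finite \<Rightarrow> 'n trm) \<Rightarrow> ('v \<Rightarrow> 'n trm) \<Rightarrow> ('m \<Rightarrow> 'v \<Rightarrow> 'l::field) \<Rightarrow> ('n, 'l) mpol set"
  where "I_point t b \<Gamma> = ideal_gen
    (range (\<lambda>j. Monom (b j) - (\<Sum>i\<in>UNIV. Const (\<Gamma> i j) * Monom (t i))))"

section \<open>The homogeneous border basis scheme and its universal family\<close>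

definition C_hom ::
    "('m \<Rightarrow> 'n::finite trm) \<Rightarrow> ('v \<Rightarrow> 'n trm) \<Rightarrow> ('m \<times> 'v) set"
  where "C_hom t b = {(i, j). tdeg (t i) = tdeg (b j)}"

definition g_hom ::
    "('m::finite \<Rightarrow> 'n::finite trm) \<Rightarrow> ('v \<Rightarrow> 'n trm) \<Rightarrow> 'v \<Rightarrow> ('n, ('m, 'v, 'k::field) KC) mpol"
  where "g_hom t b j =
    Monom (b j) - (\<Sum>i\<in>{i. tdeg (t i) = tdeg (b j)}. Const (Indet (i, j)) * Monom (t i))"

text \<open>\<open>B\<^sup>h\<^sup>o\<^sup>m\<close> is the residue class ring of \<open>K[C]\<close> modulo the following ideal.\<close>

definition I_B_hom ::
    "('m::finite \<Rightarrow> 'n::finite trm) \<Rightarrow> ('v \<Rightarrow> 'n trm) \<Rightarrow> ('m, 'v, 'k::field) KC set"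
  where "I_B_hom t b = I_B t b + ideal_gen (Indet ` (- C_hom t b))"

text \<open>
  Elements of \<open>U\<^sup>h\<^sup>o\<^sup>m\<close>, the residue class ring of \<open>B\<^sup>h\<^sup>o\<^sup>m[x]\<close> modulo the ideal generated by the
  \<open>g\<^sub>j\<^sup>h\<^sup>o\<^sup>m\<close>, are represented by polynomials in \<open>K[C][x]\<close>. Two of them have the same image in
  \<open>B\<^sup>h\<^sup>o\<^sup>m[x]\<close> iff all coefficients of their difference lie in \<^const>\<open>I_B_hom\<close>, and the same image
  in \<open>U\<^sup>h\<^sup>o\<^sup>m\<close> iff up to such coefficients the difference is a combination of the \<open>g\<^sub>j\<^sup>h\<^sup>o\<^sup>m\<close>.
\<close>

definition U_hom_eq ::
    "('m::finite \<Rightarrow> 'n::finite trm) \<Rightarrow> ('v \<Rightarrow> 'n trm) \<Rightarrow>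
     ('n, ('m, 'v, 'k::field) KC) mpol \<Rightarrow> ('n, ('m, 'v, 'k) KC) mpol \<Rightarrow> bool"
  where "U_hom_eq t b f f' \<longleftrightarrow>
    f - f' \<in> {p. \<forall>s. Poly_Mapping.lookup p s \<in> I_B_hom t b} + ideal_gen (range (g_hom t b))"

text \<open>
  The minors of order n of a matrix with n rows: the choices of n of its columns, in increasing
  order, are the strictly increasing maps from the row indices to the column indices.
\<close>

definition max_minor :: "'a::comm_ring_1 ^ 'v ^ 'n \<Rightarrow> ('n::finite \<Rightarrow> 'v) \<Rightarrow> 'a"
  where "max_minor W \<sigma> = det (\<chi> i k. W $ i $ \<sigma> k)"

end

theory Submission
  imports Defs
begin

text \<open>
  A point \<open>\<Gamma>\<close> lies on the border basis scheme iff its multiplication matrices commute, which is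
  the classical criterion for the order ideal to be a basis modulo \<open>I\<^sub>\<Gamma>\<close>
  (\<open>border_point.mem_I_iff\<close>, \<open>point_of_df_border_basis\<close>). If moreover \<open>\<Gamma>\<close> kills all \<open>c\<^sub>i\<^sub>j\<close> with
  \<open>deg t\<^sub>i > deg b\<^sub>j\<close>, then the degree form ideal of \<open>I\<^sub>\<Gamma>\<close> is \<open>H = I\<^sub>\<Gamma>\<^sub>'\<close>, where \<open>\<Gamma>'\<close> keeps only the
  coordinates with \<open>deg t\<^sub>i = deg b\<^sub>j\<close> (\<open>DF_I_point\<close>). The \<open>a\<^sub>i\<^sub>j\<close> involve only these coordinates,
  and the \<open>t\<^sub>i\<close> are independent modulo \<open>H\<close>, so all \<open>a\<^sub>i\<^sub>j\<close> vanish at \<open>\<Gamma>\<close> iff all maximal minors of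
  the specialised matrix \<open>W\<close> lie in \<open>H\<close>. What remains is Wiebe's criterion: for homogeneous
  \<open>g\<^sub>j = \<Sum>\<^sub>i h\<^sub>i\<^sub>j x\<^sub>i\<close> generating an ideal \<open>H\<close> of finite colength, \<open>H\<close> is generated by a regular
  sequence of length \<open>n\<close> iff some maximal minor of \<open>(h\<^sub>i\<^sub>j)\<close> is not in \<open>H\<close>; and in that case the
  Hilbert function is symmetric.

  The proof of Wiebe's criterion perturbs \<open>n\<close> elements \<open>g\<^sub>j\<close> of \<open>H\<close> to \<open>f\<^sub>j = x\<^sub>j\<^sup>N + g\<^sub>j\<close> with large \<open>N\<close>.
  Since \<open>x\<^sub>j\<^sup>N\<close> is the degree form of \<open>f\<^sub>j\<close>, an explicit residue functional \<open>tau\<close> makes \<open>P/(f)\<close> a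
  Frobenius algebra, so the annihilator of \<open>(x\<^sub>1,\<dots>,x\<^sub>n)\<close> in it is a line. The determinant of
  \<open>h + diag (x\<^sub>j\<^sup>N\<^sup>-\<^sup>1)\<close> lies on that line, has \<open>tau = 1\<close> for degree reasons, and is congruent to
  \<open>det h\<close> modulo \<open>H\<close>. If \<open>g\<close> generates \<open>H\<close>, then \<open>(f)\<close> and \<open>H\<close> agree near the origin, whence
  \<open>det h \<notin> H\<close> (\<open>det_notin_parameter_ideal\<close>) and the socle of \<open>P/H\<close> is a line
  (\<open>socle_dim_le_1\<close>), which gives the symmetry (\<open>graded_point.symmetric_of_socle\<close>). Conversely, if
  \<open>det h \<notin> H\<close>, then \<open>H/(f)\<close> misses the line, so by duality \<open>H = (x\<^sub>1,\<dots>,x\<^sub>n) H + (f)\<close>, and the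
  graded Nakayama argument yields \<open>H = (g)\<close> (\<open>generated_by_nonzero_minor\<close>). That \<open>n\<close> homogeneous
  generators of an ideal of finite colength form a regular sequence follows from the same
  perturbation: the syzygies of the \<open>f\<^sub>j\<close> are Koszul because those of the \<open>x\<^sub>j\<^sup>N\<close> are, and this
  property passes to \<open>g\<close> (\<open>regular_sequence_of_parameters\<close>).
\<close>

section \<open>Ideals\<close>

lemma is_idealI:
  assumes "0 \<in> I" "\<And>x y. x \<in> I \<Longrightarrow> y \<in> I \<Longrightarrow> x + y \<in> I" "\<And>c x. x \<in> I \<Longrightarrow> c * x \<in> I"
  shows "is_ideal I"
  using assms unfolding is_ideal_def module.subspace_def[OF module_times] by blast

lemma ideal_0: "is_ideal I \<Longrightarrow> 0 \<in> I"
  unfolding is_ideal_def by (rule module.subspace_0[OF module_times])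

lemma ideal_add: "is_ideal I \<Longrightarrow> x \<in> I \<Longrightarrow> y \<in> I \<Longrightarrow> x + y \<in> I"
  unfolding is_ideal_def by (rule module.subspace_add[OF module_times])

lemma ideal_mult: "is_ideal I \<Longrightarrow> x \<in> I \<Longrightarrow> c * x \<in> I"
  unfolding is_ideal_def by (rule module.subspace_scale[OF module_times])

lemma ideal_mult_right: "is_ideal I \<Longrightarrow> x \<in> I \<Longrightarrow> x * c \<in> I"
  using ideal_mult[of I x c] by (simp add: mult.commute)

lemma ideal_diff: "is_ideal I \<Longrightarrow> x \<in> I \<Longrightarrow> y \<in> I \<Longrightarrow> x - y \<in> I"
  unfolding is_ideal_def by (rule module.subspace_diff[OF module_times])

lemma ideal_sum: "is_ideal I \<Longrightarrow> (\<And>a. a \<in> A \<Longrightarrow> f a \<in> I) \<Longrightarrow> sum f A \<in> I"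
  unfolding is_ideal_def by (rule module.subspace_sum[OF module_times])

lemma ideal_cong: "is_ideal I \<Longrightarrow> x - y \<in> I \<Longrightarrow> x \<in> I \<longleftrightarrow> y \<in> I"
  using ideal_add[of I "x - y" y] ideal_diff[of I x "x - y"] by auto

lemma ideal_prod_cong:
  assumes "is_ideal I" "\<And>a. a \<in> A \<Longrightarrow> f a - g a \<in> I"
  shows "prod f A - prod g A \<in> I"
  using assms(2)
proof (induction A rule: infinite_finite_induct)
  case (insert a A)
  have "prod f (insert a A) - prod g (insert a A)
      = (f a - g a) * prod f A + g a * (prod f A - prod g A)"
    using insert.hyps by (simp add: algebra_simps)
  also have "\<dots> \<in> I"
    using insert by (intro ideal_add[OF assms(1)] ideal_mult[OF assms(1)] ideal_mult_right[OF assms(1)]) auto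
  finally show ?case .
qed (simp_all add: ideal_0[OF assms(1)])

lemma is_ideal_gen: "is_ideal (ideal_gen S)"
  unfolding is_ideal_def ideal_gen_def by (rule module.subspace_span[OF module_times])

lemma ideal_gen_base: "x \<in> S \<Longrightarrow> x \<in> ideal_gen S"
  unfolding ideal_gen_def by (rule module.span_base[OF module_times])

lemma ideal_gen_least: "is_ideal I \<Longrightarrow> S \<subseteq> I \<Longrightarrow> ideal_gen S \<subseteq> I"
  unfolding is_ideal_def ideal_gen_def by (rule module.span_minimal[OF module_times])

lemma ideal_gen_image_iff:
  assumes "finite A"
  shows "p \<in> ideal_gen (f ` A) \<longleftrightarrow> (\<exists>c. p = (\<Sum>a\<in>A. c a * f a))"
proof
  let ?I = "{p. \<exists>c. p = (\<Sum>a\<in>A. c a * f a)}"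
  have "is_ideal ?I"
  proof (rule is_idealI)
    show "0 \<in> ?I" by (auto intro: exI[of _ "\<lambda>_. 0"])
    fix x y assume "x \<in> ?I" "y \<in> ?I"
    then obtain c d where "x = (\<Sum>a\<in>A. c a * f a)" "y = (\<Sum>a\<in>A. d a * f a)" by blast
    then have "x + y = (\<Sum>a\<in>A. (c a + d a) * f a)"
      by (simp only: distrib_right sum.distrib)
    then show "x + y \<in> ?I" by (intro CollectI exI)
  next
    fix r x assume "x \<in> ?I"
    then obtain c where "x = (\<Sum>a\<in>A. c a * f a)" by blast
    then have "r * x = (\<Sum>a\<in>A. (r * c a) * f a)"
      by (simp only: mult.assoc sum_distrib_left)
    then show "r * x \<in> ?I" by (intro CollectI exI)
  qed
  moreover have "f ` A \<subseteq> ?I"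
  proof
    fix x assume "x \<in> f ` A"
    then obtain a where a: "a \<in> A" "x = f a" by blast
    have "(\<Sum>b\<in>A. (if b = a then 1 else 0) * f b) = (\<Sum>b\<in>A. if b = a then f b else 0)"
      by (intro sum.cong) auto
    also have "\<dots> = f a" using a assms by simp
    finally show "x \<in> ?I" using a(2) by (auto intro!: exI[of _ "\<lambda>b. if b = a then 1 else 0"])
  qed
  moreover assume "p \<in> ideal_gen (f ` A)"
  ultimately show "\<exists>c. p = (\<Sum>a\<in>A. c a * f a)" using ideal_gen_least by blast
next
  assume "\<exists>c. p = (\<Sum>a\<in>A. c a * f a)"
  then show "p \<in> ideal_gen (f ` A)"
    by (metis (no_types, lifting) ideal_sum ideal_mult is_ideal_gen ideal_gen_base imageI)
qed

lemma is_ideal_plus: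
  assumes "is_ideal I" "is_ideal J"
  shows "is_ideal (I + J)"
proof (rule is_idealI)
  show "0 \<in> I + J" using set_plus_intro[OF ideal_0[OF assms(1)] ideal_0[OF assms(2)]] by simp
  fix x y assume "x \<in> I + J" "y \<in> I + J"
  then obtain a b c d where *: "x = a + b" "y = c + d" "a \<in> I" "b \<in> J" "c \<in> I" "d \<in> J"
    by (auto simp: set_plus_def)
  have "x + y = (a + c) + (b + d)" by (simp add: *)
  then show "x + y \<in> I + J"
    using * assms by (metis ideal_add set_plus_intro)
next
  fix r x assume "x \<in> I + J"
  then obtain a b where *: "x = a + b" "a \<in> I" "b \<in> J" by (auto simp: set_plus_def)
  have "r * x = r * a + r * b" by (simp add: * algebra_simps)
  then show "r * x \<in> I + J" using * assms by (metis ideal_mult set_plus_intro)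
qed

lemma subset_plus_ideal: "is_ideal J \<Longrightarrow> I \<subseteq> I + J" "is_ideal J \<Longrightarrow> I \<subseteq> J + I"
  using set_plus_intro[of _ I 0 J] set_plus_intro[of 0 J _ I] by (auto dest: ideal_0)

section \<open>Determinants over commutative rings\<close>

lemma det_row_in_ideal:
  fixes A :: "'a::comm_ring_1^'n::finite^'n"
  assumes "is_ideal I" "\<And>j. A $ k $ j \<in> I"
  shows "det A \<in> I"
  unfolding det_def
proof (rule ideal_sum[OF assms(1)])
  fix p :: "'n \<Rightarrow> 'n"
  have "(\<Prod>i\<in>UNIV. A $ i $ p i) = A $ k $ p k * (\<Prod>i\<in>UNIV - {k}. A $ i $ p i)"
    by (simp add: prod.remove)
  also have "\<dots> \<in> I" by (intro ideal_mult_right assms)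
  finally show "of_int (sign p) * (\<Prod>i\<in>UNIV. A $ i $ p i) \<in> I" by (rule ideal_mult[OF assms(1)])
qed

lemma det_cong_ideal:
  fixes A B :: "'a::comm_ring_1^'n::finite^'n"
  assumes "is_ideal I" "\<And>i j. A $ i $ j - B $ i $ j \<in> I"
  shows "det A - det B \<in> I"
proof -
  have "det A - det B = (\<Sum>p\<in>{p. p permutes UNIV}. of_int (sign p) *
      ((\<Prod>i\<in>UNIV. A $ i $ p i) - (\<Prod>i\<in>UNIV. B $ i $ p i)))"
    unfolding det_def by (simp add: sum_subtractf right_diff_distrib)
  also have "\<dots> \<in> I"
    by (intro ideal_sum[OF assms(1)] ideal_mult[OF assms(1)] ideal_prod_cong[OF assms(1)] assms(2))
  finally show ?thesis .
qed

text \<open>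
  Cramer's rule: replacing row \<open>k\<close> of \<open>A\<close> by the combination \<open>x A\<close> of its rows multiplies the
  determinant by \<open>x\<^sub>k\<close>, and a matrix with a row in \<open>I\<close> has its determinant in \<open>I\<close>. It is used both for
  \<open>x\<close> the indeterminates (the determinant is then a socle element) and for \<open>x\<close> a list of
  generators (the determinant then carries one ideal into another).
\<close>

lemma cramer_ideal:
  fixes A :: "'a::comm_ring_1^'n::finite^'n"
  assumes I: "is_ideal I" and x: "\<And>j. (\<Sum>i\<in>UNIV. x i * A $ i $ j) \<in> I"
  shows "x k * det A \<in> I"
proof -
  let ?R = "\<lambda>v. det (\<chi> i. if i = k then v else A $ i)"
  have sc: "?R (x i *s A $ i) = (if i = k then x k * det A else 0)" for i
  proof -
    have "?R (x i *s A $ i) = x i * ?R (A $ i)"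
      using det_row_mul[of k "x i" "\<lambda>_. A $ i" "\<lambda>i. A $ i"] .
    moreover have "?R (A $ i) = 0" if "i \<noteq> k"
      using that by (intro det_identical_rows[of i k]) (auto simp: row_def vec_eq_iff)
    moreover have "(\<chi> i. if i = k then A $ k else A $ i) = A" by (simp add: vec_eq_iff)
    ultimately show ?thesis by auto
  qed
  have "?R (\<Sum>i\<in>UNIV. x i *s A $ i) = (\<Sum>i\<in>UNIV. ?R (x i *s A $ i))"
    using det_linear_row_sum[of UNIV k "\<lambda>_ i. x i *s A $ i" "\<lambda>i. A $ i"] by simp
  also have "\<dots> = x k * det A" unfolding sc by simp
  finally have "x k * det A = ?R (\<Sum>i\<in>UNIV. x i *s A $ i)" by simp
  also have "\<dots> \<in> I" by (rule det_row_in_ideal[OF I, of _ k]) (simp add: x)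
  finally show ?thesis .
qed

section \<open>Terms and polynomials\<close>

abbreviation "lookup \<equiv> Poly_Mapping.lookup"
abbreviation "keys \<equiv> Poly_Mapping.keys"
abbreviation "single \<equiv> Poly_Mapping.single"

lemma tdeg_0 [simp]: "tdeg 0 = 0"
  by (simp add: tdeg_def)

lemma tdeg_add [simp]: "tdeg (s + u) = tdeg s + tdeg u"
  by (simp add: tdeg_def lookup_add sum.distrib)

lemma lookup_var_trm: "lookup (var_trm x) y = (if x = y then 1 else 0)"
  by (simp add: var_trm_def lookup_single when_def)

lemma tdeg_var_trm [simp]: "tdeg (var_trm x) = 1"
  by (simp add: tdeg_def lookup_var_trm)

lemma tdeg_eq_0_iff: "tdeg s = 0 \<longleftrightarrow> s = 0"
  by (auto simp: tdeg_def intro!: poly_mapping_eqI)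

lemma trm_diffE:
  fixes s u :: "'n trm"
  assumes "\<And>x. lookup u x \<le> lookup s x"
  obtains w where "s = u + w"
proof
  show "s = u + (s - u)"
    using assms by (intro poly_mapping_eqI) (simp add: lookup_add lookup_minus)
qed

lemma trm_nonzeroE:
  fixes s :: "'n trm"
  assumes "s \<noteq> 0"
  obtains x w where "s = var_trm x + w"
proof -
  have "\<exists>x. lookup s x > 0"
  proof (rule ccontr)
    assume "\<not> (\<exists>x. lookup s x > 0)"
    then have "s = 0" by (intro poly_mapping_eqI) simp
    with assms show False by simp
  qed
  then obtain x where x: "lookup s x > 0" by blast
  show thesis
  proof (rule trm_diffE[of "var_trm x" s])
    show "lookup (var_trm x) y \<le> lookup s y" for y
      using x by (auto simp: lookup_var_trm)
  qed (rule that)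
qed

lemma trm_induct [case_names 0 var]:
  fixes s :: "'n::finite trm"
  assumes "P 0" "\<And>r s. P s \<Longrightarrow> P (var_trm r + s)"
  shows "P s"
proof (induction "tdeg s" arbitrary: s)
  case 0 then show ?case using assms(1) by (simp add: tdeg_eq_0_iff)
next
  case (Suc d)
  then have "s \<noteq> 0" by auto
  then obtain x w where w: "s = var_trm x + w" by (rule trm_nonzeroE)
  then have "d = tdeg w" using Suc(2) by simp
  then show ?case using Suc(1) assms(2) w by blast
qed

lemma single_eq_Const_Monom:
  "single s c = Const c * (Monom s :: ('n, 'a::comm_semiring_1) mpol)"
  by (simp add: Const_def Monom_def mult_single)

lemma Monom_add: "Monom (s + u) = Monom s * (Monom u :: ('n, 'a::comm_semiring_1) mpol)"
  by (simp add: Monom_def mult_single)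

lemma Monom_0 [simp]: "Monom 0 = (1 :: ('n, 'a::comm_semiring_1) mpol)"
  by (simp add: Monom_def)

lemma Const_0 [simp]: "Const 0 = 0"
  by (simp add: Const_def)

lemma Const_1 [simp]: "Const 1 = (1 :: ('n, 'a::comm_semiring_1) mpol)"
  by (simp add: Const_def)

lemma Const_add: "Const (a + b) = Const a + (Const b :: ('n, 'a::comm_ring_1) mpol)"
  by (simp add: Const_def single_add)

lemma Const_mult: "Const (a * b) = Const a * (Const b :: ('n, 'a::comm_ring_1) mpol)"
  by (simp add: Const_def mult_single)

lemma Const_minus: "Const (- a) = - (Const a :: ('n, 'a::comm_ring_1) mpol)"
  by (simp add: Const_def single_uminus)

lemma Const_diff: "Const (a - b) = Const a - (Const b :: ('n, 'a::comm_ring_1) mpol)"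
  by (simp add: Const_def single_diff)

lemma Const_sum: "Const (sum f A) = (\<Sum>a\<in>A. Const (f a) :: ('n, 'a::comm_ring_1) mpol)"
  by (induction A rule: infinite_finite_induct) (auto simp: Const_add)

lemma mpol_expand:
  fixes p :: "('n, 'a::comm_monoid_add) mpol"
  assumes "finite S" "keys p \<subseteq> S"
  shows "p = (\<Sum>s\<in>S. single s (lookup p s))"
proof (rule poly_mapping_eqI)
  fix u
  have "lookup (\<Sum>s\<in>S. single s (lookup p s)) u = (\<Sum>s\<in>S. if s = u then lookup p u else 0)"
    by (auto simp: lookup_sum lookup_single when_def intro!: sum.cong)
  also have "\<dots> = lookup p u" using assms by (auto simp: in_keys_iff)
  finally show "lookup p u = lookup (\<Sum>s\<in>S. single s (lookup p s)) u" by simp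
qed

lemma mpol_induct [case_names single add]:
  fixes p :: "('n, 'a::comm_monoid_add) mpol"
  assumes single: "\<And>s c. P (single s c)" and add: "\<And>p q. P p \<Longrightarrow> P q \<Longrightarrow> P (p + q)"
  shows "P p"
proof -
  have "P (\<Sum>s\<in>S. single s (lookup p s))" if "finite S" for S
    using that by (induction S) (auto intro: assms single[of 0 0, simplified])
  from this[of "keys p"] show ?thesis using mpol_expand[of "keys p" p] by simp
qed

lemma additive_imp_multiplicative:
  fixes f :: "('n, 'a::comm_ring_1) mpol \<Rightarrow> 'b::comm_ring_1"
  assumes add: "\<And>p q. f (p + q) = f p + f q"
    and single: "\<And>s c u d. f (single (s + u) (c * d))
      = f (single s c) * f (single u d)"
  shows "f (p * q) = f p * f q"
proof (induction p rule: mpol_induct)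
  case (single s c)
  show ?case
  proof (induction q rule: mpol_induct)
    case (single u d)
    then show ?case by (simp add: mult_single assms(2))
  next
    case (add q r)
    then show ?case by (simp add: distrib_left assms(1))
  qed
next
  case (add p r)
  then show ?case by (simp add: distrib_right assms(1))
qed

lemma lookup_single_mult_add:
  fixes p :: "('n, 'a::comm_ring_1) mpol"
  shows "lookup (single s c * p) (s + u) = c * lookup p u"
  by (induction p rule: mpol_induct)
    (auto simp: mult_single lookup_single when_def distrib_left lookup_add)

lemma lookup_single_mult_other:
  fixes p :: "('n, 'a::comm_ring_1) mpol"
  assumes "\<And>u. v \<noteq> s + u"
  shows "lookup (single s c * p) v = 0"
  using assms[symmetric] by (induction p rule: mpol_induct)
    (auto simp: mult_single lookup_single when_def distrib_left lookup_add)

lemma lookup_Const_mult: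
  fixes p :: "('n, 'a::comm_ring_1) mpol"
  shows "lookup (Const c * p) u = c * lookup p u"
  using lookup_single_mult_add[of 0 c p u] by (simp add: Const_def)

lemma lookup_Monom_mult_add:
  fixes p :: "('n, 'a::comm_ring_1) mpol"
  shows "lookup (Monom s * p) (s + u) = lookup p u"
  using lookup_single_mult_add[of s 1 p u] by (simp add: Monom_def)

lemma lookup_Monom_mult_other:
  fixes p :: "('n, 'a::comm_ring_1) mpol"
  shows "lookup s x > lookup v x \<Longrightarrow> lookup (Monom s * p) v = 0"
  unfolding Monom_def by (rule lookup_single_mult_other) (auto simp: lookup_add)

lemma lookup_Monom: "lookup (Monom s) u = (if s = u then 1 else 0)"
  by (simp add: Monom_def lookup_single when_def)

lemma lookup_Const: "lookup (Const c) u = (if u = 0 then c else 0)"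
  by (simp add: Const_def lookup_single when_def)

subsection \<open>Degrees and homogeneous components\<close>

definition deg_le :: "nat \<Rightarrow> ('n::finite, 'a::zero) mpol \<Rightarrow> bool"
  where "deg_le d p \<longleftrightarrow> (\<forall>s. tdeg s > d \<longrightarrow> lookup p s = 0)"

definition hom_deg :: "nat \<Rightarrow> ('n::finite, 'a::zero) mpol \<Rightarrow> bool"
  where "hom_deg d p \<longleftrightarrow> (\<forall>s. tdeg s \<noteq> d \<longrightarrow> lookup p s = 0)"

definition hcomp :: "nat \<Rightarrow> ('n::finite, 'a::comm_monoid_add) mpol \<Rightarrow> ('n, 'a) mpol"
  where "hcomp d p = (\<Sum>s\<in>{s\<in>keys p. tdeg s = d}. single s (lookup p s))"

lemma lookup_hcomp: "lookup (hcomp d p) s = (if tdeg s = d then lookup p s else 0)"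
proof -
  have "lookup (hcomp d p) s = (\<Sum>u\<in>{u\<in>keys p. tdeg u = d}. if u = s then lookup p s else 0)"
    by (auto simp: hcomp_def lookup_sum lookup_single when_def intro!: sum.cong)
  also have "\<dots> = (if tdeg s = d then lookup p s else 0)" by (auto simp: in_keys_iff)
  finally show ?thesis .
qed

lemma hom_deg_hcomp [simp]: "hom_deg d (hcomp d p)"
  by (simp add: hom_deg_def lookup_hcomp)

lemma hom_deg_imp_deg_le: "hom_deg d p \<Longrightarrow> deg_le d p"
  by (simp add: hom_deg_def deg_le_def)

lemma hcomp_hom_deg: "hom_deg d p \<Longrightarrow> hcomp e p = (if e = d then p else 0)"
  by (auto simp: hom_deg_def lookup_hcomp intro!: poly_mapping_eqI)

lemma hcomp_add: "hcomp d (p + q) = hcomp d p + hcomp d q"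
  by (auto simp: lookup_hcomp lookup_add intro!: poly_mapping_eqI)

lemma hcomp_0 [simp]: "hcomp d 0 = 0"
  by (auto simp: lookup_hcomp intro!: poly_mapping_eqI)

lemma hcomp_sum: "hcomp d (sum f A) = (\<Sum>a\<in>A. hcomp d (f a))"
  by (auto simp: lookup_hcomp lookup_sum intro!: poly_mapping_eqI)

lemma hcomp_diff: "hcomp d (p - q :: ('n::finite, 'a::ab_group_add) mpol) = hcomp d p - hcomp d q"
  by (auto simp: lookup_hcomp lookup_minus intro!: poly_mapping_eqI)

lemma hcomp_minus: "hcomp d (- p :: ('n::finite, 'a::ab_group_add) mpol) = - hcomp d p"
  by (auto simp: lookup_hcomp intro!: poly_mapping_eqI)

lemma deg_le_hcomp_0: "deg_le d p \<Longrightarrow> d < e \<Longrightarrow> hcomp e p = 0"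
  by (auto simp: deg_le_def lookup_hcomp intro!: poly_mapping_eqI)

lemma ex_deg_le: "\<exists>d. deg_le d p"
proof -
  have "tdeg s \<le> (\<Sum>s\<in>keys p. tdeg s)" if "s \<in> keys p" for s
    using that by (intro member_le_sum) auto
  then show ?thesis unfolding deg_le_def in_keys_iff by (metis not_le)
qed

lemma ex_deg_le_finite:
  assumes "finite A"
  shows "\<exists>d. \<forall>a\<in>A. deg_le d (f a)"
proof -
  have "\<forall>a. \<exists>d. deg_le d (f a)" by (simp add: ex_deg_le)
  then obtain D where D: "deg_le (D a) (f a)" for a by metis
  have "D a \<le> sum D A" if "a \<in> A" for a using that assms by (intro member_le_sum) auto
  then show ?thesis using D unfolding deg_le_def by (metis order_le_less_trans)
qed

lemma deg_le_mono: "deg_le d p \<Longrightarrow> d \<le> e \<Longrightarrow> deg_le e p"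
  by (simp add: deg_le_def)

lemma deg_le_keys: "deg_le d p \<Longrightarrow> s \<in> keys p \<Longrightarrow> tdeg s \<le> d"
  unfolding deg_le_def in_keys_iff by (meson not_le)

lemma deg_le_0 [simp]: "deg_le d 0"
  by (simp add: deg_le_def)

lemma deg_le_1 [simp]: "deg_le d 1"
  by (simp add: deg_le_def lookup_one when_def)

lemma deg_le_add: "deg_le d p \<Longrightarrow> deg_le d q \<Longrightarrow> deg_le d (p + q)"
  by (simp add: deg_le_def lookup_add)

lemma deg_le_minus: "deg_le d (p :: ('n::finite, 'a::ab_group_add) mpol) \<Longrightarrow> deg_le d (- p)"
  by (simp add: deg_le_def)

lemma deg_le_diff: "deg_le d (p :: ('n::finite, 'a::ab_group_add) mpol) \<Longrightarrow> deg_le d q \<Longrightarrow> deg_le d (p - q)"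
  by (simp add: deg_le_def lookup_minus)

lemma deg_le_sum: "(\<And>a. a \<in> A \<Longrightarrow> deg_le d (f a)) \<Longrightarrow> deg_le d (sum f A)"
  by (simp add: deg_le_def lookup_sum)

lemma deg_le_Monom: "tdeg s \<le> d \<Longrightarrow> deg_le d (Monom s)"
  by (auto simp: deg_le_def lookup_Monom)

lemma hom_deg_Monom: "tdeg s = d \<Longrightarrow> hom_deg d (Monom s)"
  by (auto simp: hom_deg_def lookup_Monom)

lemma mpol_sum_hcomp:
  assumes "deg_le D p"
  shows "p = (\<Sum>d\<le>D. hcomp d p)"
proof (rule poly_mapping_eqI)
  fix s
  show "lookup p s = lookup (\<Sum>d\<le>D. hcomp d p) s"
    using assms by (auto simp: lookup_sum lookup_hcomp deg_le_def)
qed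

lemma mult_expand:
  fixes p q :: "('n, 'a::comm_ring_1) mpol"
  shows "p * q = (\<Sum>s\<in>keys p. \<Sum>u\<in>keys q. single (s + u) (lookup p s * lookup q u))"
proof -
  have "p * q = (\<Sum>s\<in>keys p. single s (lookup p s)) *
      (\<Sum>u\<in>keys q. single u (lookup q u))"
    using mpol_expand[of "keys p" p] mpol_expand[of "keys q" q] by simp
  then show ?thesis by (simp only: sum_product mult_single)
qed

lemma hcomp_mult_expand:
  fixes p q :: "('n::finite, 'a::comm_ring_1) mpol"
  shows "hcomp d (p * q) = (\<Sum>s\<in>keys p. \<Sum>u\<in>keys q.
    if tdeg s + tdeg u = d then single (s + u) (lookup p s * lookup q u) else 0)"
proof -
  have "hcomp d (p * q) = (\<Sum>s\<in>keys p. \<Sum>u\<in>keys q.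
      hcomp d (single (s + u) (lookup p s * lookup q u)))"
    by (subst mult_expand) (simp only: hcomp_sum)
  moreover have h: "hcomp d (single (s + u) c)
      = (if tdeg s + tdeg u = d then single (s + u) c else 0)" for s u and c :: 'a
    by (rule poly_mapping_eqI) (auto simp: lookup_hcomp lookup_single when_def)
  ultimately show ?thesis by (simp only: h)
qed

text \<open>
  Passing to the component in the degree bound is multiplicative. This is how determinants are
  computed from their top degree parts and syzygies from their leading forms.
\<close>

lemma hcomp_mult:
  fixes p q :: "('n::finite, 'a::comm_ring_1) mpol"
  assumes "deg_le d p" "deg_le e q"
  shows "hcomp (d + e) (p * q) = hcomp d p * hcomp e q"
proof -
  note * = deg_le_keys[OF assms(1)] and ** = deg_le_keys[OF assms(2)]
  have "hcomp (d + e) (p * q) = (\<Sum>s\<in>keys p. if tdeg s = d then (\<Sum>u\<in>keys q. if tdeg u = e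
    then single (s + u) (lookup p s * lookup q u) else 0) else 0)"
    unfolding hcomp_mult_expand
  proof (rule sum.cong[OF refl])
    fix s assume s: "s \<in> keys p"
    show "(\<Sum>u\<in>keys q. if tdeg s + tdeg u = d + e
        then single (s + u) (lookup p s * lookup q u) else 0) =
      (if tdeg s = d then (\<Sum>u\<in>keys q. if tdeg u = e
        then single (s + u) (lookup p s * lookup q u) else 0) else 0)"
    proof (cases "tdeg s = d")
      case False
      then have "tdeg s + tdeg u \<noteq> d + e" if "u \<in> keys q" for u
        using *[OF s] **[OF that] by linarith
      then show ?thesis using False by simp
    qed simp
  qed
  also have "\<dots> = hcomp d p * hcomp e q"
    unfolding hcomp_def sum_product mult_single by (simp only: sum.inter_filter[OF finite_keys])
  finally show ?thesis .
qed

lemma deg_le_mult: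
  fixes p q :: "('n::finite, 'a::comm_ring_1) mpol"
  assumes "deg_le d p" "deg_le e q"
  shows "deg_le (d + e) (p * q)"
proof -
  have "tdeg s \<le> d + e" if "s \<in> keys (p * q)" for s
  proof -
    from that keys_mult obtain a b where "s = a + b" "a \<in> keys p" "b \<in> keys q" by blast
    then show ?thesis using deg_le_keys[OF assms(1)] deg_le_keys[OF assms(2)] by (simp add: add_mono)
  qed
  then show ?thesis unfolding deg_le_def in_keys_iff by (meson not_le)
qed

lemma hom_deg_mult:
  fixes p q :: "('n::finite, 'a::comm_ring_1) mpol"
  assumes "hom_deg d p" "hom_deg e q"
  shows "hom_deg (d + e) (p * q)"
  using hcomp_mult[OF assms[THEN hom_deg_imp_deg_le]] assms
  by (metis hcomp_hom_deg hom_deg_hcomp)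

lemma hcomp_mult_hom:
  fixes p q :: "('n::finite, 'a::comm_ring_1) mpol"
  assumes "hom_deg d p"
  shows "hcomp k (q * p) = (if d \<le> k then hcomp (k - d) q * p else 0)"
proof -
  obtain D where D: "deg_le D q" using ex_deg_le by blast
  have "hcomp k (q * p) = (\<Sum>e\<le>D. hcomp k (hcomp e q * p))"
    by (subst mpol_sum_hcomp[OF D]) (simp add: sum_distrib_right hcomp_sum)
  also have "\<dots> = (\<Sum>e\<le>D. if k = e + d then hcomp e q * p else 0)"
    by (intro sum.cong refl) (simp add: hcomp_hom_deg[OF hom_deg_mult[OF hom_deg_hcomp assms]])
  also have "\<dots> = (\<Sum>e\<le>D. if e = k - d then (if d \<le> k then hcomp (k - d) q * p else 0) else 0)"
    by (intro sum.cong refl) auto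
  also have "\<dots> = (if d \<le> k then hcomp (k - d) q * p else 0)"
    using D by (auto simp: deg_le_hcomp_0)
  finally show ?thesis .
qed

lemma deg_le_prod:
  fixes f :: "'i \<Rightarrow> ('n::finite, 'a::comm_ring_1) mpol"
  assumes "\<And>i. i \<in> A \<Longrightarrow> deg_le (d i) (f i)"
  shows "deg_le (sum d A) (prod f A)"
  using assms
  by (induction A rule: infinite_finite_induct) (auto intro!: deg_le_mult)

lemma hcomp_prod:
  fixes f :: "'i \<Rightarrow> ('n::finite, 'a::comm_ring_1) mpol"
  assumes "\<And>i. i \<in> A \<Longrightarrow> deg_le (d i) (f i)"
  shows "hcomp (sum d A) (prod f A) = (\<Prod>i\<in>A. hcomp (d i) (f i))"
  using assms
proof (induction A rule: infinite_finite_induct)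
  case (insert a A)
  then show ?case by (simp add: hcomp_mult deg_le_prod)
qed (auto simp: lookup_hcomp lookup_one when_def intro!: poly_mapping_eqI)

lemma deg_le_power:
  fixes p :: "('n::finite, 'a::comm_ring_1) mpol"
  assumes "deg_le d p" shows "deg_le (d * k) (p ^ k)"
  using deg_le_prod[of "{..<k}" "\<lambda>_. d" "\<lambda>_. p"] assms by (simp add: mult.commute)

lemma Indet_power: "Indet x ^ k = (Monom (single x k) :: ('n, 'a::comm_ring_1) mpol)"
proof (induction k)
  case (Suc k)
  have "single x (Suc k) = var_trm x + single x k"
    by (simp add: var_trm_def single_add[symmetric])
  then show ?case using Suc by (simp add: Monom_add Indet_def)
qed simp

lemma tdeg_single [simp]: "tdeg (single x k) = k"
  by (simp add: tdeg_def lookup_single when_def)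


section \<open>A residue functional\<close>

definition tm :: "('n::finite \<Rightarrow> nat) \<Rightarrow> 'n trm"
  where "tm k = Poly_Mapping.Abs_poly_mapping k"

lemma lookup_tm [simp]: "lookup (tm k) = k"
  unfolding tm_def by (rule lookup_Abs_poly_mapping) simp

lemma tm_lookup: "tm (lookup s) = s"
  by (rule poly_mapping_eqI) simp

lemma tm_eq_iff: "tm k = tm l \<longleftrightarrow> k = l"
  using lookup_tm by metis

lemma tdeg_tm: "tdeg (tm k) = (\<Sum>j\<in>UNIV. k j)"
  by (simp add: tdeg_def)

definition cube :: "nat \<Rightarrow> ('n::finite \<Rightarrow> nat) set"
  where "cube M = {k. \<forall>j. k j \<le> M}"

lemma finite_cube [simp]: "finite (cube M)"
proof -
  have *: "cube M = PiE UNIV (\<lambda>_. {..M})" by (auto simp: cube_def PiE_def extensional_def)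
  show ?thesis unfolding * by (rule finite_PiE) auto
qed

text \<open>
  Modulo \<open>F\<close>, an element killed by all indeterminates is only seen by constant terms. In particular
  multipliers with constant term 1 act on it as the identity, which is what makes them serve as the
  units of the local ring at the origin.
\<close>

lemma mult_annihilated:
  fixes w :: "('n::finite, 'k::comm_ring_1) mpol"
  assumes F: "is_ideal F" and w: "\<And>i. Indet i * w \<in> F"
  shows "r * w - Const (lookup r 0) * w \<in> F"
proof (induction r rule: mpol_induct)
  case (single s c)
  show ?case
  proof (cases "s = 0")
    case True then show ?thesis by (simp add: Const_def ideal_0[OF F])
  next
    case False
    then obtain i t where t: "s = var_trm i + t" by (rule trm_nonzeroE)
    have "single s c * w = (Const c * Monom t) * (Indet i * w)"
      by (simp only: single_eq_Const_Monom t Monom_add Indet_def mult_ac)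
    also have "\<dots> \<in> F" by (intro ideal_mult[OF F] w)
    finally show ?thesis using False by (simp add: lookup_single when_def)
  qed
next
  case (add p q)
  have "(p + q) * w - Const (lookup (p + q) 0) * w
     = (p * w - Const (lookup p 0) * w) + (q * w - Const (lookup q 0) * w)"
    by (simp add: lookup_add Const_add algebra_simps)
  then show ?case using add ideal_add[OF F] by simp
qed

text \<open>
  The perturbed sequence \<open>f\<^sub>j = x\<^sub>j\<^sup>N - e\<^sub>j\<close>. Expanding \<open>1 / f\<^sub>j\<close> as a geometric series in
  \<open>e\<^sub>j / x\<^sub>j\<^sup>N\<close> turns the Grothendieck residue of \<open>p dx / (f\<^sub>1 \<dots> f\<^sub>n)\<close> at infinity into the sum
  over all exponent vectors \<open>k\<close> of the coefficient of \<open>x\<^sub>1\<^sup>N\<^sup>-\<^sup>1 \<dots> x\<^sub>n\<^sup>N\<^sup>-\<^sup>1 x\<^sup>N\<^sup>k\<close> in \<open>p e\<^sup>k\<close>,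
  here called \<open>tau p\<close>. The sum is finite because each factor \<open>e\<^sub>j\<close> raises the degree by less than
  \<open>N\<close>, the degree by which it moves the monomial.
\<close>

locale residue =
  fixes e :: "'n::finite \<Rightarrow> ('n, 'k::field) mpol" and N :: nat
  assumes N_pos: "N > 0" and deg_e: "deg_le (N - 1) (e j)"
begin

definition f :: "'n \<Rightarrow> ('n, 'k) mpol"
  where "f j = Indet j ^ N - e j"

definition F :: "('n, 'k) mpol set"
  where "F = ideal_gen (range f)"

definition corner :: "('n \<Rightarrow> nat) \<Rightarrow> 'n trm"
  where "corner k = tm (\<lambda>j. (N - 1) + N * k j)"

definition res_term :: "('n, 'k) mpol \<Rightarrow> ('n \<Rightarrow> nat) \<Rightarrow> 'k"
  where "res_term p k = lookup (p * (\<Prod>j\<in>UNIV. e j ^ k j)) (corner k)"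

definition tau :: "('n, 'k) mpol \<Rightarrow> 'k"
  where "tau p = (\<Sum>k\<in>{k. res_term p k \<noteq> 0}. res_term p k)"

definition top_deg :: nat
  where "top_deg = CARD('n) * (N - 1)"

lemma is_ideal_F: "is_ideal F"
  unfolding F_def by (rule is_ideal_gen)

lemma f_in_F: "f j \<in> F"
  unfolding F_def by (intro ideal_gen_base) simp

lemma tdeg_corner: "tdeg (corner k) = top_deg + N * (\<Sum>j\<in>UNIV. k j)"
  by (simp add: corner_def tdeg_tm top_deg_def sum.distrib sum_distrib_left)

lemma res_term_eq_0:
  assumes "deg_le D p" "D < top_deg + (\<Sum>j\<in>UNIV. k j)"
  shows "res_term p k = 0"
proof -
  have "deg_le (D + (\<Sum>j\<in>UNIV. (N - 1) * k j)) (p * (\<Prod>j\<in>UNIV. e j ^ k j))"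
    by (intro deg_le_mult assms(1) deg_le_prod deg_le_power deg_e)
  moreover have "N * (\<Sum>j\<in>UNIV. k j) = (N - 1) * (\<Sum>j\<in>UNIV. k j) + (\<Sum>j\<in>UNIV. k j)"
    using N_pos by (cases N) auto
  then have "D + (\<Sum>j\<in>UNIV. (N - 1) * k j) < tdeg (corner k)"
    using assms(2) by (simp add: tdeg_corner sum_distrib_left)
  ultimately show ?thesis unfolding res_term_def deg_le_def by blast
qed

lemma res_term_support:
  assumes "deg_le D p"
  shows "{k. res_term p k \<noteq> 0} \<subseteq> cube D"
proof
  fix k assume "k \<in> {k. res_term p k \<noteq> 0}"
  then have "\<not> D < top_deg + (\<Sum>j\<in>UNIV. k j)" using res_term_eq_0[OF assms] by blast
  moreover have "k j \<le> (\<Sum>j\<in>UNIV. k j)" for j by (rule member_le_sum) auto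
  ultimately have "k j \<le> D" for j by (meson le_trans not_le trans_le_add2)
  then show "k \<in> cube D" by (simp add: cube_def)
qed

lemma tau_eq:
  assumes "finite K" "{k. res_term p k \<noteq> 0} \<subseteq> K"
  shows "tau p = (\<Sum>k\<in>K. res_term p k)"
  unfolding tau_def by (rule sum.mono_neutral_left) (use assms in auto)

lemma tau_cube: "deg_le D p \<Longrightarrow> tau p = (\<Sum>k\<in>cube D. res_term p k)"
  by (rule tau_eq[OF finite_cube res_term_support])

lemma tau_add: "tau (p + q) = tau p + tau q"
proof -
  obtain D where D: "\<forall>r\<in>{p, q}. deg_le D r" using ex_deg_le_finite[of "{p, q}" id] by auto
  then have "deg_le D (p + q)" by (simp add: deg_le_add)
  then have "tau (p + q) = (\<Sum>k\<in>cube D. res_term (p + q) k)" by (rule tau_cube)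
  also have "\<dots> = (\<Sum>k\<in>cube D. res_term p k) + (\<Sum>k\<in>cube D. res_term q k)"
    by (simp add: res_term_def distrib_right lookup_add sum.distrib)
  also have "\<dots> = tau p + tau q" using D tau_cube[of D p] tau_cube[of D q] by simp
  finally show ?thesis .
qed

lemma tau_scale: "tau (Const c * p) = c * tau p"
proof -
  obtain D where D: "deg_le D p" using ex_deg_le by blast
  have "deg_le (0 + D) (Const c * p)"
    by (rule deg_le_mult[OF _ D]) (auto simp: deg_le_def lookup_Const)
  then have "tau (Const c * p) = (\<Sum>k\<in>cube D. res_term (Const c * p) k)" using tau_cube by simp
  also have "\<dots> = c * (\<Sum>k\<in>cube D. res_term p k)"
    by (simp add: res_term_def mult.assoc lookup_Const_mult sum_distrib_left)
  also have "\<dots> = c * tau p" using tau_cube[OF D] by simp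
  finally show ?thesis .
qed

lemma tau_0 [simp]: "tau 0 = 0"
  by (simp add: tau_def res_term_def)

lemma tau_minus: "tau (- p) = - tau p"
  using tau_add[of p "- p"] by (simp add: add_eq_0_iff)

lemma tau_diff: "tau (p - q) = tau p - tau q"
  using tau_add[of p "- q"] by (simp add: tau_minus)

lemma tau_sum: "tau (sum g A) = (\<Sum>a\<in>A. tau (g a))"
  by (induction A rule: infinite_finite_induct) (auto simp: tau_add)

text \<open>
  Shifting \<open>k\<^sub>j\<close> by one matches the terms of the two sums; on the left, those with \<open>k\<^sub>j = 0\<close> vanish
  because \<open>x\<^sub>j\<close> occurs in the corner with exponent \<open>N - 1 < N\<close> only. Hence \<open>tau\<close> vanishes on the
  ideal of the \<open>f\<^sub>j\<close>.
\<close>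

lemma tau_power_eq: "tau (Indet j ^ N * p) = tau (e j * p)"
proof -
  let ?S = "\<lambda>k. k(j := Suc (k j))"
  obtain D where D: "\<forall>r\<in>{Indet j ^ N * p, e j * p}. deg_le D r"
    using ex_deg_le_finite[of "{Indet j ^ N * p, e j * p}" id] by auto
  have "{k. res_term (Indet j ^ N * p) k \<noteq> 0} \<subseteq> ?S ` cube D"
  proof
    fix k assume k: "k \<in> {k. res_term (Indet j ^ N * p) k \<noteq> 0}"
    have "k j \<noteq> 0"
    proof
      assume "k j = 0"
      then have "lookup (corner k) j < lookup (single j N) j"
        using N_pos by (simp add: corner_def)
      then have "res_term (Indet j ^ N * p) k = 0"
        unfolding res_term_def Indet_power mult.assoc by (rule lookup_Monom_mult_other)
      then show False using k by simp
    qed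
    then have "k = ?S (k(j := k j - 1))" by (simp add: fun_eq_iff)
    moreover have "k \<in> cube D" using k D res_term_support by blast
    then have "k(j := k j - 1) \<in> cube D" by (auto simp: cube_def intro: le_trans[OF diff_le_self])
    ultimately show "k \<in> ?S ` cube D" by (rule image_eqI)
  qed
  then have "tau (Indet j ^ N * p) = (\<Sum>k\<in>?S ` cube D. res_term (Indet j ^ N * p) k)"
    by (intro tau_eq finite_imageI finite_cube)
  also have "\<dots> = (\<Sum>k\<in>cube D. res_term (Indet j ^ N * p) (?S k))"
  proof (rule sum.reindex[unfolded comp_def])
    show "inj_on ?S (cube D)"
    proof (rule inj_onI)
      fix k l assume "?S k = ?S l"
      then have "?S k i = ?S l i" for i by simp
      then have "k i = l i" for i by (metis fun_upd_apply nat.inject)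
      then show "k = l" by blast
    qed
  qed
  also have "\<dots> = (\<Sum>k\<in>cube D. res_term (e j * p) k)"
  proof (rule sum.cong[OF refl])
    fix k
    have c: "corner (?S k) = single j N + corner k"
      by (rule poly_mapping_eqI) (simp add: corner_def lookup_add lookup_single when_def)
    have P: "(\<Prod>i\<in>UNIV. e i ^ ?S k i) = e j * (\<Prod>i\<in>UNIV. e i ^ k i)"
    proof -
      have "(\<Prod>i\<in>UNIV. e i ^ ?S k i) = e j ^ Suc (k j) * (\<Prod>i\<in>UNIV - {j}. e i ^ ?S k i)"
        by (simp add: prod.remove[of UNIV j])
      also have "(\<Prod>i\<in>UNIV - {j}. e i ^ ?S k i) = (\<Prod>i\<in>UNIV - {j}. e i ^ k i)"
        by (intro prod.cong) auto
      also have "e j ^ Suc (k j) * (\<Prod>i\<in>UNIV - {j}. e i ^ k i)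
        = e j * (e j ^ k j * (\<Prod>i\<in>UNIV - {j}. e i ^ k i))" by (simp add: mult.assoc)
      also have "e j ^ k j * (\<Prod>i\<in>UNIV - {j}. e i ^ k i) = (\<Prod>i\<in>UNIV. e i ^ k i)"
        by (rule prod.remove[symmetric]) auto
      finally show ?thesis .
    qed
    have "Indet j ^ N * p * (e j * (\<Prod>i\<in>UNIV. e i ^ k i))
      = Monom (single j N) * (e j * p * (\<Prod>i\<in>UNIV. e i ^ k i))"
      by (simp only: Indet_power mult_ac)
    then show "res_term (Indet j ^ N * p) (?S k) = res_term (e j * p) k"
      unfolding res_term_def c P by (simp only: lookup_Monom_mult_add)
  qed
  also have "\<dots> = tau (e j * p)" using D by (intro tau_cube[symmetric]) simp
  finally show ?thesis .
qed

lemma tau_F: "p \<in> F \<Longrightarrow> tau p = 0"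
proof -
  assume "p \<in> F"
  then obtain c where "p = (\<Sum>j\<in>UNIV. c j * f j)"
    unfolding F_def ideal_gen_image_iff[OF finite] by blast
  then have "tau p = (\<Sum>j\<in>UNIV. tau (c j * f j))" by (simp add: tau_sum)
  moreover have "tau (c j * f j) = 0" for j
    using tau_power_eq[of j "c j"] by (simp add: f_def right_diff_distrib tau_diff mult.commute)
  ultimately show ?thesis by simp
qed

lemma tau_cong: "p - q \<in> F \<Longrightarrow> tau p = tau q"
  using tau_F[of "p - q"] by (simp add: tau_diff)

lemma tau_top:
  assumes "deg_le top_deg p"
  shows "tau p = lookup p (tm (\<lambda>_. N - 1))"
proof -
  have "{k. res_term p k \<noteq> 0} \<subseteq> {\<lambda>_. 0}"
  proof
    fix k assume "k \<in> {k. res_term p k \<noteq> 0}"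
    then have "\<not> top_deg < top_deg + (\<Sum>j\<in>UNIV. k j)" using res_term_eq_0[OF assms] by blast
    then have "(\<Sum>j\<in>UNIV. k j) = 0" by simp
    then show "k \<in> {\<lambda>_. 0}" by auto
  qed
  then have "tau p = (\<Sum>k\<in>{\<lambda>_. 0}. res_term p k)" by (intro tau_eq) auto
  then show ?thesis by (simp add: res_term_def corner_def)
qed

subsection \<open>Reduction modulo the complete intersection\<close>

abbreviation cube_sum :: "(('n \<Rightarrow> nat) \<Rightarrow> 'k) \<Rightarrow> ('n, 'k) mpol"
  where "cube_sum c \<equiv> (\<Sum>a\<in>cube (N - 1). Const (c a) * Monom (tm a))"

lemma cube_spans: "\<exists>c. p - cube_sum c \<in> F"
proof -
  have span: "\<exists>c. p - cube_sum c \<in> F" if "\<forall>s\<in>keys p. \<exists>c. Monom s - cube_sum c \<in> F" for p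
  proof -
    from bchoice[OF that] obtain c where c: "\<forall>s\<in>keys p. Monom s - cube_sum (c s) \<in> F" ..
    have "(\<Sum>s\<in>keys p. Const (lookup p s) * (Monom s - cube_sum (c s))) \<in> F"
      using c by (intro ideal_sum ideal_mult is_ideal_F) blast
    moreover have "(\<Sum>s\<in>keys p. Const (lookup p s) * Monom s) = p"
      using mpol_expand[of "keys p" p] by (simp add: single_eq_Const_Monom)
    moreover have "(\<Sum>s\<in>keys p. Const (lookup p s) * cube_sum (c s))
        = cube_sum (\<lambda>a. \<Sum>s\<in>keys p. lookup p s * c s a)"
      unfolding Const_sum Const_mult sum_distrib_left sum_distrib_right
      by (subst sum.swap) (simp only: mult.assoc)
    ultimately have "p - cube_sum (\<lambda>a. \<Sum>s\<in>keys p. lookup p s * c s a) \<in> F"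
      by (simp only: right_diff_distrib sum_subtractf)
    then show ?thesis by (rule exI[of _ "\<lambda>a. \<Sum>s\<in>keys p. lookup p s * c s a"])
  qed
  have "\<exists>c. Monom s - cube_sum c \<in> F" for s
  proof (induction "tdeg s" arbitrary: s rule: less_induct)
    case less
    show ?case
    proof (cases "lookup s \<in> cube (N - 1)")
      case True
      have "cube_sum (\<lambda>a. if a = lookup s then 1 else 0)
         = (\<Sum>a\<in>cube (N - 1). if a = lookup s then Monom s else 0)"
        by (intro sum.cong) (auto simp: tm_lookup)
      also have "\<dots> = Monom s" using True by simp
      finally show ?thesis
        by (intro exI[of _ "\<lambda>a. if a = lookup s then 1 else 0"]) (simp add: ideal_0[OF is_ideal_F])
    next
      case False
      then obtain j where "\<not> lookup s j \<le> N - 1" by (auto simp: cube_def)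
      then have "lookup (single j N) i \<le> lookup s i" for i
        by (auto simp: lookup_single when_def)
      then obtain w where w: "s = single j N + w" by (rule trm_diffE)
      have "\<exists>c. Monom w * e j - cube_sum c \<in> F"
      proof (rule span, rule ballI)
        fix u assume u: "u \<in> keys (Monom w * e j)"
        have "deg_le (tdeg w + (N - 1)) (Monom w * e j)"
          by (intro deg_le_mult deg_e deg_le_Monom) simp
        then have "tdeg u < tdeg s" using u N_pos unfolding w by (auto dest: deg_le_keys)
        then show "\<exists>c. Monom u - cube_sum c \<in> F" by (rule less)
      qed
      then obtain c where "Monom w * e j - cube_sum c \<in> F" ..
      moreover have "Monom w * f j \<in> F" by (intro ideal_mult is_ideal_F f_in_F)
      ultimately have "Monom w * f j + (Monom w * e j - cube_sum c) \<in> F"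
        by (intro ideal_add is_ideal_F)
      moreover have "Monom s = Monom w * f j + Monom w * e j"
        unfolding w Monom_add f_def Indet_power by (simp add: algebra_simps)
      ultimately show ?thesis by (intro exI[of _ c]) (simp add: add_diff_eq)
    qed
  qed
  then show ?thesis by (intro span) blast
qed

abbreviation compl :: "('n \<Rightarrow> nat) \<Rightarrow> 'n trm"
  where "compl b \<equiv> tm (\<lambda>j. N - 1 - b j)"

lemma tdeg_corner_diff:
  fixes b :: "'n \<Rightarrow> nat"
  assumes "b \<in> cube (N - 1)"
  shows "compl b + tm b = tm (\<lambda>_. N - 1)"
    and "tdeg (compl b) + tdeg (tm b) = top_deg"
proof -
  show *: "compl b + tm b = tm (\<lambda>_. N - 1)"
  proof (rule poly_mapping_eqI)
    fix k
    have "b k \<le> N - 1" using assms by (simp add: cube_def)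
    then show "lookup (compl b + tm b) k = lookup (tm (\<lambda>_. N - 1)) k"
      by (simp add: lookup_add)
  qed
  have "tdeg (compl b) + tdeg (tm b) = tdeg (tm (\<lambda>_. N - 1) :: 'n trm)"
    by (simp only: tdeg_add[symmetric] *)
  then show "tdeg (compl b) + tdeg (tm b) = top_deg"
    by (simp add: tdeg_tm top_deg_def)
qed

text \<open>
  On the monomials \<open>x\<^sup>a\<close> with all \<open>a\<^sub>j < N\<close>, pairing with the complementary monomials is unitriangular
  with respect to the degree. So a leading coefficient of the reduced form of \<open>u\<close> is a value of \<open>tau\<close>
  on a multiple of \<open>u\<close>. The next lemma solves the same triangular system, degree by degree, for a
  prescribed functional.
\<close>

lemma tau_nondegenerate:
  assumes "\<And>r. tau (r * u) = 0"
  shows "u \<in> F"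
proof -
  obtain c where c: "u - cube_sum c \<in> F"
    using cube_spans by blast
  define v where "v = cube_sum c"
  have tv: "tau (r * v) = 0" for r
  proof -
    have "r * u - r * v \<in> F"
      using ideal_mult[OF is_ideal_F c, of r] by (simp add: v_def right_diff_distrib)
    from tau_cong[OF this] show ?thesis using assms by simp
  qed
  have lv: "lookup v s = (if lookup s \<in> cube (N - 1) then c (lookup s) else 0)" for s
  proof -
    have "lookup v s = (\<Sum>a\<in>cube (N - 1). if a = lookup s then c a else 0)"
      unfolding v_def lookup_sum
      by (intro sum.cong refl) (auto simp: lookup_Const_mult lookup_Monom tm_lookup)
    then show ?thesis by simp
  qed
  have "c a = 0" if a: "a \<in> cube (N - 1)" for a
  proof (rule ccontr)
    assume "c a \<noteq> 0"
    define A :: "('n \<Rightarrow> nat) set" where "A = {a\<in>cube (N - 1). c a \<noteq> 0}"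
    have "finite A" "A \<noteq> {}" using a \<open>c a \<noteq> 0\<close> finite_cube by (auto simp: A_def)
    then have "Max ((\<lambda>a. tdeg (tm a)) ` A) \<in> (\<lambda>a. tdeg (tm a)) ` A" by (intro Max_in) auto
    then obtain b where b: "b \<in> A" and "tdeg (tm b) = Max ((\<lambda>a. tdeg (tm a)) ` A)" by auto
    then have max: "tdeg (tm a) \<le> tdeg (tm b)" if "a \<in> A" for a
      using that \<open>finite A\<close> by simp
    have bb: "b \<in> cube (N - 1)" "c b \<noteq> 0" using b by (auto simp: A_def)
    have "deg_le (tdeg (tm b)) v"
      unfolding deg_le_def
    proof (intro allI impI)
      fix s :: "'n trm" assume "tdeg s > tdeg (tm b)"
      then have "lookup s \<notin> A" using max[of "lookup s"] by (auto simp: tm_lookup)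
      then show "lookup v s = 0" by (auto simp: lv A_def)
    qed
    then have "deg_le (tdeg (compl b) + tdeg (tm b)) (Monom (compl b) * v)"
      by (intro deg_le_mult deg_le_Monom) auto
    then have "tau (Monom (compl b) * v)
        = lookup (Monom (compl b) * v) (compl b + tm b)"
      unfolding tdeg_corner_diff[OF bb(1)] by (rule tau_top)
    also have "\<dots> = c b" using bb by (simp only: lookup_Monom_mult_add lv) simp
    finally show False using tv bb by simp
  qed
  then have "v = 0" by (simp add: v_def)
  then show ?thesis using c by (simp add: v_def)
qed

lemma tau_represents:
  fixes ell :: "('n, 'k) mpol \<Rightarrow> 'k"
  assumes add: "\<And>p q. ell (p + q) = ell p + ell q" and scale: "\<And>c p. ell (Const c * p) = c * ell p"
    and F: "\<And>p. p \<in> F \<Longrightarrow> ell p = 0"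
  shows "\<exists>q. \<forall>r. tau (q * r) = ell r"
proof -
  have "\<exists>q. \<forall>a\<in>cube (N - 1). tdeg (tm a) < d \<longrightarrow> tau (q * Monom (tm a)) = ell (Monom (tm a))" for d
  proof (induction d)
    case (Suc d)
    then obtain q where q: "tau (q * Monom (tm a)) = ell (Monom (tm a))"
      if "a \<in> cube (N - 1)" "tdeg (tm a) < d" for a by blast
    define B :: "('n \<Rightarrow> nat) set" where "B = {b \<in> cube (N - 1). tdeg (tm b) = d}"
    define c where "c b = ell (Monom (tm b)) - tau (q * Monom (tm b))" for b
    define q' where "q' = q + (\<Sum>b\<in>B. Const (c b) * Monom (compl b))"
    have fB: "finite B" unfolding B_def using finite_cube by simp
    have "tau (q' * Monom (tm a)) = ell (Monom (tm a))"
      if a: "a \<in> cube (N - 1)" "tdeg (tm a) < Suc d" for a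
    proof -
      have m: "tau (Monom (compl b) * Monom (tm a)) = (if b = a then 1 else 0)"
        if b: "b \<in> B" for b
      proof -
        have b': "b \<in> cube (N - 1)" "tdeg (tm b) = d" using b by (auto simp: B_def)
        have "deg_le top_deg (Monom (compl b + tm a) :: ('n, 'k) mpol)"
          using tdeg_corner_diff(2)[OF b'(1)] b'(2) a(2) by (intro deg_le_Monom) simp
        then have "tau (Monom (compl b + tm a))
            = lookup (Monom (compl b + tm a)) (tm (\<lambda>_. N - 1))"
          by (rule tau_top)
        also have "\<dots> = (if b = a then 1 else 0)"
          unfolding tdeg_corner_diff(1)[OF b'(1), symmetric] lookup_Monom by (auto simp: tm_eq_iff)
        finally show ?thesis by (simp add: Monom_add)
      qed
      have "tau (q' * Monom (tm a)) = tau (q * Monom (tm a)) +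
          (\<Sum>b\<in>B. tau (Const (c b) * (Monom (compl b) * Monom (tm a))))"
        by (simp add: q'_def distrib_right tau_add sum_distrib_right tau_sum mult.assoc)
      also have "\<dots> = tau (q * Monom (tm a)) + (\<Sum>b\<in>B. if b = a then c b else 0)"
        by (rule arg_cong[where f = "(+) _"], rule sum.cong[OF refl], simp only: tau_scale m, simp)
      also have "\<dots> = tau (q * Monom (tm a)) + (if a \<in> B then c a else 0)"
        using fB by simp
      also have "\<dots> = ell (Monom (tm a))"
        using a q[of a] by (auto simp: B_def c_def)
      finally show ?thesis .
    qed
    then show ?case by blast
  qed simp
  from this[of "Suc top_deg"] obtain q where
    q: "\<forall>a\<in>cube (N - 1). tdeg (tm a) < Suc top_deg \<longrightarrow> tau (q * Monom (tm a)) = ell (Monom (tm a))" ..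
  have l0: "ell 0 = 0" using F ideal_0[OF is_ideal_F] by blast
  have lsum: "ell (sum g A) = (\<Sum>a\<in>A. ell (g a))" for g and A :: "('n \<Rightarrow> nat) set"
    by (induction A rule: infinite_finite_induct) (auto simp: add l0)
  have "tau (q * r) = ell r" for r
  proof -
    obtain c where c: "r - cube_sum c \<in> F" (is "r - ?v \<in> F")
      using cube_spans by blast
    have "q * r - q * ?v \<in> F"
      using ideal_mult[OF is_ideal_F c, of q] by (simp only: right_diff_distrib)
    then have "tau (q * r) = tau (q * ?v)" by (rule tau_cong)
    also have "q * ?v = (\<Sum>a\<in>cube (N - 1). Const (c a) * (q * Monom (tm a)))"
      by (simp add: sum_distrib_left mult_ac)
    also have "tau \<dots> = (\<Sum>a\<in>cube (N - 1). c a * tau (q * Monom (tm a)))"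
      by (simp add: tau_sum tau_scale)
    also have "\<dots> = (\<Sum>a\<in>cube (N - 1). c a * ell (Monom (tm a)))"
    proof (rule sum.cong[OF refl])
      fix a :: "'n \<Rightarrow> nat" assume a: "a \<in> cube (N - 1)"
      have "tdeg (tm a) < Suc top_deg" using tdeg_corner_diff(2)[OF a] by simp
      then show "c a * tau (q * Monom (tm a)) = c a * ell (Monom (tm a))" using q a by simp
    qed
    also have "\<dots> = ell ?v" by (simp add: lsum scale)
    also have "\<dots> = ell r" using add[of "r - ?v" ?v] F[OF c] by simp
    finally show ?thesis .
  qed
  then show ?thesis by blast
qed

subsection \<open>The socle\<close>

lemma socle_tau_zero:
  assumes w: "\<And>i. Indet i * w \<in> F" and t: "tau w = 0"
  shows "w \<in> F"
proof (rule tau_nondegenerate)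
  fix r
  have "tau (r * w) = tau (Const (lookup r 0) * w)"
    by (rule tau_cong[OF mult_annihilated[OF is_ideal_F w]])
  then show "tau (r * w) = 0" by (simp add: tau_scale t)
qed

text \<open>
  An element killed by the indeterminates is determined modulo \<open>F\<close> by its value under \<open>tau\<close>.
\<close>

lemma socle_one_dim:
  assumes "\<And>i. Indet i * u \<in> F" "\<And>i. Indet i * v \<in> F"
  shows "Const (tau v) * u - Const (tau u) * v \<in> F"
proof (rule socle_tau_zero)
  show "tau (Const (tau v) * u - Const (tau u) * v) = 0"
    by (simp add: tau_diff tau_scale)
  fix i
  have "Indet i * (Const (tau v) * u - Const (tau u) * v)
     = Const (tau v) * (Indet i * u) - Const (tau u) * (Indet i * v)"
    by (simp add: algebra_simps)
  also have "\<dots> \<in> F" by (intro ideal_diff ideal_mult is_ideal_F assms)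
  finally show "Indet i * (Const (tau v) * u - Const (tau u) * v) \<in> F" .
qed

end

lemma separating_functional:
  fixes V :: "('n, 'k::field) mpol set"
  assumes V: "is_ideal V" and p: "p \<notin> V"
  shows "\<exists>ell :: ('n, 'k) mpol \<Rightarrow> 'k. (\<forall>x y. ell (x + y) = ell x + ell y) \<and>
    (\<forall>c x. ell (Const c * x) = c * ell x) \<and> (\<forall>x\<in>V. ell x = 0) \<and> ell p = 1"
proof -
  interpret v: vector_space "\<lambda>c (x :: ('n, 'k) mpol). Const c * x"
    by unfold_locales (simp_all add: Const_add Const_mult algebra_simps)
  interpret k: vector_space "(*) :: 'k \<Rightarrow> 'k \<Rightarrow> 'k"
    by unfold_locales (simp_all add: algebra_simps)
  interpret vk: vector_space_pair "\<lambda>c (x :: ('n, 'k) mpol). Const c * x" "(*) :: 'k \<Rightarrow> 'k \<Rightarrow> 'k" ..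
  have subV: "v.subspace V"
    unfolding v.subspace_def using ideal_0[OF V] ideal_add[OF V] ideal_mult[OF V] by blast
  obtain B where B: "B \<subseteq> V" "v.independent B" "V \<subseteq> v.span B"
    using v.maximal_independent_subset by blast
  have sB: "v.span B = V" using B subV by (simp add: v.span_minimal subset_antisym)
  have ind: "v.independent (insert p B)"
    using p B(2) by (intro v.independent_insertI) (auto simp: sB)
  obtain g where g: "Vector_Spaces.linear (\<lambda>c x. Const c * x) (*) g"
    "\<forall>x\<in>insert p B. g x = (if x = p then 1 else 0)"
    using vk.linear_independent_extend[OF ind, of "\<lambda>x. if x = p then 1 else 0"] by blast
  interpret g: Vector_Spaces.linear "\<lambda>c x. Const c * x" "(*)" g by (rule g(1))
  show ?thesis
  proof (intro exI conjI allI ballI)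
    show "g (x + y) = g x + g y" for x y by (rule g.add)
    show "g (Const c * x) = c * g x" for c x by (rule g.scale)
    show "g p = 1" using g(2) by simp
    have "g x = 0" if "x \<in> v.span B" for x
      using that
    proof (induction rule: v.span_induct_alt)
      case base show ?case by (rule g.zero)
    next
      case (step c x y)
      have "x \<noteq> p" using step(1) B(1) p by blast
      then show ?case using step g(2) by (simp add: g.add g.scale)
    qed
    then show "g x = 0" if "x \<in> V" for x using that sB by blast
  qed
qed

context residue
begin

text \<open>
  Duality in the Frobenius algebra \<open>P/F\<close>: a functional that vanishes on \<open>(x\<^sub>1,\<dots>,x\<^sub>n) I + F\<close> but not
  on \<open>p\<close> has the form \<open>tau (q _)\<close>, and then \<open>q p\<close> is the wanted element.
\<close>

lemma socle_in_ideal: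
  assumes I: "is_ideal I" "F \<subseteq> I" and p: "p \<in> I"
    and np: "p \<notin> {x. \<exists>w y. (\<forall>i. w i \<in> I) \<and> y \<in> F \<and> x = (\<Sum>i\<in>UNIV. Indet i * w i) + y}"
  shows "\<exists>u\<in>I. u \<notin> F \<and> (\<forall>i. Indet i * u \<in> F)"
proof -
  let ?V = "{x. \<exists>w y. (\<forall>i. w i \<in> I) \<and> y \<in> F \<and> x = (\<Sum>i\<in>UNIV. Indet i * w i) + y}"
  have V: "is_ideal ?V"
  proof (rule is_idealI)
    show "0 \<in> ?V"
      using ideal_0[OF I(1)] ideal_0[OF is_ideal_F]
      by (intro CollectI exI[of _ "\<lambda>_. 0"] exI[of _ 0]) simp
    fix x y assume "x \<in> ?V" "y \<in> ?V"
    then obtain w a w' a' where *: "\<forall>i. w i \<in> I" "a \<in> F" "x = (\<Sum>i\<in>UNIV. Indet i * w i) + a"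
      "\<forall>i. w' i \<in> I" "a' \<in> F" "y = (\<Sum>i\<in>UNIV. Indet i * w' i) + a'" by blast
    have "x + y = (\<Sum>i\<in>UNIV. Indet i * (w i + w' i)) + (a + a')"
      by (simp add: * distrib_left sum.distrib)
    then show "x + y \<in> ?V" using * ideal_add[OF I(1)] ideal_add[OF is_ideal_F]
      by (intro CollectI exI[of _ "\<lambda>i. w i + w' i"] exI[of _ "a + a'"]) simp
  next
    fix r x assume "x \<in> ?V"
    then obtain w a where *: "\<forall>i. w i \<in> I" "a \<in> F" "x = (\<Sum>i\<in>UNIV. Indet i * w i) + a" by blast
    have "r * x = (\<Sum>i\<in>UNIV. Indet i * (r * w i)) + r * a"
      by (simp add: * distrib_left sum_distrib_left mult_ac)
    then show "r * x \<in> ?V" using * ideal_mult[OF I(1)] ideal_mult[OF is_ideal_F]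
      by (intro CollectI exI[of _ "\<lambda>i. r * w i"] exI[of _ "r * a"]) simp
  qed
  obtain l where l': "\<forall>x y. l (x + y) = l x + l y" "\<forall>c x. l (Const c * x) = c * l x"
    "\<forall>x\<in>?V. l x = 0" "l p = 1"
    using separating_functional[OF V np] by (elim exE conjE)
  note l = l'(1)[rule_format] l'(2)[rule_format] bspec[OF l'(3)] l'(4)
  have FV: "x \<in> ?V" if "x \<in> F" for x
    using that ideal_0[OF I(1)] by (intro CollectI exI[of _ "\<lambda>_. 0"] exI[of _ x]) simp
  have mV: "Indet i * x \<in> ?V" if "x \<in> I" for i x
  proof -
    have "(\<Sum>j\<in>UNIV. Indet j * (if j = i then x else 0)) = (\<Sum>j\<in>UNIV. if j = i then Indet i * x else 0)"
      by (intro sum.cong) auto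
    also have "\<dots> = Indet i * x" by simp
    finally show ?thesis using that ideal_0[OF I(1)] ideal_0[OF is_ideal_F]
      by (intro CollectI exI[of _ "\<lambda>j. if j = i then x else 0"] exI[of _ 0]) simp
  qed
  have "\<exists>q. \<forall>r. tau (q * r) = l r"
    by (rule tau_represents[OF l(1) l(2) l(3)[OF FV]])
  then obtain q where q: "\<forall>r. tau (q * r) = l r" ..
  have "q * p \<in> I" by (rule ideal_mult[OF I(1) p])
  moreover have "q * p \<notin> F" using tau_F[of "q * p"] q l(4) by auto
  moreover have "Indet i * (q * p) \<in> F" for i
  proof (rule tau_nondegenerate)
    fix r
    have "tau (r * (Indet i * (q * p))) = tau (q * (Indet i * (r * p)))" by (simp add: mult_ac)
    also have "\<dots> = l (Indet i * (r * p))" by (simp only: q)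
    also have "\<dots> = 0" by (intro l(3) mV ideal_mult I(1) p)
    finally show "tau (r * (Indet i * (q * p))) = 0" .
  qed
  ultimately show ?thesis by blast
qed

end


section \<open>Complete intersections\<close>

lemma Monom_prod: "(\<Prod>i\<in>A. Monom (s i) :: ('n, 'a::comm_ring_1) mpol) = Monom (sum s A)"
  by (induction A rule: infinite_finite_induct) (auto simp: Monom_add)

lemma sum_single_tm: "(\<Sum>i\<in>UNIV. single i (k i)) = tm k"
  by (rule poly_mapping_eqI) (simp add: lookup_sum lookup_single when_def)

lemma of_int_mpol: "of_int k = (Const (of_int k) :: ('n, 'a::comm_ring_1) mpol)"
  by (simp add: Const_def)

lemma hcomp_Const_mult:
  "hcomp d (Const c * p) = Const c * hcomp d (p :: ('n::finite, 'a::comm_ring_1) mpol)"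
  by (rule poly_mapping_eqI) (simp add: lookup_hcomp lookup_Const_mult)

lemma hcomp_of_int_mult:
  "hcomp d (of_int k * p) = of_int k * hcomp d (p :: ('n::finite, 'a::comm_ring_1) mpol)"
  unfolding of_int_mpol by (rule hcomp_Const_mult)

lemma deg_le_of_int_mult:
  "deg_le d p \<Longrightarrow> deg_le d (of_int k * p :: ('n::finite, 'a::comm_ring_1) mpol)"
  unfolding of_int_mpol by (simp add: deg_le_def lookup_Const_mult)

lemma deg_le_Indet: "deg_le 1 (Indet i :: ('n::finite, 'a::comm_ring_1) mpol)"
  unfolding Indet_def by (rule deg_le_Monom) simp

lemma hom_deg_Indet: "hom_deg 1 (Indet i :: ('n::finite, 'a::comm_ring_1) mpol)"
  unfolding Indet_def by (rule hom_deg_Monom) simp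

lemma deg_le_Indet_power: "deg_le k (Indet i ^ k :: ('n::finite, 'a::comm_ring_1) mpol)"
  unfolding Indet_power by (rule deg_le_Monom) simp

lemma hcomp_det:
  fixes A :: "('n::finite, 'a::comm_ring_1) mpol ^ 'm::finite ^ 'm"
  assumes "\<And>i j. deg_le d (A $ i $ j)"
  shows "deg_le (CARD('m) * d) (det A)"
    and "hcomp (CARD('m) * d) (det A) = det (\<chi> i j. hcomp d (A $ i $ j))"
proof -
  have *: "CARD('m) * d = (\<Sum>i\<in>(UNIV :: 'm set). d)" by simp
  show "deg_le (CARD('m) * d) (det A)"
    unfolding det_def * by (intro deg_le_sum deg_le_of_int_mult deg_le_prod assms)
  show "hcomp (CARD('m) * d) (det A) = det (\<chi> i j. hcomp d (A $ i $ j))"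
    unfolding det_def * hcomp_sum hcomp_of_int_mult
    by (intro sum.cong refl arg_cong2[where f = "(*)"])
      (simp only: hcomp_prod[where d = "\<lambda>_. d"] assms vec_lambda_beta)
qed

context residue
begin

text \<open>
  The matrix \<open>A\<close> expresses the \<open>f\<^sub>j\<close> through the indeterminates, so Cramer's rule puts \<open>det A\<close> into
  the socle. Its component of top degree is the determinant of \<open>diag (x\<^sub>j\<^sup>N\<^sup>-\<^sup>1)\<close>, the corner monomial,
  because the \<open>h\<^sub>i\<^sub>j\<close> have smaller degree.
\<close>

lemma corner_det:
  fixes h :: "'n \<Rightarrow> 'n \<Rightarrow> ('n, 'k) mpol"
  assumes N: "N \<ge> 2" and h: "\<And>i j. deg_le (N - 2) (h i j)"
    and e: "\<And>j. e j = - (\<Sum>i\<in>UNIV. h i j * Indet i)"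
    and A: "A = (\<chi> i j. h i j + (if i = j then Indet j ^ (N - 1) else 0))"
  shows "Indet k * det A \<in> F" and "tau (det A) = 1"
proof -
  have pow: "Indet j * Indet j ^ (N - 1) = (Indet j ^ N :: ('n, 'k) mpol)" for j
    using N_pos by (cases N) auto
  have "(\<Sum>i\<in>UNIV. Indet i * A $ i $ j) = f j" for j
  proof -
    have "(\<Sum>i\<in>UNIV. Indet i * A $ i $ j) = (\<Sum>i\<in>UNIV. h i j * Indet i)
        + (\<Sum>i\<in>UNIV. if i = j then Indet j * Indet j ^ (N - 1) else 0)"
      unfolding sum.distrib[symmetric]
      by (intro sum.cong refl) (simp add: A distrib_left mult.commute)
    then show ?thesis by (simp add: f_def e pow add.commute del: One_nat_def)
  qed
  then show "Indet k * det A \<in> F" by (intro cramer_ideal is_ideal_F) (simp add: f_in_F)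
  have dA: "deg_le (N - 1) (A $ i $ j)" for i j
    using deg_le_mono[OF h, of "N - 1"] by (auto simp: A intro!: deg_le_add deg_le_Indet_power)
  have "tau (det A) = lookup (det A) (tm (\<lambda>_. N - 1))"
    using hcomp_det(1)[OF dA] by (intro tau_top) (simp add: top_deg_def)
  also have "\<dots> = lookup (hcomp top_deg (det A)) (tm (\<lambda>_. N - 1))"
    by (simp add: lookup_hcomp tdeg_tm top_deg_def)
  also have "hcomp top_deg (det A) = det (\<chi> i j. hcomp (N - 1) (A $ i $ j))"
    unfolding top_deg_def by (rule hcomp_det(2)[OF dA])
  also have "(\<chi> i j. hcomp (N - 1) (A $ i $ j))
      = (\<chi> i j. if i = j then Indet j ^ (N - 1) else (0 :: ('n, 'k) mpol))"
  proof -
    have "hcomp (N - 1) (h i j) = 0" for i j using h N by (intro deg_le_hcomp_0[of "N - 2"]) auto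
    moreover have "hcomp (N - 1) (Indet j ^ (N - 1)) = (Indet j ^ (N - 1) :: ('n, 'k) mpol)" for j
      unfolding Indet_power by (subst hcomp_hom_deg[OF hom_deg_Monom]) auto
    ultimately show ?thesis by (simp add: vec_eq_iff A hcomp_add)
  qed
  also have "det (\<chi> i j. if i = j then Indet j ^ (N - 1) else (0 :: ('n, 'k) mpol))
      = (\<Prod>i\<in>UNIV. Indet i ^ (N - 1))"
    by (subst det_diagonal) auto
  also have "\<dots> = Monom (tm (\<lambda>_. N - 1))"
    unfolding Indet_power Monom_prod sum_single_tm ..
  finally show "tau (det A) = 1" by (simp add: lookup_Monom)
qed

text \<open>
  Writing \<open>x\<^sub>j\<^sup>N = x\<^sub>j x\<^sub>j\<^sup>N\<^sup>-\<^sup>1\<close> with \<open>x\<^sub>j\<^sup>N\<^sup>-\<^sup>1 \<in> (g)\<close> shows \<open>f = g B\<close> with \<open>B\<close> congruent to the identity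
  modulo the indeterminates. Thus \<open>(f)\<close> and \<open>(g)\<close> coincide after localisation at the origin;
  \<open>det B\<close> is an explicit denominator.
\<close>

lemma unit_multiple:
  assumes e: "\<And>j. e j = - g j" and I: "I = ideal_gen (range g)"
    and pow: "\<And>i. Indet i ^ (N - 1) \<in> I"
  shows "F \<subseteq> I"
    and "\<exists>B :: ('n, 'k) mpol ^ 'n ^ 'n. lookup (det B) 0 = 1 \<and> (\<forall>j. f j = (\<Sum>k\<in>UNIV. g k * B $ k $ j))"
    and "\<exists>D. lookup D 0 = 1 \<and> (\<forall>p\<in>I. D * p \<in> F)"
proof -
  have Ii: "is_ideal I" unfolding I by (rule is_ideal_gen)
  have pow': "Indet j ^ N = Indet j * (Indet j ^ (N - 1) :: ('n, 'k) mpol)" for j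
    using N_pos by (cases N) auto
  have "f j \<in> I" for j
    unfolding f_def e pow' diff_minus_eq_add
    by (intro ideal_add[OF Ii] ideal_mult[OF Ii] pow) (auto simp: I intro: ideal_gen_base)
  then show FI: "F \<subseteq> I" unfolding F_def by (intro ideal_gen_least Ii) auto
  have "\<exists>c. Indet j ^ (N - 1) = (\<Sum>k\<in>UNIV. c k * g k)" for j
    using pow[of j] unfolding I ideal_gen_image_iff[OF finite] .
  then obtain c where c: "Indet j ^ (N - 1) = (\<Sum>k\<in>UNIV. c j k * g k)" for j by metis
  define B :: "('n, 'k) mpol ^ 'n ^ 'n"
    where "B = (\<chi> k j. (if k = j then 1 else 0) + Indet j * c j k)"
  have fB: "f j = (\<Sum>k\<in>UNIV. g k * B $ k $ j)" for j
  proof -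
    have "(\<Sum>k\<in>UNIV. g k * B $ k $ j) = (\<Sum>k\<in>UNIV. (if k = j then g j else 0) + Indet j * (c j k * g k))"
      by (intro sum.cong refl) (simp add: B_def distrib_left mult_ac)
    also have "\<dots> = g j + Indet j * (\<Sum>k\<in>UNIV. c j k * g k)"
      by (simp add: sum.distrib sum_distrib_left)
    finally show ?thesis by (simp add: f_def e pow' c del: One_nat_def)
  qed
  have "det B - det (mat 1 :: ('n, 'k) mpol ^ 'n ^ 'n) \<in> ideal_gen (range Indet)"
  proof (rule det_cong_ideal[OF is_ideal_gen])
    fix i j
    have "B $ i $ j - mat 1 $ i $ j = Indet j * c j i" by (simp add: B_def mat_def)
    then show "B $ i $ j - mat 1 $ i $ j \<in> ideal_gen (range Indet)"
      by (simp add: ideal_mult_right ideal_gen_base is_ideal_gen)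
  qed
  then obtain a where a: "det B - det (mat 1 :: ('n, 'k) mpol ^ 'n ^ 'n) = (\<Sum>i\<in>UNIV. a i * Indet i)"
    unfolding ideal_gen_image_iff[OF finite] by blast
  have "lookup (a i * Indet i) 0 = 0" for i
    unfolding mult.commute[of "a i"] Indet_def
    by (rule lookup_Monom_mult_other[where x = i]) (simp add: lookup_var_trm)
  then have "lookup (det B - det (mat 1 :: ('n, 'k) mpol ^ 'n ^ 'n)) 0 = 0" unfolding a lookup_sum by simp
  then have l1: "lookup (det B) 0 = 1" by (simp add: lookup_minus)
  with fB show "\<exists>B :: ('n, 'k) mpol ^ 'n ^ 'n. lookup (det B) 0 = 1 \<and>
      (\<forall>j. f j = (\<Sum>k\<in>UNIV. g k * B $ k $ j))" by blast
  have "g k * det B \<in> F" for k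
    by (rule cramer_ideal[OF is_ideal_F]) (simp add: fB[symmetric] f_in_F)
  then have Dg: "det B * g k \<in> F" for k by (simp add: mult.commute)
  have "det B * p \<in> F" if "p \<in> I" for p
  proof -
    from that obtain q where "p = (\<Sum>k\<in>UNIV. q k * g k)"
      unfolding I ideal_gen_image_iff[OF finite] by blast
    then have "det B * p = (\<Sum>k\<in>UNIV. q k * (det B * g k))"
      by (simp only: sum_distrib_left mult_ac)
    also have "\<dots> \<in> F" by (intro ideal_sum ideal_mult is_ideal_F Dg)
    finally show ?thesis .
  qed
  with l1 show "\<exists>D. lookup D 0 = 1 \<and> (\<forall>p\<in>I. D * p \<in> F)" by blast
qed

end

lemma ideal_power_mono:
  assumes "is_ideal I" "x ^ M \<in> I" "M \<le> k"
  shows "x ^ k \<in> I"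
proof -
  have "x ^ k = x ^ (k - M) * x ^ M" using assms(3) by (simp flip: power_add)
  then show ?thesis using ideal_mult[OF assms(1,2)] by simp
qed

text \<open>
  The perturbation, with \<open>N\<close> so large that \<open>x\<^sub>j\<^sup>N\<^sup>-\<^sup>1 \<in> I\<close>: then the matrix \<open>A\<close> of \<open>corner_det\<close> is congruent
  to \<open>h\<close> modulo \<open>I\<close>, and a socle element of \<open>P/F\<close> with \<open>tau = 1\<close> represents \<open>det h\<close> modulo \<open>I\<close>.
\<close>

lemma ex_perturbation:
  fixes g :: "'n::finite \<Rightarrow> ('n, 'k::field) mpol" and h :: "'n \<Rightarrow> 'n \<Rightarrow> ('n, 'k) mpol"
  assumes g: "\<And>j. g j = (\<Sum>i\<in>UNIV. h i j * Indet i)" and I: "is_ideal I"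
    and pow: "\<And>i. Indet i ^ M \<in> I"
  shows "\<exists>N (A :: ('n, 'k) mpol ^ 'n ^ 'n). residue (\<lambda>j. - g j) N \<and> (\<forall>i. Indet i ^ (N - 1) \<in> I) \<and>
    det A - det (\<chi> i j. h i j) \<in> I \<and>
    (\<forall>k. Indet k * det A \<in> residue.F (\<lambda>j. - g j) N) \<and> residue.tau (\<lambda>j. - g j) N (det A) = 1"
proof -
  obtain D where D: "\<forall>a\<in>UNIV. deg_le D (case_prod h a)"
    using ex_deg_le_finite[of UNIV "case_prod h"] by auto
  \<comment> \<open>large enough for \<open>deg h\<^sub>i\<^sub>j < N - 1\<close>, \<open>deg g\<^sub>j < N\<close> and \<open>x\<^sub>i\<^sup>N\<^sup>-\<^sup>1 \<in> I\<close>\<close>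
  define N where "N = D + M + 2"
  have h: "deg_le (N - 2) (h i j)" for i j
    using D deg_le_mono[of D "h i j" "N - 2"] by (auto simp: N_def)
  have "deg_le (N - 1) (- g j)" for j
  proof -
    have "deg_le ((N - 2) + 1) (- g j)"
      unfolding g by (intro deg_le_minus deg_le_sum deg_le_mult h deg_le_Indet)
    then show ?thesis by (simp add: N_def)
  qed
  then interpret residue "\<lambda>j. - g j" N
    by unfold_locales (auto simp: N_def)
  have pow': "Indet i ^ (N - 1) \<in> I" for i
    by (rule ideal_power_mono[OF I pow]) (simp add: N_def)
  define A :: "('n, 'k) mpol ^ 'n ^ 'n"
    where "A = (\<chi> i j. h i j + (if i = j then Indet j ^ (N - 1) else 0))"
  have N2: "N \<ge> 2" by (simp add: N_def)
  have e: "- g j = - (\<Sum>i\<in>UNIV. h i j * Indet i)" for j by (simp add: g)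
  note C = corner_det[OF N2 h e A_def]
  have "det A - det (\<chi> i j. h i j) \<in> I"
    by (rule det_cong_ideal[OF I]) (auto simp: A_def pow' ideal_0[OF I] simp del: One_nat_def)
  then show ?thesis
    by (intro exI[of _ N] exI[of _ A] conjI allI residue_axioms pow' C)
qed

text \<open>
  If \<open>det h\<close> were in \<open>I = (g)\<close>, so would be the determinant of \<open>corner_det\<close>, which is congruent to
  it. A unit multiple of that determinant, hence it itself, would lie in \<open>F\<close>, contradicting \<open>tau = 1\<close>.
\<close>

lemma det_notin_parameter_ideal:
  fixes g :: "'n::finite \<Rightarrow> ('n, 'k::field) mpol" and h :: "'n \<Rightarrow> 'n \<Rightarrow> ('n, 'k) mpol"
  assumes g: "\<And>j. g j = (\<Sum>i\<in>UNIV. h i j * Indet i)" and I: "I = ideal_gen (range g)"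
    and pow: "\<And>i. Indet i ^ M \<in> I"
  shows "det (\<chi> i j. h i j) \<notin> I"
proof
  assume d: "det (\<chi> i j. h i j) \<in> I"
  have Ii: "is_ideal I" unfolding I by (rule is_ideal_gen)
  obtain N and A :: "('n, 'k) mpol ^ 'n ^ 'n" where N: "residue (\<lambda>j. - g j) N" and pow': "\<And>i. Indet i ^ (N - 1) \<in> I"
    and A': "det A - det (\<chi> i j. h i j) \<in> I"
      "\<And>k. Indet k * det A \<in> residue.F (\<lambda>j. - g j) N" "residue.tau (\<lambda>j. - g j) N (det A) = 1"
    using ex_perturbation[of g h, OF g Ii pow] by blast
  interpret residue "\<lambda>j. - g j" N by (rule N)
  note A = A'(2,3)
  note U = unit_multiple[of g, OF refl I pow']
  obtain u where u: "lookup u 0 = 1" "\<forall>p\<in>I. u * p \<in> F" using U(3) by blast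
  have "det A \<in> I" using d ideal_cong[OF Ii A'(1)] by simp
  then have "u * det A \<in> F" using u by blast
  moreover have "u * det A - Const (lookup u 0) * det A \<in> F"
    by (rule mult_annihilated[OF is_ideal_F A(1)])
  ultimately have "Const (lookup u 0) * det A \<in> F" using ideal_cong[OF is_ideal_F] by blast
  then have "det A \<in> F" using u(1) by simp
  then show False using tau_F A(2) by simp
qed

text \<open>
  A multiplier \<open>y\<close> with constant term 1 and \<open>y I \<subseteq> F\<close> embeds the socle of \<open>P/I\<close> into that of
  \<open>P/F\<close>, which is a line.
\<close>

lemma socle_dim_le_1:
  fixes g :: "'n::finite \<Rightarrow> ('n, 'k::field) mpol"
  assumes I: "I = ideal_gen (range g)" and pow: "\<And>i. Indet i ^ M \<in> I"
    and u: "\<And>i. Indet i * u \<in> I" and v: "\<And>i. Indet i * v \<in> I"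
  shows "\<exists>c d. (c \<noteq> 0 \<or> d \<noteq> 0) \<and> Const c * u + Const d * v \<in> I"
proof -
  have Ii: "is_ideal I" unfolding I by (rule is_ideal_gen)
  obtain D where D: "\<forall>j\<in>UNIV. deg_le D (g j)"
    using ex_deg_le_finite[of UNIV g] by auto
  define N where "N = D + M + 1"
  have "deg_le (N - 1) (- g j)" for j
    using D deg_le_mono[of D "g j" "N - 1"] by (auto simp: N_def intro: deg_le_minus)
  then interpret residue "\<lambda>j. - g j" N
    by unfold_locales (auto simp: N_def)
  have pow': "Indet i ^ (N - 1) \<in> I" for i
    by (rule ideal_power_mono[OF Ii pow]) (simp add: N_def)
  note U = unit_multiple[of g, OF refl I pow']
  obtain y where y: "lookup y 0 = 1" "\<forall>p\<in>I. y * p \<in> F" using U(3) by blast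
  have yw: "y * w - w \<in> I" if "\<And>i. Indet i * w \<in> I" for w
    using mult_annihilated[OF Ii that, of y] y(1) by simp
  have yF: "Indet i * (y * w) \<in> F" if "\<And>i. Indet i * w \<in> I" for w i
    using bspec[OF y(2) that, of i] by (simp only: mult.left_commute)
  show ?thesis
  proof (cases "tau (y * u) = 0")
    case True
    then have "y * u \<in> F" using socle_tau_zero[OF yF[OF u]] by blast
    then have "u \<in> I" using subsetD[OF U(1)] ideal_cong[OF Ii yw[OF u]] by simp
    then show ?thesis by (intro exI[of _ 1] exI[of _ 0]) simp
  next
    case False
    let ?c = "tau (y * v)" and ?d = "- tau (y * u)"
    let ?w = "Const ?c * u + Const ?d * v"
    have "Const ?c * (y * u) - Const (tau (y * u)) * (y * v) \<in> F"
      by (intro socle_one_dim yF u v)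
    moreover have "y * ?w = Const ?c * (y * u) - Const (tau (y * u)) * (y * v)"
      by (simp add: Const_minus right_diff_distrib mult_ac)
    ultimately have yI: "y * ?w \<in> I" using subsetD[OF U(1)] by simp
    have mI: "Indet i * ?w \<in> I" for i
    proof -
      have "Indet i * ?w = Const ?c * (Indet i * u) + Const ?d * (Indet i * v)"
        by (simp only: distrib_left mult_ac)
      then show ?thesis using u v by (simp add: ideal_add ideal_mult Ii)
    qed
    have "?w \<in> I" using ideal_cong[OF Ii yw[OF mI]] yI by simp
    then show ?thesis using False by (intro exI[of _ ?c] exI[of _ ?d]) simp
  qed
qed

lemma hcomp_in_ideal_gen:
  fixes S :: "('n::finite, 'k::comm_ring_1) mpol set"
  assumes S: "\<And>s. s \<in> S \<Longrightarrow> \<exists>d. hom_deg d s" and p: "p \<in> ideal_gen S"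
  shows "hcomp d p \<in> ideal_gen S"
proof -
  let ?I = "{p. \<forall>d. hcomp d p \<in> ideal_gen S}"
  have "is_ideal ?I"
  proof (rule is_idealI)
    show "0 \<in> ?I" using ideal_0[OF is_ideal_gen] by simp
    show "x + y \<in> ?I" if "x \<in> ?I" "y \<in> ?I" for x y
      using that by (auto simp: hcomp_add intro: ideal_add[OF is_ideal_gen])
    fix c x assume x: "x \<in> ?I"
    obtain D where D: "deg_le D x" using ex_deg_le by blast
    have "hcomp d (c * x) \<in> ideal_gen S" for d
    proof -
      have "hcomp d (c * x) = (\<Sum>e\<le>D. hcomp d (c * hcomp e x))"
        by (subst mpol_sum_hcomp[OF D]) (simp only: sum_distrib_left hcomp_sum)
      also have "\<dots> \<in> ideal_gen S"
        using x by (intro ideal_sum is_ideal_gen)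
          (auto simp: hcomp_mult_hom[OF hom_deg_hcomp] intro!: ideal_mult is_ideal_gen ideal_0)
      finally show ?thesis .
    qed
    then show "c * x \<in> ?I" by blast
  qed
  moreover have "S \<subseteq> ?I"
  proof
    fix s assume s: "s \<in> S"
    then obtain e where "hom_deg e s" using S by blast
    then show "s \<in> ?I" using s by (simp add: hcomp_hom_deg ideal_gen_base ideal_0 is_ideal_gen)
  qed
  ultimately show ?thesis using ideal_gen_least p by blast
qed

text \<open>
  The hard direction of Wiebe's criterion. Here \<open>g\<close> is only a family inside \<open>I\<close>. A nonzero
  socle element of \<open>P/F\<close> inside \<open>I/F\<close> would span the line containing the determinant of
  \<open>corner_det\<close>, which is not in \<open>I\<close> because \<open>det h\<close> is not.
  By \<open>socle_in_ideal\<close> therefore \<open>I = (x\<^sub>1,\<dots>,x\<^sub>n) I + (g)\<close>, and homogeneity allows an induction on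
  the degree.
\<close>

lemma generated_by_nonzero_minor:
  fixes g :: "'n::finite \<Rightarrow> ('n, 'k::field) mpol" and h :: "'n \<Rightarrow> 'n \<Rightarrow> ('n, 'k) mpol"
  assumes g: "\<And>j. g j = (\<Sum>i\<in>UNIV. h i j * Indet i)"
    and hom: "\<And>j. hom_deg (dg j) (g j)"
    and I: "is_ideal I" and homI: "\<And>d p. p \<in> I \<Longrightarrow> hcomp d p \<in> I"
    and pow: "\<And>i. Indet i ^ M \<in> I" and gI: "\<And>j. g j \<in> I"
    and det: "det (\<chi> i j. h i j) \<notin> I"
  shows "I = ideal_gen (range g)"
proof
  show "ideal_gen (range g) \<subseteq> I" using gI by (intro ideal_gen_least I) auto
  obtain N and A :: "('n, 'k) mpol ^ 'n ^ 'n" where N: "residue (\<lambda>j. - g j) N" and pow': "\<And>i. Indet i ^ (N - 1) \<in> I"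
    and A': "det A - det (\<chi> i j. h i j) \<in> I"
      "\<And>k. Indet k * det A \<in> residue.F (\<lambda>j. - g j) N" "residue.tau (\<lambda>j. - g j) N (det A) = 1"
    using ex_perturbation[of g h, OF g I pow] by blast
  interpret residue "\<lambda>j. - g j" N by (rule N)
  note A = A'(2,3)
  have powN: "Indet j ^ N = Indet j * (Indet j ^ (N - 1) :: ('n, 'k) mpol)" for j
    using N_pos by (cases N) auto
  have "f j \<in> I" for j
    unfolding f_def powN diff_minus_eq_add
    by (intro ideal_add[OF I] ideal_mult[OF I] pow' gI)
  then have FI: "F \<subseteq> I" unfolding F_def by (intro ideal_gen_least I) auto
  have AI: "det A \<notin> I" using det ideal_cong[OF I A'(1)] by simp
  have no_socle: "u \<in> F" if u: "u \<in> I" "\<And>i. Indet i * u \<in> F" for u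
  proof (rule socle_tau_zero[OF u(2)], rule ccontr)
    assume t: "tau u \<noteq> 0"
    have "Const (tau (det A)) * u - Const (tau u) * det A \<in> F"
      by (intro socle_one_dim u A)
    then have "u - Const (tau u) * det A \<in> I" using FI A(2) by auto
    then have "Const (tau u) * det A \<in> I" using u(1) ideal_cong[OF I] by blast
    then have "Const (1 / tau u) * (Const (tau u) * det A) \<in> I" by (rule ideal_mult[OF I])
    moreover have "Const (1 / tau u) * (Const (tau u) * det A) = det A"
      using t by (simp only: mult.assoc[symmetric] Const_mult[symmetric]) simp
    ultimately show False using AI by simp
  qed
  have decomp: "\<exists>w c. (\<forall>i. w i \<in> I) \<and> p = (\<Sum>i\<in>UNIV. w i * Indet i) + (\<Sum>j\<in>UNIV. c j * g j)"
    if p: "p \<in> I" for p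
  proof -
    have "p \<in> {x. \<exists>w y. (\<forall>i. w i \<in> I) \<and> y \<in> F \<and> x = (\<Sum>i\<in>UNIV. Indet i * w i) + y}"
      using socle_in_ideal[OF I FI p] no_socle by blast
    then obtain w y where w: "\<And>i. w i \<in> I" "y \<in> F" "p = (\<Sum>i\<in>UNIV. Indet i * w i) + y"
      by (elim CollectE exE conjE) auto
    obtain c where c: "y = (\<Sum>j\<in>UNIV. c j * f j)"
      using w(2) unfolding F_def ideal_gen_image_iff[OF finite] by blast
    have "p = (\<Sum>i\<in>UNIV. Indet i * w i + c i * f i)" by (simp add: w c sum.distrib)
    also have "\<dots> = (\<Sum>i\<in>UNIV. (w i + c i * Indet i ^ (N - 1)) * Indet i + c i * g i)"
      by (intro sum.cong refl) (simp add: f_def powN algebra_simps)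
    finally have "p = (\<Sum>i\<in>UNIV. (w i + c i * Indet i ^ (N - 1)) * Indet i) + (\<Sum>j\<in>UNIV. c j * g j)"
      by (simp only: sum.distrib)
    moreover have "w i + c i * Indet i ^ (N - 1) \<in> I" for i
      by (intro ideal_add[OF I] ideal_mult[OF I] w pow')
    ultimately show ?thesis
      by (intro exI[of _ "\<lambda>i. w i + c i * Indet i ^ (N - 1)"] exI[of _ c]) blast
  qed
  have step: "hcomp d p \<in> ideal_gen (range g)" if "p \<in> I" for p d
    using that
  proof (induction d arbitrary: p rule: less_induct)
    case (less d)
    obtain w c where w: "\<And>i. w i \<in> I"
      "p = (\<Sum>i\<in>UNIV. w i * Indet i) + (\<Sum>j\<in>UNIV. c j * g j)" using decomp[OF less(2)] by blast
    have "hcomp d (w i * Indet i) \<in> ideal_gen (range g)" for i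
    proof (cases d)
      case 0 then show ?thesis
        by (simp add: hcomp_mult_hom[OF hom_deg_Indet] ideal_0 is_ideal_gen)
    next
      case (Suc k)
      then have "hcomp k (w i) \<in> ideal_gen (range g)" by (intro less(1) w) simp
      then show ?thesis using Suc
        by (simp add: hcomp_mult_hom[OF hom_deg_Indet] ideal_mult_right is_ideal_gen)
    qed
    moreover have "g j \<in> ideal_gen (range g)" for j by (simp add: ideal_gen_base)
    then have "hcomp d (c j * g j) \<in> ideal_gen (range g)" for j
      by (simp add: hcomp_mult_hom[OF hom] ideal_mult ideal_0 is_ideal_gen)
    ultimately show ?case
      unfolding w(2) hcomp_add hcomp_sum by (intro ideal_add ideal_sum is_ideal_gen)
  qed
  show "I \<subseteq> ideal_gen (range g)"
  proof
    fix p assume p: "p \<in> I"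
    obtain E where "deg_le E p" using ex_deg_le by blast
    then have "p = (\<Sum>d\<le>E. hcomp d p)" by (rule mpol_sum_hcomp)
    moreover have "(\<Sum>d\<le>E. hcomp d p) \<in> ideal_gen (range g)"
      by (intro ideal_sum is_ideal_gen step p)
    ultimately show "p \<in> ideal_gen (range g)" by simp
  qed
qed


section \<open>Koszul syzygies and regular sequences\<close>

text \<open>
  Homogeneous of degree \<open>E - d\<close> in the integers: for \<open>E < d\<close> only 0 qualifies. This is the degree
  condition on the coefficient of a generator of degree \<open>d\<close> in a syzygy of total degree \<open>E\<close>.
\<close>

definition hom_shift :: "nat \<Rightarrow> nat \<Rightarrow> ('n::finite, 'a::zero) mpol \<Rightarrow> bool"
  where "hom_shift E d p \<longleftrightarrow> (\<forall>s. lookup p s \<noteq> 0 \<longrightarrow> tdeg s + d = E)"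

lemma hom_shift_iff:
  fixes p :: "('n::finite, 'a::zero) mpol"
  shows "hom_shift E d p \<longleftrightarrow> (if d \<le> E then hom_deg (E - d) p else p = 0)"
proof (cases "d \<le> E")
  case True
  then have "tdeg s + d = E \<longleftrightarrow> tdeg s = E - d" for s :: "'n trm" by linarith
  then show ?thesis using True unfolding hom_shift_def hom_deg_def by (simp, blast)
next
  case False
  then have "tdeg s + d \<noteq> E" for s :: "'n trm" by linarith
  then have "hom_shift E d p \<longleftrightarrow> (\<forall>s. lookup p s = 0)" unfolding hom_shift_def by blast
  also have "\<dots> \<longleftrightarrow> p = 0" by (auto intro!: poly_mapping_eqI)
  finally show ?thesis using False by simp
qed

definition trunc :: "nat \<Rightarrow> nat \<Rightarrow> ('n::finite, 'a::comm_monoid_add) mpol \<Rightarrow> ('n, 'a) mpol"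
  where "trunc E d p = (if d \<le> E then hcomp (E - d) p else 0)"

lemma hom_shift_trunc: "hom_shift E d (trunc E d p)"
  by (simp add: hom_shift_iff trunc_def)

lemma trunc_hom: "hom_shift E d p \<Longrightarrow> trunc E d p = p"
  by (auto simp: hom_shift_iff trunc_def hcomp_hom_deg split: if_splits)

lemma trunc_sum: "trunc E d (sum f A) = (\<Sum>a\<in>A. trunc E d (f a))"
  by (simp add: trunc_def hcomp_sum)

lemma trunc_mult:
  fixes p q :: "('n::finite, 'a::comm_ring_1) mpol"
  assumes "hom_deg e q"
  shows "trunc E d (p * q) = trunc E (d + e) p * q"
proof -
  consider "d + e \<le> E" | "d \<le> E" "\<not> d + e \<le> E" | "\<not> d \<le> E" by linarith
  then show ?thesis
    by cases (simp_all add: trunc_def hcomp_mult_hom[OF assms] diff_diff_left le_diff_conv2 add.commute)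
qed

text \<open>
  The zero diagonal is required separately because the characteristic may be 2.
\<close>

definition alternating :: "('n \<Rightarrow> 'n \<Rightarrow> 'a::comm_ring_1) \<Rightarrow> bool"
  where "alternating S \<longleftrightarrow> (\<forall>j. S j j = 0) \<and> (\<forall>j k. S j k = - S k j)"

lemma alternatingI: "(\<And>j. S j j = 0) \<Longrightarrow> (\<And>j k. S j k = - S k j) \<Longrightarrow> alternating S"
  unfolding alternating_def by blast

lemma alternating_diag: "alternating S \<Longrightarrow> S j j = 0"
  unfolding alternating_def by blast

lemma alternating_swap: "alternating S \<Longrightarrow> S j k = - S k j"
  unfolding alternating_def by blast

lemma alternating_0: "alternating (\<lambda>_ _. 0)"
  by (rule alternatingI) simp_all

lemma alternating_trunc:
  assumes S: "alternating S" and m: "\<And>j k. m j k = m k j"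
  shows "alternating (\<lambda>j k. trunc E (m j k) (S j k))"
proof (rule alternatingI)
  show "trunc E (m j j) (S j j) = 0" for j
    using alternating_diag[OF S] by (simp add: trunc_def)
  show "trunc E (m j k) (S j k) = - trunc E (m k j) (S k j)" for j k
    using alternating_swap[OF S, of j k] m[of j k] by (simp add: trunc_def hcomp_minus)
qed

lemma alternating_sum:
  fixes S :: "'n \<Rightarrow> 'n \<Rightarrow> 'a::comm_ring_1"
  assumes "alternating S" "finite A"
  shows "(\<Sum>j\<in>A. \<Sum>k\<in>A. S j k * x k * x j) = 0"
  using assms(2)
proof (induction A)
  case (insert a A)
  note 1 = alternating_diag[OF assms(1), of a]
  have "(\<Sum>j\<in>insert a A. \<Sum>k\<in>insert a A. S j k * x k * x j)
    = (\<Sum>k\<in>A. S a k * x k * x a) + (\<Sum>j\<in>A. S j a * x a * x j + (\<Sum>k\<in>A. S j k * x k * x j))"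
    using insert.hyps by (simp add: 1)
  also have "\<dots> = (\<Sum>k\<in>A. S a k * x k * x a + S k a * x a * x k)"
    using insert.IH by (simp add: sum.distrib)
  also have "\<dots> = 0"
  proof (intro sum.neutral ballI)
    fix k show "S a k * x k * x a + S k a * x a * x k = 0"
      using alternating_swap[OF assms(1), of a k] by (simp add: mult_ac)
  qed
  finally show ?case .
qed simp

definition koszul :: "('n::finite \<Rightarrow> 'a::comm_ring_1) \<Rightarrow> ('n \<Rightarrow> 'a) \<Rightarrow> bool"
  where "koszul f u \<longleftrightarrow> (\<exists>S. alternating S \<and> (\<forall>j. u j = (\<Sum>k\<in>UNIV. S j k * f k)))"

text \<open>
  The coefficient \<open>u\<^sub>a\<close> of a syzygy lies in the ideal of the other \<open>x\<^sub>j\<close>; subtracting the Koszul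
  syzygies that produce it leaves a syzygy without \<open>x\<^sub>a\<close>.
\<close>

lemma koszul_of_regular:
  fixes x :: "'n::finite \<Rightarrow> 'a::comm_ring_1"
  assumes reg: "\<And>A a u. a \<notin> A \<Longrightarrow> u * x a \<in> ideal_gen (x ` A) \<Longrightarrow> u \<in> ideal_gen (x ` A)"
    and u: "(\<Sum>j\<in>UNIV. u j * x j) = 0"
  shows "koszul x u"
proof -
  have "\<exists>S. alternating S \<and> (\<forall>j\<in>A. u j = (\<Sum>k\<in>A. S j k * x k))"
    if "finite A" "(\<Sum>j\<in>A. u j * x j) = 0" for A and u :: "'n \<Rightarrow> 'a"
    using that
  proof (induction A arbitrary: u)
    case empty
    show ?case by (intro exI[of _ "\<lambda>_ _. 0"]) (simp add: alternating_0)
  next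
    case (insert a A)
    have "u a * x a = (\<Sum>j\<in>A. (- u j) * x j)"
      using insert.prems insert.hyps by (simp add: sum_negf add_eq_0_iff2)
    then have "u a * x a \<in> ideal_gen (x ` A)"
      unfolding ideal_gen_image_iff[OF \<open>finite A\<close>] by (intro exI)
    then have "u a \<in> ideal_gen (x ` A)" by (rule reg[OF \<open>a \<notin> A\<close>])
    then obtain c where c: "u a = (\<Sum>j\<in>A. c j * x j)"
      unfolding ideal_gen_image_iff[OF \<open>finite A\<close>] by blast
    have "(\<Sum>j\<in>A. (u j + c j * x a) * x j) = (\<Sum>j\<in>A. u j * x j) + x a * (\<Sum>j\<in>A. c j * x j)"
      unfolding distrib_right sum.distrib sum_distrib_left by (simp only: mult_ac)
    also have "\<dots> = 0"
      unfolding c[symmetric] using insert.prems insert.hyps by (simp add: mult.commute add.commute)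
    finally obtain S where S: "alternating S" "\<And>j. j \<in> A \<Longrightarrow> u j + c j * x a = (\<Sum>k\<in>A. S j k * x k)"
      using insert.IH[of "\<lambda>j. u j + c j * x a"] by blast
    \<comment> \<open>the Koszul syzygies between \<open>a\<close> and \<open>A\<close> that were subtracted, bordered around \<open>S\<close>\<close>
    define T where "T j k = (if j = a then if k = a then 0 else c k
      else if k = a then - c j else S j k)" for j k
    have "alternating T"
    proof (rule alternatingI)
      show "T j j = 0" for j using alternating_diag[OF S(1)] by (simp add: T_def)
      show "T j k = - T k j" for j k using alternating_swap[OF S(1), of j k] by (simp add: T_def)
    qed
    moreover have "u j = (\<Sum>k\<in>insert a A. T j k * x k)" if "j \<in> insert a A" for j
    proof (cases "j = a")
      case True
      have "(\<Sum>k\<in>insert a A. T a k * x k) = (\<Sum>k\<in>A. c k * x k)"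
        using insert.hyps by (auto simp: T_def intro!: sum.cong)
      then show ?thesis using c True by simp
    next
      case False
      then have "(\<Sum>k\<in>insert a A. T j k * x k) = - c j * x a + (\<Sum>k\<in>A. S j k * x k)"
        using insert.hyps by (auto simp: T_def intro!: sum.cong)
      moreover have "u j = (\<Sum>k\<in>A. S j k * x k) - c j * x a"
        using S(2)[of j] False that by (simp add: eq_diff_eq)
      ultimately show ?thesis by simp
    qed
    ultimately show ?case by blast
  qed
  from this[OF finite u] show ?thesis by (auto simp: koszul_def)
qed

lemma koszul_powers:
  fixes u :: "'n::finite \<Rightarrow> ('n, 'k::comm_ring_1) mpol"
  assumes u: "(\<Sum>j\<in>UNIV. u j * Indet j ^ N) = 0"
  shows "koszul (\<lambda>j. Indet j ^ N) u"
proof (rule koszul_of_regular[OF _ u])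
  fix A a and u :: "('n, 'k) mpol"
  assume a: "a \<notin> A" and "u * Indet a ^ N \<in> ideal_gen ((\<lambda>j. Indet j ^ N) ` A)"
  then obtain c where c: "u * Indet a ^ N = (\<Sum>j\<in>A. c j * Indet j ^ N)"
    unfolding ideal_gen_image_iff[OF finite] by blast
  have "single s (lookup u s) \<in> ideal_gen ((\<lambda>j. Indet j ^ N) ` A)"
    if s: "s \<in> keys u" for s
  proof -
    let ?s = "single a N + s"
    have "lookup (u * Indet a ^ N) ?s = lookup u s"
      unfolding Indet_power mult.commute[of u] by (rule lookup_Monom_mult_add)
    then have "(\<Sum>j\<in>A. lookup (c j * Indet j ^ N) ?s) \<noteq> 0"
      using s by (simp add: c lookup_sum in_keys_iff)
    then obtain j where j: "j \<in> A" "lookup (c j * Indet j ^ N) ?s \<noteq> 0"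
      by (meson sum.not_neutral_contains_not_neutral)
    have "\<not> lookup (single j N) j > lookup ?s j"
      using j(2) lookup_Monom_mult_other[of ?s j "single j N" "c j"]
      unfolding Indet_power mult.commute[of "c j"] by blast
    moreover have "j \<noteq> a" using j(1) a by blast
    ultimately have "lookup s j \<ge> N" by (simp add: lookup_add lookup_single when_def)
    then have "lookup (single j N) i \<le> lookup s i" for i
      by (auto simp: lookup_single when_def)
    then obtain w where w: "s = single j N + w" by (rule trm_diffE)
    have "single s (lookup u s) = (Const (lookup u s) * Monom w) * Indet j ^ N"
      unfolding single_eq_Const_Monom Indet_power by (simp only: w Monom_add mult_ac)
    also have "\<dots> \<in> ideal_gen ((\<lambda>j. Indet j ^ N) ` A)"
      using j(1) by (intro ideal_mult is_ideal_gen ideal_gen_base) auto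
    finally show ?thesis .
  qed
  then have "(\<Sum>s\<in>keys u. single s (lookup u s)) \<in> ideal_gen ((\<lambda>j. Indet j ^ N) ` A)"
    by (intro ideal_sum is_ideal_gen)
  then show "u \<in> ideal_gen ((\<lambda>j. Indet j ^ N) ` A)"
    using mpol_expand[of "keys u" u] by simp
qed

lemma koszul_add:
  assumes "koszul f u" "koszul f v"
  shows "koszul f (\<lambda>j. u j + v j)"
proof -
  from assms obtain S T where ST: "alternating S" "alternating T"
    "\<And>j. u j = (\<Sum>k\<in>UNIV. S j k * f k)" "\<And>j. v j = (\<Sum>k\<in>UNIV. T j k * f k)"
    unfolding koszul_def by blast
  then show ?thesis
    unfolding koszul_def
  proof (intro exI[of _ "\<lambda>j k. S j k + T j k"] conjI)
    show "alternating (\<lambda>j k. S j k + T j k)"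
    proof (rule alternatingI)
      show "S j j + T j j = 0" for j using ST(1,2) by (simp add: alternating_diag)
      show "S j k + T j k = - (S k j + T k j)" for j k
        using alternating_swap[OF ST(1), of j k] alternating_swap[OF ST(2), of j k] by simp
    qed
  qed (simp add: ST distrib_right sum.distrib)
qed

lemma koszul_syzygy:
  assumes "koszul f u"
  shows "(\<Sum>j\<in>UNIV. u j * f j) = 0"
proof -
  obtain S where S: "alternating S" "\<And>j. u j = (\<Sum>k\<in>UNIV. S j k * f k)"
    using assms unfolding koszul_def by blast
  then show ?thesis using alternating_sum[OF S(1) finite, of f] by (simp add: sum_distrib_right)
qed

text \<open>
  The leading forms of a syzygy of \<open>f\<close> are a syzygy of the powers \<open>x\<^sub>j\<^sup>N\<close>, hence Koszul; subtracting
  the corresponding Koszul syzygy of \<open>f\<close> lowers the degree.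
\<close>

lemma (in residue) koszul_f:
  assumes "(\<Sum>j\<in>UNIV. u j * f j) = 0"
  shows "koszul f u"
proof -
  have "koszul f u" if "\<And>j s. d \<le> tdeg s \<Longrightarrow> lookup (u j) s = 0" "(\<Sum>j\<in>UNIV. u j * f j) = 0"
    for d and u :: "'n \<Rightarrow> ('n, 'k) mpol"
    using that
  proof (induction d arbitrary: u)
    case 0
    then have "u j = 0" for j by (intro poly_mapping_eqI) simp
    then show ?case unfolding koszul_def
      by (intro exI[of _ "\<lambda>_ _. 0"]) (simp add: alternating_0)
  next
    case (Suc d)
    have du: "deg_le d (u j)" for j using Suc.prems(1) by (simp add: deg_le_def)
    have df: "deg_le N (f j)" for j
      unfolding f_def by (intro deg_le_diff deg_le_Indet_power deg_le_mono[OF deg_e]) simp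
    have hf: "hcomp N (f j) = Indet j ^ N" for j
      using deg_le_hcomp_0[OF deg_e, of N j] N_pos
      unfolding f_def hcomp_diff Indet_power by (simp add: hcomp_hom_deg[OF hom_deg_Monom[OF refl]])
    have "(\<Sum>j\<in>UNIV. hcomp d (u j) * Indet j ^ N) = (\<Sum>j\<in>UNIV. hcomp (d + N) (u j * f j))"
      by (simp only: hcomp_mult[OF du df] hf)
    also have "\<dots> = hcomp (d + N) (\<Sum>j\<in>UNIV. u j * f j)" by (simp only: hcomp_sum)
    also have "\<dots> = 0" by (simp add: Suc.prems(2))
    finally have "koszul (\<lambda>j. Indet j ^ N) (\<lambda>j. hcomp d (u j))" by (rule koszul_powers)
    then obtain S where S: "alternating S" "\<And>j. hcomp d (u j) = (\<Sum>k\<in>UNIV. S j k * Indet k ^ N)"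
      unfolding koszul_def by blast
    define T where "T j k = trunc d N (S j k)" for j k
    have altT: "alternating T" unfolding T_def by (rule alternating_trunc[OF S(1) refl])
    have hI: "hom_deg N (Indet k ^ N :: ('n, 'k) mpol)" for k
      unfolding Indet_power by (rule hom_deg_Monom) simp
    have T: "hcomp d (u j) = (\<Sum>k\<in>UNIV. T j k * Indet k ^ N)" for j
    proof -
      have "hcomp d (u j) = trunc d 0 (hcomp d (u j))"
        by (simp add: trunc_def hcomp_hom_deg[OF hom_deg_hcomp])
      then show ?thesis unfolding S(2) trunc_sum trunc_mult[OF hI] T_def by simp
    qed
    have dT: "deg_le d (T j k * f k)" for j k
    proof (cases "N \<le> d")
      case True
      then have "deg_le (d - N + N) (T j k * f k)"
        by (intro deg_le_mult df) (simp add: T_def trunc_def hom_deg_imp_deg_le)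
      then show ?thesis using True by simp
    qed (simp add: T_def trunc_def)
    have hT: "hcomp d (T j k * f k) = T j k * Indet k ^ N" for j k
    proof (cases "N \<le> d")
      case True
      have "deg_le (d - N) (T j k)" using True by (simp add: T_def trunc_def hom_deg_imp_deg_le)
      from hcomp_mult[OF this df, of k] show ?thesis
        using True by (simp add: hf) (simp add: T_def trunc_def hcomp_hom_deg[OF hom_deg_hcomp])
    qed (simp add: T_def trunc_def)
    define w where "w j = (\<Sum>k\<in>UNIV. T j k * f k)" for j
    have kw: "koszul f w" unfolding koszul_def w_def using altT by blast
    have "koszul f (\<lambda>j. u j - w j)"
    proof (rule Suc.IH)
      fix j and s :: "'n trm" assume s: "d \<le> tdeg s"
      show "lookup (u j - w j) s = 0"
      proof (cases "tdeg s = d")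
        case True
        have "hcomp d (u j - w j) = 0"
          unfolding hcomp_diff w_def hcomp_sum hT T by simp
        then have "lookup (hcomp d (u j - w j)) s = 0" by simp
        then show ?thesis using True by (simp add: lookup_hcomp)
      next
        case False
        have "deg_le d (u j - w j)" unfolding w_def by (intro deg_le_diff deg_le_sum du dT)
        then show ?thesis using False s by (simp add: deg_le_def)
      qed
    next
      show "(\<Sum>j\<in>UNIV. (u j - w j) * f j) = 0"
        using Suc.prems(2) koszul_syzygy[OF kw] by (simp add: left_diff_distrib sum_subtractf)
    qed
    from koszul_add[OF this kw] show ?case by simp
  qed
  moreover obtain D where D: "\<forall>j\<in>UNIV. deg_le D (u j)" using ex_deg_le_finite[of UNIV u] by auto
  then have "lookup (u j) s = 0" if "Suc D \<le> tdeg s" for j s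
    using that by (simp add: deg_le_def)
  ultimately show ?thesis using assms by blast
qed

subsection \<open>Homogeneous systems of parameters\<close>

text \<open>
  Column \<open>j\<close> of the adjugate consists of the determinants of \<open>B\<close> with row \<open>j\<close> replaced by unit
  vectors, so that pairing it with row \<open>i\<close> puts row \<open>i\<close> in place of row \<open>j\<close>.
\<close>

lemma adjugate:
  fixes B :: "'a::comm_ring_1 ^ 'n::finite ^ 'n"
  shows "\<exists>M. \<forall>i j. (\<Sum>k\<in>UNIV. B $ i $ k * M k j) = (if i = j then det B else 0)"
proof (intro exI allI)
  fix i j
  let ?R = "\<lambda>v. det (\<chi> r. if r = j then v else B $ r)"
  have "(\<Sum>k\<in>UNIV. B $ i $ k * ?R (axis k 1)) = (\<Sum>k\<in>UNIV. ?R (B $ i $ k *s axis k 1))"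
    by (simp only: det_row_mul[of j _ "\<lambda>_. axis _ 1" "\<lambda>r. B $ r"])
  also have "\<dots> = ?R (\<Sum>k\<in>UNIV. B $ i $ k *s axis k 1)"
    using det_linear_row_sum[of UNIV j "\<lambda>_ k. B $ i $ k *s axis k 1" "\<lambda>r. B $ r"] by simp
  also have "(\<Sum>k\<in>UNIV. B $ i $ k *s axis k 1) = B $ i"
    by (simp add: vec_eq_iff axis_def if_distrib cong: if_cong)
  also have "?R (B $ i) = (if i = j then det B else 0)"
  proof (cases "i = j")
    case True
    then have "(\<chi> r. if r = j then B $ i else B $ r) = B" by (simp add: vec_eq_iff)
    then show ?thesis using True by simp
  next
    case False
    then show ?thesis by (simp, intro det_identical_rows[of i j]) (auto simp: row_def vec_eq_iff)
  qed
  finally show "(\<Sum>k\<in>UNIV. B $ i $ k * ?R (axis k 1)) = (if i = j then det B else 0)" .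
qed

definition koszul_on :: "('n \<Rightarrow> nat) \<Rightarrow> ('n::finite \<Rightarrow> ('n, 'k::comm_ring_1) mpol) \<Rightarrow> 'n set \<Rightarrow> bool"
  where "koszul_on d g A \<longleftrightarrow> (\<forall>E u. (\<forall>j\<in>A. hom_shift E (d j) (u j)) \<longrightarrow> (\<Sum>j\<in>A. u j * g j) = 0 \<longrightarrow>
    (\<exists>S. alternating S \<and> (\<forall>j\<in>A. u j = (\<Sum>k\<in>A. S j k * g k))))"

text \<open>
  With \<open>f = g B\<close> as in \<open>unit_multiple\<close>, a syzygy \<open>u\<close> of \<open>g\<close> gives the syzygy \<open>adj(B) u\<close> of \<open>f\<close>, which
  is Koszul, say \<open>S f\<close>. Applying \<open>B\<close> gives \<open>det B u = (B S B\<^sup>T) g\<close>, and as \<open>det B\<close> has constant term 1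
  the component of the degree of \<open>u\<close> is a Koszul expression of \<open>u\<close> itself.
\<close>

lemma koszul_on_UNIV:
  fixes g :: "'n::finite \<Rightarrow> ('n, 'k::field) mpol"
  assumes hom: "\<And>j. hom_deg (d j) (g j)" and pow: "\<And>i. Indet i ^ M \<in> ideal_gen (range g)"
  shows "koszul_on d g UNIV"
  unfolding koszul_on_def
proof (intro allI impI)
  fix E and u :: "'n \<Rightarrow> ('n, 'k) mpol"
  assume u: "\<forall>j\<in>UNIV. hom_shift E (d j) (u j)" and syz: "(\<Sum>j\<in>UNIV. u j * g j) = 0"
  define N where "N = (\<Sum>j\<in>UNIV. d j) + M + 1"
  have "deg_le (N - 1) (- g j)" for j
  proof -
    have "d j \<le> (\<Sum>j\<in>UNIV. d j)" by (rule member_le_sum) auto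
    then show ?thesis
      using hom_deg_imp_deg_le[OF hom, of j] deg_le_mono[of "d j" "g j" "N - 1"]
      by (simp add: N_def deg_le_minus)
  qed
  then interpret residue "\<lambda>j. - g j" N
    by unfold_locales (auto simp: N_def)
  have pow': "Indet i ^ (N - 1) \<in> ideal_gen (range g)" for i
    by (rule ideal_power_mono[OF is_ideal_gen pow]) (simp add: N_def)
  obtain B :: "('n, 'k) mpol ^ 'n ^ 'n" where B: "lookup (det B) 0 = 1"
    "\<And>j. f j = (\<Sum>k\<in>UNIV. g k * B $ k $ j)"
    using unit_multiple(2)[of g, OF refl refl pow'] by blast
  obtain Q where Q: "\<And>i j. (\<Sum>k\<in>UNIV. B $ i $ k * Q k j) = (if i = j then det B else 0)"
    using adjugate[of B] by blast
  define v where "v k = (\<Sum>j\<in>UNIV. Q k j * u j)" for k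
  have Bv: "(\<Sum>k\<in>UNIV. B $ i $ k * v k) = det B * u i" for i
  proof -
    have "(\<Sum>k\<in>UNIV. B $ i $ k * v k) = (\<Sum>k\<in>UNIV. \<Sum>j\<in>UNIV. B $ i $ k * Q k j * u j)"
      by (simp only: v_def sum_distrib_left mult.assoc)
    also have "\<dots> = (\<Sum>j\<in>UNIV. (\<Sum>k\<in>UNIV. B $ i $ k * Q k j) * u j)"
      by (subst sum.swap) (simp only: sum_distrib_right)
    also have "\<dots> = (\<Sum>j\<in>UNIV. if i = j then det B * u i else 0)"
      unfolding Q by (intro sum.cong) auto
    finally show ?thesis by simp
  qed
  have "(\<Sum>k\<in>UNIV. v k * f k) = (\<Sum>k\<in>UNIV. \<Sum>i\<in>UNIV. g i * (B $ i $ k * v k))"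
    by (simp only: B(2) sum_distrib_left mult_ac)
  also have "\<dots> = (\<Sum>i\<in>UNIV. g i * (\<Sum>k\<in>UNIV. B $ i $ k * v k))"
    by (subst sum.swap) (simp only: sum_distrib_left)
  also have "\<dots> = det B * (\<Sum>i\<in>UNIV. u i * g i)"
    unfolding Bv by (simp only: sum_distrib_left mult_ac)
  finally have "(\<Sum>k\<in>UNIV. v k * f k) = 0" by (simp add: syz)
  then have "koszul f v" by (rule koszul_f)
  then obtain S where S: "alternating S" "\<And>k. v k = (\<Sum>l\<in>UNIV. S k l * f l)"
    unfolding koszul_def by blast
  define T where "T i p = (\<Sum>k\<in>UNIV. \<Sum>l\<in>UNIV. S k l * B $ p $ l * B $ i $ k)" for i p
  have "T i i = 0" for i
    unfolding T_def by (rule alternating_sum[OF S(1) finite])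
  moreover have "T i p = - T p i" for i p
  proof -
    have "T i p = (\<Sum>l\<in>UNIV. \<Sum>k\<in>UNIV. S k l * B $ p $ l * B $ i $ k)"
      unfolding T_def by (rule sum.swap)
    also have "\<dots> = (\<Sum>l\<in>UNIV. \<Sum>k\<in>UNIV. - (S l k * B $ i $ k * B $ p $ l))"
    proof (intro sum.cong refl)
      fix k l show "S k l * B $ p $ l * B $ i $ k = - (S l k * B $ i $ k * B $ p $ l)"
        using alternating_swap[OF S(1), of k l] by (simp add: mult_ac)
    qed
    finally show ?thesis unfolding T_def by (simp add: sum_negf)
  qed
  ultimately have altT: "alternating T" by (rule alternatingI)
  have Du: "det B * u i = (\<Sum>p\<in>UNIV. T i p * g p)" for i
  proof -
    have "det B * u i = (\<Sum>k\<in>UNIV. \<Sum>l\<in>UNIV. \<Sum>p\<in>UNIV. S k l * B $ p $ l * B $ i $ k * g p)"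
      unfolding Bv[symmetric] S(2) B(2) by (simp only: sum_distrib_left mult_ac)
    also have "\<dots> = (\<Sum>k\<in>UNIV. \<Sum>p\<in>UNIV. \<Sum>l\<in>UNIV. S k l * B $ p $ l * B $ i $ k * g p)"
      by (intro sum.cong refl sum.swap)
    also have "\<dots> = (\<Sum>p\<in>UNIV. \<Sum>k\<in>UNIV. \<Sum>l\<in>UNIV. S k l * B $ p $ l * B $ i $ k * g p)"
      by (rule sum.swap)
    also have "\<dots> = (\<Sum>p\<in>UNIV. T i p * g p)"
      unfolding T_def by (simp only: sum_distrib_right)
    finally show ?thesis .
  qed
  have "u i = (\<Sum>p\<in>UNIV. trunc E (d i + d p) (T i p) * g p)" for i
  proof -
    have ui: "hom_shift E (d i) (u i)" using u by blast
    have "trunc E (d i) (det B * u i) = u i"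
    proof (cases "d i \<le> E")
      case True
      then have "hom_deg (E - d i) (u i)" using ui by (simp add: hom_shift_iff)
      then have "trunc E (d i) (det B * u i) = hcomp 0 (det B) * u i"
        using True by (simp add: trunc_def hcomp_mult_hom)
      moreover have "hcomp 0 (det B) = 1"
        using B(1) by (intro poly_mapping_eqI)
          (auto simp: lookup_hcomp lookup_one when_def tdeg_eq_0_iff)
      ultimately show ?thesis by simp
    next
      case False then show ?thesis using ui by (simp add: hom_shift_iff trunc_def)
    qed
    then show ?thesis unfolding Du trunc_sum trunc_mult[OF hom] by simp
  qed
  then show "\<exists>S. alternating S \<and> (\<forall>j\<in>UNIV. u j = (\<Sum>k\<in>UNIV. S j k * g k))"
    using alternating_trunc[OF altT, of "\<lambda>j k. d j + d k" E] by (auto simp: add.commute)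
qed

text \<open>
  A Koszul expression of a syzygy without \<open>g\<^sub>a\<close> may still involve \<open>g\<^sub>a\<close>, but the coefficients of \<open>g\<^sub>a\<close>
  form a syzygy of smaller degree, to which induction applies. This is the graded Nakayama argument
  for the first Koszul homology.
\<close>

lemma koszul_on_remove:
  fixes g :: "'n::finite \<Rightarrow> ('n, 'k::comm_ring_1) mpol"
  assumes hom: "\<And>j. hom_deg (d j) (g j)" and pos: "d a > 0" and a: "a \<notin> A"
    and K: "koszul_on d g (insert a A)"
  shows "koszul_on d g A"
proof -
  have "\<exists>S. alternating S \<and> (\<forall>j\<in>A. u j = (\<Sum>k\<in>A. S j k * g k))"
    if "\<forall>j\<in>A. hom_shift E (d j) (u j)" "(\<Sum>j\<in>A. u j * g j) = 0" for E and u :: "'n \<Rightarrow> ('n, 'k) mpol"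
    using that
  proof (induction E arbitrary: u rule: less_induct)
    case (less E)
    define u' where "u' j = (if j = a then 0 else u j)" for j
    have ns: "(\<Sum>j\<in>insert a A. y j) = y a + (\<Sum>j\<in>A. y j)" for y :: "'n \<Rightarrow> ('n, 'k) mpol"
      using a by simp
    have "(\<Sum>j\<in>A. u' j * g j) = (\<Sum>j\<in>A. u j * g j)"
      using a by (intro sum.cong) (auto simp: u'_def)
    then have 1: "(\<Sum>j\<in>insert a A. u' j * g j) = 0"
      unfolding ns using less.prems(2) by (simp add: u'_def)
    have 2: "\<forall>j\<in>insert a A. hom_shift E (d j) (u' j)"
      using less.prems(1) by (auto simp: u'_def hom_shift_def)
    obtain S where S: "alternating S" "\<And>j. j \<in> insert a A \<Longrightarrow> u' j = (\<Sum>k\<in>insert a A. S j k * g k)"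
      using K 1 2 unfolding koszul_on_def by blast
    define T where "T j k = trunc E (d j + d k) (S j k)" for j k
    have altT: "alternating T" unfolding T_def by (rule alternating_trunc[OF S(1) add.commute])
    have uT: "u' j = (\<Sum>k\<in>insert a A. T j k * g k)" if "j \<in> insert a A" for j
    proof -
      have "u' j = trunc E (d j) (u' j)" using trunc_hom[OF bspec[OF 2 that]] by simp
      also have "\<dots> = (\<Sum>k\<in>insert a A. T j k * g k)"
        unfolding S(2)[OF that] trunc_sum trunc_mult[OF hom] T_def ..
      finally show ?thesis .
    qed
    note T0 = alternating_diag[OF altT, of a] and Ta = alternating_swap[OF altT, of _ a]
    have w0: "(\<Sum>k\<in>A. T a k * g k) = 0"
      using uT[of a] unfolding ns by (simp add: T0 u'_def)
    have uA: "u j = (\<Sum>k\<in>A. T j k * g k) - T a j * g a" if "j \<in> A" for j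
    proof -
      have "u j = u' j" using that a by (auto simp: u'_def)
      also have "\<dots> = T j a * g a + (\<Sum>k\<in>A. T j k * g k)" using uT[of j] that unfolding ns by simp
      finally show ?thesis using Ta[of j] by simp
    qed
    show ?case
    proof (cases "d a \<le> E")
      case False
      then have "T a j = 0" for j by (simp add: T_def trunc_def)
      then show ?thesis using altT uA by (intro exI[of _ T]) simp
    next
      case True
      have "hom_shift (E - d a) (d k) (T a k)" for k
        using hom_shift_trunc[of E "d a + d k" "S a k"] True
        unfolding T_def hom_shift_def by auto
      then obtain R where R: "alternating R" "\<And>j. j \<in> A \<Longrightarrow> T a j = (\<Sum>k\<in>A. R j k * g k)"
        using less.IH[of "E - d a" "T a"] w0 True pos by auto
      have "alternating (\<lambda>j k. T j k - R j k * g a)"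
      proof (rule alternatingI)
        show "T j j - R j j * g a = 0" for j
          using alternating_diag[OF altT] alternating_diag[OF R(1)] by simp
        show "T j k - R j k * g a = - (T k j - R k j * g a)" for j k
          using alternating_swap[OF altT, of j k] alternating_swap[OF R(1), of j k] by simp
      qed
      moreover have "u j = (\<Sum>k\<in>A. (T j k - R j k * g a) * g k)" if "j \<in> A" for j
      proof -
        have "(\<Sum>k\<in>A. (T j k - R j k * g a) * g k) = (\<Sum>k\<in>A. T j k * g k) - (\<Sum>k\<in>A. R j k * g k) * g a"
          unfolding left_diff_distrib sum_subtractf sum_distrib_right by (simp only: mult_ac)
        then show ?thesis using uA[OF that] R(2)[OF that] by simp
      qed
      ultimately show ?thesis by blast
    qed
  qed
  then show ?thesis unfolding koszul_on_def by blast
qed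

lemma koszul_on_all:
  fixes g :: "'n::finite \<Rightarrow> ('n, 'k::field) mpol"
  assumes hom: "\<And>j. hom_deg (d j) (g j)" and pos: "\<And>j. d j > 0"
    and pow: "\<And>i. Indet i ^ M \<in> ideal_gen (range g)"
  shows "koszul_on d g A"
proof -
  have "koszul_on d g (- B)" if "finite B" for B
    using that
  proof (induction B)
    case empty then show ?case using koszul_on_UNIV[OF hom pow] by simp
  next
    case (insert b B)
    have "insert b (- insert b B) = - B" using insert.hyps by auto
    then show ?case using koszul_on_remove[OF hom pos, of b "- insert b B"] insert.IH by simp
  qed
  from this[of "- A"] show ?thesis by simp
qed

text \<open>
  If \<open>p g\<^sub>a\<close> is a combination of the preceding \<open>g\<^sub>k\<close>, then each component of \<open>p\<close> is the coefficient of
  \<open>g\<^sub>a\<close> in a homogeneous syzygy, and a Koszul expression exhibits it in the ideal of the \<open>g\<^sub>k\<close>.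
\<close>

lemma regular_sequence_of_parameters:
  fixes g :: "'n::finite \<Rightarrow> ('n, 'k::field) mpol"
  assumes hom: "\<And>j. hom_deg (d j) (g j)" and pos: "\<And>j. d j > 0"
    and pow: "\<And>i. Indet i ^ M \<in> ideal_gen (range g)" and proper: "1 \<notin> ideal_gen (range g)"
    and xs: "distinct xs" "set xs = UNIV"
  shows "regular_sequence (map g xs)"
  unfolding regular_sequence_def
proof (intro conjI allI impI)
  show "1 \<notin> ideal_gen (set (map g xs))" using proper xs by simp
  fix i p
  assume i: "i < length (map g xs)"
  define A where "A = set (take i xs)"
  define a where "a = xs ! i"
  have iA: "set (take i (map g xs)) = g ` A" by (simp add: take_map A_def)
  have aA: "a \<notin> A"
    using i xs(1) unfolding A_def a_def by (auto simp: in_set_conv_nth nth_eq_iff_index_eq)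
  assume "p * map g xs ! i \<in> ideal_gen (set (take i (map g xs)))"
  then have "p * g a \<in> ideal_gen (g ` A)" using i by (simp add: iA a_def)
  then obtain q where q: "p * g a = (\<Sum>k\<in>A. q k * g k)"
    unfolding ideal_gen_image_iff[OF finite] by blast
  have "hcomp e p \<in> ideal_gen (g ` A)" for e
  proof -
    define E where "E = e + d a"
    define u where "u j = (if j = a then hcomp e p else - trunc E (d j) (q j))" for j
    have "hcomp E (p * g a) = hcomp e p * g a" by (simp add: hcomp_mult_hom[OF hom] E_def)
    moreover have "hcomp E (p * g a) = (\<Sum>k\<in>A. trunc E (d k) (q k) * g k)"
      unfolding q hcomp_sum by (intro sum.cong refl) (simp add: hcomp_mult_hom[OF hom] trunc_def)
    ultimately have *: "hcomp e p * g a = (\<Sum>k\<in>A. trunc E (d k) (q k) * g k)" by simp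
    have "(\<Sum>k\<in>A. u k * g k) = (\<Sum>k\<in>A. - (trunc E (d k) (q k) * g k))"
      using aA by (intro sum.cong refl) (auto simp: u_def)
    then have syz: "(\<Sum>k\<in>insert a A. u k * g k) = 0"
      using aA * by (simp add: sum_negf) (simp add: u_def)
    have "hom_shift E (d j) (u j)" for j
    proof (cases "j = a")
      case True then show ?thesis by (simp add: u_def hom_shift_iff E_def)
    next
      case False
      then show ?thesis using hom_shift_trunc[of E "d j" "q j"] by (simp add: u_def hom_shift_def)
    qed
    then obtain S where S: "alternating S" "\<forall>j\<in>insert a A. u j = (\<Sum>k\<in>insert a A. S j k * g k)"
      using koszul_on_all[OF hom pos pow, of "insert a A"] syz unfolding koszul_on_def by blast
    have "S a a = 0" by (rule alternating_diag[OF S(1)])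
    then have "hcomp e p = (\<Sum>k\<in>A. S a k * g k)"
      using S(2) aA by (simp add: u_def)
    then show ?thesis unfolding ideal_gen_image_iff[OF finite] by (intro exI)
  qed
  then have h: "(\<Sum>e\<le>D. hcomp e p) \<in> ideal_gen (g ` A)" for D
    by (intro ideal_sum is_ideal_gen)
  obtain D where D: "deg_le D p" using ex_deg_le by blast
  have "p \<in> ideal_gen (g ` A)" by (subst mpol_sum_hcomp[OF D]) (rule h)
  then show "p \<in> ideal_gen (set (take i (map g xs)))" by (simp add: iA)
qed


section \<open>Border bases\<close>

lemma funpow_commute:
  assumes "\<And>x. F (G x) = G (F x)"
  shows "(F ^^ n) (G x) = G ((F ^^ n) x)"
  by (induction n) (simp_all add: assms)

text \<open>
  Commuting operators extend to an action of the monoid of terms. The induction adds one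
  indeterminate \<open>q\<close> at a time, which so far acted trivially.
\<close>

lemma ex_term_action:
  fixes F :: "'n::finite \<Rightarrow> 'a \<Rightarrow> 'a"
  assumes comm: "\<And>r s x. F r (F s x) = F s (F r x)"
  shows "\<exists>v :: 'n trm \<Rightarrow> 'a. v 0 = x \<and> (\<forall>r s. v (var_trm r + s) = F r (v s))"
proof -
  have "\<exists>v :: 'n trm \<Rightarrow> 'a. v 0 = x \<and>
      (\<forall>r s. v (var_trm r + s) = (if r \<in> B then F r (v s) else v s))" if "finite B" for B
    using that
  proof (induction B)
    case empty
    show ?case by (intro exI[of _ "\<lambda>_. x"]) simp
  next
    case (insert q B)
    then obtain v :: "'n trm \<Rightarrow> 'a" where v: "v 0 = x"
      "\<And>r s. v (var_trm r + s) = (if r \<in> B then F r (v s) else v s)" by blast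
    show ?case
    proof (intro exI[of _ "\<lambda>s. (F q ^^ lookup s q) (v s)"] conjI allI)
      show "(F q ^^ lookup 0 q) (v 0) = x" using v by simp
      fix r s
      show "(F q ^^ lookup (var_trm r + s) q) (v (var_trm r + s)) =
        (if r \<in> insert q B then F r ((F q ^^ lookup s q) (v s)) else (F q ^^ lookup s q) (v s))"
        using insert.hyps by (auto simp: v lookup_add lookup_var_trm funpow_commute[of "F q" "F r", OF comm])
    qed
  qed
  from this[OF finite[of UNIV]] show ?thesis by simp
qed

definition lin :: "('m::finite \<Rightarrow> 'n trm) \<Rightarrow> 'l::comm_ring_1 ^ 'm \<Rightarrow> ('n, 'l) mpol"
  where "lin t v = (\<Sum>i\<in>UNIV. Const (v $ i) * Monom (t i))"

lemma lin_add: "lin t (v + w) = lin t v + lin t w"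
  by (simp add: lin_def Const_add distrib_right sum.distrib)

lemma lin_diff: "lin t (v - w) = lin t v - lin t w"
  by (simp add: lin_def Const_diff left_diff_distrib sum_subtractf)

lemma lin_scale: "lin t (c *s v) = Const c * lin t v"
  by (simp add: lin_def Const_mult sum_distrib_left mult.assoc)

lemma lin_0 [simp]: "lin t 0 = 0"
  by (simp add: lin_def)

lemma lin_axis: "lin t (axis j 1) = Monom (t j)"
proof -
  have "lin t (axis j 1) = (\<Sum>i\<in>UNIV. if i = j then Monom (t j) else 0)"
    unfolding lin_def by (intro sum.cong) (auto simp: axis_def)
  then show ?thesis by simp
qed

lemma mult_axis: "(A *v axis j 1) $ i = (A :: 'l::comm_ring_1 ^ 'm::finite ^ 'm) $ i $ j"
  by (simp add: matrix_vector_mult_def axis_def if_distrib cong: if_cong)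

definition border_poly ::
    "('m::finite \<Rightarrow> 'n trm) \<Rightarrow> ('v \<Rightarrow> 'n trm) \<Rightarrow> ('m \<Rightarrow> 'v \<Rightarrow> 'l::comm_ring_1) \<Rightarrow> 'v \<Rightarrow> ('n, 'l) mpol"
  where "border_poly t b \<Gamma> j = Monom (b j) - (\<Sum>i\<in>UNIV. Const (\<Gamma> i j) * Monom (t i))"

lemma I_point_eq: "I_point t b \<Gamma> = ideal_gen (range (border_poly t b \<Gamma>))"
  by (simp add: I_point_def border_poly_def[abs_def])

text \<open>
  The value at \<open>\<Gamma>\<close> of the generic multiplication matrix.
\<close>

definition point_matrix ::
    "('m::finite \<Rightarrow> 'n trm) \<Rightarrow> ('v \<Rightarrow> 'n trm) \<Rightarrow> ('m \<Rightarrow> 'v \<Rightarrow> 'l::comm_ring_1) \<Rightarrow> 'n \<Rightarrow> 'l ^ 'm ^ 'm"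
  where "point_matrix t b \<Gamma> r = (\<chi> i j.
    if \<exists>m. var_trm r + t j = t m
    then (if var_trm r + t j = t i then 1 else 0)
    else \<Gamma> i (THE m. var_trm r + t j = b m))"

definition commuting ::
    "('m::finite \<Rightarrow> 'n trm) \<Rightarrow> ('v \<Rightarrow> 'n trm) \<Rightarrow> ('m \<Rightarrow> 'v \<Rightarrow> 'l::comm_ring_1) \<Rightarrow> bool"
  where "commuting t b \<Gamma> \<longleftrightarrow> (\<forall>r s. point_matrix t b \<Gamma> r ** point_matrix t b \<Gamma> s
    = point_matrix t b \<Gamma> s ** point_matrix t b \<Gamma> r)"

definition degree_filtered ::
    "('m \<Rightarrow> 'n::finite trm) \<Rightarrow> ('v \<Rightarrow> 'n trm) \<Rightarrow> ('m \<Rightarrow> 'v \<Rightarrow> 'l::zero) \<Rightarrow> bool"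
  where "degree_filtered t b \<Gamma> \<longleftrightarrow> (\<forall>i j. tdeg (t i) > tdeg (b j) \<longrightarrow> \<Gamma> i j = 0)"

definition top_part ::
    "('m \<Rightarrow> 'n::finite trm) \<Rightarrow> ('v \<Rightarrow> 'n trm) \<Rightarrow> ('m \<Rightarrow> 'v \<Rightarrow> 'l::zero) \<Rightarrow> 'm \<Rightarrow> 'v \<Rightarrow> 'l"
  where "top_part t b \<Gamma> i j = (if tdeg (t i) = tdeg (b j) then \<Gamma> i j else 0)"

locale order_border =
  fixes t :: "'m::finite \<Rightarrow> 'n::finite trm" and b :: "'v::finite \<Rightarrow> 'n trm"
  assumes inj_t: "inj t" and ord: "order_ideal (range t)"
    and inj_b: "inj b" and range_b: "range b = border (range t)"
begin

lemma ex_one: "\<exists>i. t i = 0"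
proof -
  obtain s where "s \<in> range t" using ord by (auto simp: order_ideal_def)
  then have "0 + s \<in> range t" by simp
  then have "0 \<in> range t" using ord unfolding order_ideal_def by blast
  then show ?thesis by (metis imageE)
qed

lemma factor_in_range: "var_trm r + s \<in> range t \<Longrightarrow> s \<in> range t"
  using ord unfolding order_ideal_def by (metis add.commute)

lemma border_cases: "(\<exists>m. var_trm r + t j = t m) \<or> (\<exists>m. var_trm r + t j = b m)"
proof -
  have "var_trm r + t j \<in> range t \<or> var_trm r + t j \<in> range b"
    unfolding range_b border_def by blast
  then show ?thesis by blast
qed

lemma b_notin_t: "b m \<noteq> t i"
proof -
  have "b m \<in> border (range t)" using range_b by blast
  then show ?thesis by (auto simp: border_def)
qed

lemma border_elim: obtains r j where "b m = var_trm r + t j"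
proof -
  have "b m \<in> border (range t)" using range_b by blast
  then show thesis using that by (auto simp: border_def)
qed

lemma tdeg_b_pos: "tdeg (b m) > 0"
  by (rule border_elim[of m]) simp

lemma matrix_entry_t:
  assumes "var_trm r + t j = t m"
  shows "point_matrix t b \<Gamma> r $ i $ j = (if i = m then 1 else 0)"
  by (auto simp: point_matrix_def assms inj_eq[OF inj_t])

lemma matrix_entry_b:
  assumes "var_trm r + t j = b m"
  shows "point_matrix t b \<Gamma> r $ i $ j = \<Gamma> i m"
proof -
  have "(THE m'. b m = b m') = m" by (simp add: inj_eq[OF inj_b])
  then show ?thesis using b_notin_t by (simp add: point_matrix_def assms)
qed

text \<open>
  The multiplication matrix acts on coordinates as the indeterminate does modulo \<open>I\<close>, for any ideal
  containing the border polynomials: for \<open>I\<^sub>\<Gamma>\<close> itself this gives border division, for an ideal with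
  a given border basis it gives the commutation of the matrices.
\<close>

lemma var_times_lin:
  fixes \<Gamma> :: "'m \<Rightarrow> 'v \<Rightarrow> 'l::comm_ring_1"
  assumes I: "is_ideal I" and bI: "\<And>m. border_poly t b \<Gamma> m \<in> I"
  shows "Indet r * lin t v - lin t (point_matrix t b \<Gamma> r *v v) \<in> I"
proof -
  let ?A = "point_matrix t b \<Gamma> r"
  have T: "Indet r * Monom (t j) - (\<Sum>i\<in>UNIV. Const (?A $ i $ j) * Monom (t i)) \<in> I" for j
  proof -
    have e: "Indet r * Monom (t j) = (Monom (var_trm r + t j) :: ('n, 'l) mpol)"
      by (simp add: Indet_def Monom_add)
    from border_cases[of r j] show ?thesis
    proof (elim disjE exE)
      fix m assume m: "var_trm r + t j = t m"
      have "(\<Sum>i\<in>UNIV. Const (?A $ i $ j) * Monom (t i)) = lin t (axis m (1 :: 'l))"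
        unfolding lin_def by (intro sum.cong) (auto simp: matrix_entry_t[OF m] axis_def)
      then show ?thesis by (simp add: e m lin_axis ideal_0[OF I])
    next
      fix m assume m: "var_trm r + t j = b m"
      have "Indet r * Monom (t j) - (\<Sum>i\<in>UNIV. Const (?A $ i $ j) * Monom (t i)) = border_poly t b \<Gamma> m"
        unfolding e by (simp add: border_poly_def matrix_entry_b[OF m] m)
      then show ?thesis using bI by simp
    qed
  qed
  have "lin t (?A *v v) = (\<Sum>i\<in>UNIV. \<Sum>j\<in>UNIV. Const (v $ j) * (Const (?A $ i $ j) * Monom (t i)))"
    unfolding lin_def matrix_vector_mult_def vec_lambda_beta Const_sum Const_mult sum_distrib_right
    by (simp only: mult_ac)
  also have "\<dots> = (\<Sum>j\<in>UNIV. Const (v $ j) * (\<Sum>i\<in>UNIV. Const (?A $ i $ j) * Monom (t i)))"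
    by (subst sum.swap) (simp only: sum_distrib_left)
  finally have "Indet r * lin t v - lin t (?A *v v) = (\<Sum>j\<in>UNIV. Const (v $ j) *
      (Indet r * Monom (t j) - (\<Sum>i\<in>UNIV. Const (?A $ i $ j) * Monom (t i))))"
    by (simp only: lin_def right_diff_distrib sum_subtractf sum_distrib_left mult.left_commute)
  then show ?thesis using T by (simp only: ideal_sum ideal_mult I)
qed

lemma matrix_degree:
  assumes "degree_filtered t b \<Gamma>" "point_matrix t b \<Gamma> r $ i $ j \<noteq> 0"
  shows "tdeg (t i) \<le> Suc (tdeg (t j))"
proof -
  have d: "tdeg (var_trm r + t j) = Suc (tdeg (t j))" by simp
  from border_cases[of r j] show ?thesis
  proof (elim disjE exE)
    fix m assume m: "var_trm r + t j = t m"
    then show ?thesis using assms(2) d by (auto simp: matrix_entry_t split: if_splits)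
  next
    fix m assume m: "var_trm r + t j = b m"
    then have "\<Gamma> i m \<noteq> 0" using assms(2) by (simp add: matrix_entry_b)
    then show ?thesis using assms(1) d m unfolding degree_filtered_def by (metis not_le)
  qed
qed

lemma matrix_top_part:
  "point_matrix t b (top_part t b \<Gamma>) r $ i $ j
     = (if tdeg (t i) = Suc (tdeg (t j)) then point_matrix t b \<Gamma> r $ i $ j else 0)"
proof -
  have d: "tdeg (var_trm r + t j) = Suc (tdeg (t j))" by simp
  from border_cases[of r j] show ?thesis
  proof (elim disjE exE)
    fix m assume m: "var_trm r + t j = t m"
    then show ?thesis using d by (auto simp: matrix_entry_t)
  next
    fix m assume m: "var_trm r + t j = b m"
    then show ?thesis using d by (simp add: matrix_entry_b top_part_def)
  qed
qed

text \<open>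
  In the grading by \<open>deg t\<^sub>i - deg t\<^sub>j\<close>, multiplication matrices of degree filtered points live in
  degrees at most 1, and passing to \<open>\<Gamma>'\<close> keeps exactly the part of degree 1. The degree 2 part of a
  product is the product of the degree 1 parts.
\<close>

lemma commuting_top_part:
  assumes df: "degree_filtered t b \<Gamma>" and comm: "commuting t b \<Gamma>"
  shows "commuting t b (top_part t b \<Gamma>)"
proof -
  let ?A = "point_matrix t b \<Gamma>" and ?H = "point_matrix t b (top_part t b \<Gamma>)"
  have prod: "(?H r ** ?H s) $ i $ j = (if tdeg (t i) = Suc (Suc (tdeg (t j))) then (?A r ** ?A s) $ i $ j else 0)"
    for r s i j
  proof -
    have "?H r $ i $ k * ?H s $ k $ j
        = (if tdeg (t i) = Suc (Suc (tdeg (t j))) then ?A r $ i $ k * ?A s $ k $ j else 0)" for k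
    proof (cases "?A r $ i $ k = 0 \<or> ?A s $ k $ j = 0")
      case True then show ?thesis by (auto simp: matrix_top_part)
    next
      case False
      then have "tdeg (t i) \<le> Suc (tdeg (t k))" "tdeg (t k) \<le> Suc (tdeg (t j))"
        using matrix_degree[OF df] by blast+
      then show ?thesis by (auto simp: matrix_top_part)
    qed
    then show ?thesis unfolding matrix_matrix_mult_def by simp
  qed
  show ?thesis unfolding commuting_def
  proof (intro allI)
    fix r s
    have "?A r ** ?A s = ?A s ** ?A r" using comm by (simp add: commuting_def)
    then show "?H r ** ?H s = ?H s ** ?H r" by (simp add: vec_eq_iff prod)
  qed
qed

end

locale border_point = order_border t b
  for t :: "'m::finite \<Rightarrow> 'n::finite trm" and b :: "'v::finite \<Rightarrow> 'n trm" +
  fixes \<Gamma> :: "'m \<Rightarrow> 'v \<Rightarrow> 'l::field"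
  assumes comm: "commuting t b \<Gamma>"
begin

abbreviation "A \<equiv> point_matrix t b \<Gamma>"
abbreviation "I \<equiv> I_point t b \<Gamma>"

definition one :: 'm where "one = (SOME i. t i = 0)"

lemma t_one: "t one = 0"
  unfolding one_def using ex_one by (rule someI_ex)

text \<open>
  The coordinate vector of a term with respect to the \<open>t\<^sub>i\<close>: the multiplication matrices applied to
  the vector of the term 1. It exists because they commute.
\<close>

definition coords :: "'n trm \<Rightarrow> 'l ^ 'm"
  where "coords = (SOME v. v 0 = axis one 1 \<and> (\<forall>r s. v (var_trm r + s) = A r *v v s))"

lemma coords_0: "coords 0 = axis one 1" and coords_var: "coords (var_trm r + s) = A r *v coords s"
proof -
  have "A r *v (A s *v x) = A s *v (A r *v x)" for r s x
    using comm by (simp add: commuting_def matrix_vector_mul_assoc)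
  from someI_ex[OF ex_term_action[of "\<lambda>r. (*v) (A r)", OF this]]
  show "coords 0 = axis one 1" "coords (var_trm r + s) = A r *v coords s"
    unfolding coords_def by blast+
qed

lemma coords_t: "coords (t j) = axis j 1"
proof -
  have "\<forall>j. t j = s \<longrightarrow> coords s = axis j 1" for s
  proof (induction s rule: trm_induct)
    case 0
    have "j = one" if "t j = 0" for j using injD[OF inj_t, of j one] that t_one by simp
    then show ?case by (auto simp: coords_0)
  next
    case (var r s)
    show ?case
    proof (intro allI impI)
      fix j assume j: "t j = var_trm r + s"
      then have "var_trm r + s \<in> range t" by (metis rangeI)
      then obtain k where k: "s = t k" using factor_in_range by blast
      have c: "coords (var_trm r + s) = A r *v axis k 1" using var k by (simp add: coords_var)
      have "coords (var_trm r + s) $ i = axis j 1 $ i" for i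
        unfolding c mult_axis using matrix_entry_t[of r k j \<Gamma> i] j k by (simp add: axis_def)
      then show "coords (var_trm r + s) = axis j 1" by (simp add: vec_eq_iff)
    qed
  qed
  then show ?thesis by blast
qed

lemma coords_b: "coords (b m) $ i = \<Gamma> i m"
proof (rule border_elim[of m])
  fix r j assume "b m = var_trm r + t j"
  then show ?thesis using matrix_entry_b[of r j m] by (simp add: coords_var coords_t mult_axis)
qed

definition nf :: "('n, 'l) mpol \<Rightarrow> 'l ^ 'm"
  where "nf p = (\<Sum>s\<in>keys p. lookup p s *s coords s)"

lemma nf_superset: "finite S \<Longrightarrow> keys p \<subseteq> S \<Longrightarrow> nf p = (\<Sum>s\<in>S. lookup p s *s coords s)"
  unfolding nf_def by (rule sum.mono_neutral_left) (auto simp: in_keys_iff)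

lemma nf_add: "nf (p + q) = nf p + nf q"
proof -
  let ?S = "keys p \<union> keys q"
  have "keys (p + q) \<subseteq> ?S" by (rule keys_add)
  then have "nf (p + q) = (\<Sum>s\<in>?S. lookup (p + q) s *s coords s)" by (intro nf_superset) auto
  also have "\<dots> = (\<Sum>s\<in>?S. lookup p s *s coords s) + (\<Sum>s\<in>?S. lookup q s *s coords s)"
    by (simp add: lookup_add vec.scale_left_distrib sum.distrib)
  also have "\<dots> = nf p + nf q"
    using nf_superset[of ?S p] nf_superset[of ?S q] by simp
  finally show ?thesis .
qed

lemma nf_single: "nf (single s c) = c *s coords s"
  using nf_superset[of "{s}" "single s c"] by simp

lemma nf_0 [simp]: "nf 0 = 0"
  by (simp add: nf_def)

lemma nf_Monom: "nf (Monom s) = coords s"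
  by (simp add: Monom_def nf_single)

lemma nf_Const_mult: "nf (Const c * p) = c *s nf p"
  by (induction p rule: mpol_induct)
    (auto simp: nf_single Const_def mult_single distrib_left nf_add vec.scale_right_distrib)

lemma nf_sum: "nf (sum f S) = (\<Sum>a\<in>S. nf (f a))"
  by (induction S rule: infinite_finite_induct) (auto simp: nf_add)

lemma nf_minus: "nf (- p) = - nf p"
  using nf_Const_mult[of "- 1" p] by (simp add: Const_minus)

lemma nf_diff: "nf (p - q) = nf p - nf q"
  using nf_add[of p "- q"] by (simp add: nf_minus)

lemma nf_Indet_mult: "nf (Indet r * p) = A r *v nf p"
proof (induction p rule: mpol_induct)
  case (single s c)
  have "Indet r * single s c = single (var_trm r + s) c"
    by (simp add: Indet_def Monom_def mult_single)
  then show ?case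
    by (simp add: nf_single coords_var vec_eq_iff matrix_vector_mult_def sum_distrib_left mult_ac)
next
  case (add p q) then show ?case by (simp add: distrib_left nf_add matrix_vector_right_distrib)
qed

lemma nf_mult_0:
  assumes "nf p = 0" shows "nf (q * p) = 0"
proof -
  have M: "nf (Monom s * p) = 0" for s
  proof (induction s rule: trm_induct)
    case (var r s)
    have "Monom (var_trm r + s) * p = Indet r * (Monom s * p)"
      by (simp only: Monom_add Indet_def mult.assoc)
    then show ?case using var by (simp add: nf_Indet_mult)
  qed (simp add: assms)
  show ?thesis
  proof (induction q rule: mpol_induct)
    case (single s c)
    show ?case by (simp add: single_eq_Const_Monom mult.assoc nf_Const_mult M)
  next
    case (add p q) then show ?case by (simp add: distrib_right nf_add)
  qed
qed

lemma nf_combination: "nf (\<Sum>i\<in>S. Const (c i) * Monom (t i)) $ j = (if j \<in> S then c j else 0)"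
proof -
  have "nf (\<Sum>i\<in>S. Const (c i) * Monom (t i)) $ j = (\<Sum>i\<in>S. if i = j then c j else 0)"
    by (simp add: nf_sum nf_Const_mult nf_Monom coords_t axis_def if_distrib cong: if_cong)
  then show ?thesis by simp
qed

lemma nf_lin: "nf (lin t v) = v"
  by (simp add: lin_def vec_eq_iff nf_combination)

lemma is_ideal_I: "is_ideal I"
  unfolding I_point_def by (rule is_ideal_gen)

lemma nf_I: "p \<in> I \<Longrightarrow> nf p = 0"
proof -
  let ?K = "{p. nf p = 0}"
  have "is_ideal ?K" by (rule is_idealI) (auto simp: nf_add nf_mult_0)
  moreover have "nf (border_poly t b \<Gamma> m) = 0" for m
    by (simp add: vec_eq_iff border_poly_def nf_diff nf_Monom coords_b nf_combination)
  then have "range (border_poly t b \<Gamma>) \<subseteq> ?K" by auto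
  moreover assume "p \<in> I"
  ultimately show "nf p = 0" unfolding I_point_eq using ideal_gen_least by blast
qed

lemma border_poly_in_I: "border_poly t b \<Gamma> m \<in> I"
  by (simp add: I_point_eq ideal_gen_base)

lemma nf_reduce: "p - lin t (nf p) \<in> I"
proof -
  have M: "Monom s - lin t (coords s) \<in> I" for s
  proof (induction s rule: trm_induct)
    case 0
    show ?case by (simp add: coords_0 lin_axis t_one ideal_0[OF is_ideal_I])
  next
    case (var r s)
    have "Indet r * (Monom s - lin t (coords s)) + (Indet r * lin t (coords s) - lin t (A r *v coords s)) \<in> I"
      by (intro ideal_add[OF is_ideal_I] ideal_mult[OF is_ideal_I] var
          var_times_lin[OF is_ideal_I border_poly_in_I])
    then show ?case by (simp add: Monom_add Indet_def coords_var right_diff_distrib)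
  qed
  show ?thesis
  proof (induction p rule: mpol_induct)
    case (single s c)
    have "Const c * (Monom s - lin t (coords s)) \<in> I" by (intro ideal_mult is_ideal_I M)
    then show ?case
      by (simp add: single_eq_Const_Monom nf_Const_mult nf_Monom lin_scale right_diff_distrib)
  next
    case (add p q)
    then show ?case using ideal_add[OF is_ideal_I add] by (simp add: nf_add lin_add algebra_simps)
  qed
qed

text \<open>
  The kernel of \<open>nf\<close> contains the border polynomials, and border division writes every polynomial
  modulo \<open>I\<close> with the coordinates given by \<open>nf\<close>. In particular the \<open>t\<^sub>i\<close> are a basis modulo \<open>I\<close>.
\<close>

lemma mem_I_iff: "p \<in> I \<longleftrightarrow> nf p = 0"
proof
  show "nf p = 0" if "p \<in> I" using that by (rule nf_I)
  show "p \<in> I" if "nf p = 0" using nf_reduce[of p] that by simp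
qed

lemma one_notin_I: "1 \<notin> I"
proof -
  have "nf 1 $ one = 1" using nf_Monom[of 0] by (simp add: coords_0)
  then show ?thesis by (auto simp: mem_I_iff)
qed

lemma zero_dim: "zero_dim_scheme I"
  unfolding zero_dim_scheme_def
proof (intro conjI is_ideal_I one_notin_I exI allI)
  let ?T = "\<lambda>i. Monom (t i) :: ('n, 'l) mpol"
  have inj: "inj ?T"
  proof (rule injI)
    fix i j assume "?T i = ?T j"
    then have "lookup (?T i) (t j) = lookup (?T j) (t j)" by simp
    then show "i = j" by (simp add: lookup_Monom inj_eq[OF inj_t] split: if_splits)
  qed
  show "finite (range ?T)" by simp
  fix p
  have "(\<Sum>s\<in>range ?T. Const (nf p $ inv ?T s) * s) = lin t (nf p)"
    unfolding lin_def sum.reindex[OF inj] o_def inv_f_f[OF inj] ..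
  then show "p - (\<Sum>s\<in>range ?T. Const (nf p $ inv ?T s) * s) \<in> I" using nf_reduce by simp
qed

lemma coords_degree:
  assumes "degree_filtered t b \<Gamma>" "coords s $ i \<noteq> 0"
  shows "tdeg (t i) \<le> tdeg s"
proof -
  have "\<forall>i. coords s $ i \<noteq> 0 \<longrightarrow> tdeg (t i) \<le> tdeg s"
  proof (induction s rule: trm_induct)
    case 0 show ?case by (auto simp: coords_0 axis_def t_one)
  next
    case (var r s)
    show ?case
    proof (intro allI impI)
      fix i assume "coords (var_trm r + s) $ i \<noteq> 0"
      then have "(\<Sum>k\<in>UNIV. A r $ i $ k * coords s $ k) \<noteq> 0"
        by (simp add: coords_var matrix_vector_mult_def)
      then obtain k where "A r $ i $ k * coords s $ k \<noteq> 0"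
        by (meson sum.not_neutral_contains_not_neutral)
      then have "tdeg (t i) \<le> Suc (tdeg (t k))" "tdeg (t k) \<le> tdeg s"
        using matrix_degree[OF assms(1)] var by auto
      then show "tdeg (t i) \<le> tdeg (var_trm r + s)" by simp
    qed
  qed
  then show ?thesis using assms(2) by blast
qed

lemma nf_component: "nf p $ i = (\<Sum>s\<in>keys p. lookup p s * coords s $ i)"
  by (simp add: nf_def)

lemma df_border_basis:
  assumes df: "degree_filtered t b \<Gamma>"
  shows "has_df_border_basis t I"
  unfolding has_df_border_basis_def
proof (intro allI conjI impI)
  fix d and p :: "('n, 'l) mpol" assume p: "\<forall>s\<in>keys p. tdeg s \<le> d"
  have "nf p $ i = 0" if "\<not> tdeg (t i) \<le> d" for i
  proof -
    have "lookup p s * coords s $ i = 0" if "s \<in> keys p" for s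
      using coords_degree[OF df, of s i] p that \<open>\<not> tdeg (t i) \<le> d\<close> by fastforce
    then show ?thesis unfolding nf_component by (intro sum.neutral ballI)
  qed
  then have "lin t (nf p) = (\<Sum>i\<in>{j. tdeg (t j) \<le> d}. Const (nf p $ i) * Monom (t i))"
    unfolding lin_def by (intro sum.mono_neutral_right) auto
  then show "\<exists>c. p - (\<Sum>j\<in>{j. tdeg (t j) \<le> d}. Const (c j) * Monom (t j)) \<in> I"
    using nf_reduce[of p] by (intro exI[of _ "\<lambda>i. nf p $ i"]) simp
next
  fix d c j
  assume "(\<Sum>j\<in>{j. tdeg (t j) \<le> d}. Const (c j) * Monom (t j)) \<in> I" and j: "tdeg (t j) \<le> d"
  then have "nf (\<Sum>j\<in>{j. tdeg (t j) \<le> d}. Const (c j) * Monom (t j)) $ j = 0" by (simp add: mem_I_iff)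
  then show "c j = 0" using j by (simp add: nf_combination)
qed

end

context order_border
begin

text \<open>
  Expanding the \<open>b\<^sub>j\<close> in the basis gives \<open>\<Gamma>\<close>. Its matrices describe multiplication by indeterminates
  modulo \<open>I\<close> and therefore commute; comparing the two bases gives \<open>I = I\<^sub>\<Gamma>\<close>.
\<close>

lemma point_of_df_border_basis:
  fixes I :: "('n, 'l::field) mpol set"
  assumes I: "is_ideal I" and basis: "has_df_border_basis t I"
  shows "\<exists>\<Gamma>. commuting t b \<Gamma> \<and> degree_filtered t b \<Gamma> \<and> I = I_point t b \<Gamma>"
proof -
  have ex: "\<exists>v. (\<forall>i. tdeg (t i) > d \<longrightarrow> v $ i = 0) \<and> p - lin t v \<in> I"
    if p: "\<forall>s\<in>keys p. tdeg s \<le> d" for p d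
  proof -
    obtain c where c: "p - (\<Sum>j\<in>{j. tdeg (t j) \<le> d}. Const (c j) * Monom (t j)) \<in> I"
      using basis p unfolding has_df_border_basis_def by blast
    let ?v = "\<chi> i. if tdeg (t i) \<le> d then c i else 0"
    have "lin t ?v = (\<Sum>j\<in>{j. tdeg (t j) \<le> d}. Const (c j) * Monom (t j))"
      unfolding lin_def by (rule sum.mono_neutral_cong_right) auto
    then show ?thesis using c by (intro exI[of _ ?v]) simp
  qed
  have indep: "v = 0" if v: "lin t v \<in> I" for v
  proof -
    define d where "d = (\<Sum>i\<in>UNIV. tdeg (t i))"
    have d: "tdeg (t i) \<le> d" for i unfolding d_def by (rule member_le_sum) auto
    then have U: "{j. tdeg (t j) \<le> d} = UNIV" by blast
    have "\<forall>c. (\<Sum>j\<in>{j. tdeg (t j) \<le> d}. Const (c j) * Monom (t j)) \<in> I \<longrightarrow>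
        (\<forall>j. tdeg (t j) \<le> d \<longrightarrow> c j = 0)"
      using basis unfolding has_df_border_basis_def by (elim allE[of _ d] conjE)
    then show ?thesis using v d unfolding U lin_def by (simp add: vec_eq_iff)
  qed
  have "\<forall>m. \<exists>v. (\<forall>i. tdeg (t i) > tdeg (b m) \<longrightarrow> v $ i = 0) \<and> Monom (b m) - lin t v \<in> I"
    by (intro allI ex) (auto simp: Monom_def)
  from choice[OF this] obtain G where
    G: "\<forall>m. (\<forall>i. tdeg (t i) > tdeg (b m) \<longrightarrow> G m $ i = 0) \<and> Monom (b m) - lin t (G m) \<in> I" ..
  define \<Gamma> where "\<Gamma> i m = G m $ i" for i m
  let ?A = "point_matrix t b \<Gamma>"
  have df: "degree_filtered t b \<Gamma>" using G by (simp add: degree_filtered_def \<Gamma>_def)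
  have bI: "border_poly t b \<Gamma> m \<in> I" for m using G by (simp add: border_poly_def \<Gamma>_def lin_def)
  note mult = var_times_lin[OF I bI]
  have two: "Indet s * (Indet r * lin t v) - lin t (?A s *v (?A r *v v)) \<in> I" for r s v
    using ideal_add[OF I ideal_mult[OF I mult[of r v], of "Indet s"] mult[of s "?A r *v v"]]
    by (simp add: right_diff_distrib)
  have "?A r *v (?A s *v v) - ?A s *v (?A r *v v) = 0" for r s v
    using ideal_diff[OF I two[of s r v] two[of r s v]]
    by (intro indep) (simp add: lin_diff mult.left_commute)
  then have "(?A r ** ?A s) *v v = (?A s ** ?A r) *v v" for r s v
    by (simp flip: matrix_vector_mul_assoc)
  then have comm: "commuting t b \<Gamma>"
    unfolding commuting_def by (metis mult_axis vec_eq_iff)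
  interpret border_point t b \<Gamma> by unfold_locales (rule comm)
  have "I_point t b \<Gamma> \<subseteq> I" unfolding I_point_eq using bI by (intro ideal_gen_least I) auto
  moreover have "I \<subseteq> I_point t b \<Gamma>"
  proof
    fix p assume p: "p \<in> I"
    have "p - lin t (nf p) \<in> I"
      using nf_reduce[of p] \<open>I_point t b \<Gamma> \<subseteq> I\<close> by blast
    then have "lin t (nf p) \<in> I" using p ideal_cong[OF I] by blast
    then have "nf p = 0" by (rule indep)
    then show "p \<in> I_point t b \<Gamma>" by (simp add: mem_I_iff)
  qed
  ultimately show ?thesis using comm df by blast
qed

subsection \<open>The degree form ideal\<close>

lemma deg_form_eq: "deg_form p = hcomp (pdeg p) p"
  by (simp add: deg_form_def hcomp_def)

lemma deg_le_pdeg: "deg_le (pdeg p) p"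
proof -
  have "tdeg s \<le> pdeg p" if "s \<in> keys p" for s
    unfolding pdeg_def using that by (intro Max_ge) auto
  then show ?thesis unfolding deg_le_def in_keys_iff by (metis not_le)
qed

lemma hom_deg_border_poly_top_part:
  "hom_deg (tdeg (b m)) (border_poly t b (top_part t b \<Gamma>) m)"
proof -
  have "hom_deg (tdeg (b m)) (Const (top_part t b \<Gamma> i m) * Monom (t i))" for i
    by (auto simp: hom_deg_def top_part_def lookup_Const_mult lookup_Monom)
  then show ?thesis
    unfolding border_poly_def hom_deg_def lookup_minus lookup_sum by (auto simp: lookup_Monom)
qed

lemma deg_form_border_poly:
  fixes \<Gamma> :: "'m \<Rightarrow> 'v \<Rightarrow> 'l::field"
  assumes df: "degree_filtered t b \<Gamma>"
  shows "border_poly t b \<Gamma> m \<noteq> 0"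
    and "deg_form (border_poly t b \<Gamma> m) = border_poly t b (top_part t b \<Gamma>) m"
proof -
  let ?g = "border_poly t b \<Gamma> m"
  have l: "lookup (border_poly t b G m) s = (if s = b m then 1 else 0) - (\<Sum>i\<in>UNIV. if s = t i then G i m else 0)"
    for s and G :: "'m \<Rightarrow> 'v \<Rightarrow> 'l"
    unfolding border_poly_def lookup_minus lookup_sum lookup_Const_mult lookup_Monom
    by (intro arg_cong2[where f = "(-)"] sum.cong) auto
  have lb: "lookup ?g (b m) = 1" unfolding l using b_notin_t by simp
  then show "?g \<noteq> 0" by auto
  have dg: "deg_le (tdeg (b m)) ?g"
    unfolding deg_le_def
  proof (intro allI impI)
    fix s :: "'n trm" assume s: "tdeg s > tdeg (b m)"
    then have "(\<Sum>i\<in>UNIV. if s = t i then \<Gamma> i m else 0) = 0"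
      using df by (intro sum.neutral) (auto simp: degree_filtered_def)
    then show "lookup ?g s = 0" using s by (auto simp: l)
  qed
  have "pdeg ?g = tdeg (b m)"
  proof (rule antisym)
    have "keys ?g \<noteq> {}" using lb by (metis in_keys_iff empty_iff zero_neq_one)
    then show "pdeg ?g \<le> tdeg (b m)"
      unfolding pdeg_def using deg_le_keys[OF dg] by (intro Max.boundedI) auto
    have "b m \<in> keys ?g" using lb by (simp add: in_keys_iff)
    then show "tdeg (b m) \<le> pdeg ?g" using deg_le_keys[OF deg_le_pdeg] by blast
  qed
  then have "deg_form ?g = hcomp (tdeg (b m)) ?g" by (simp add: deg_form_eq)
  also have "\<dots> = border_poly t b (top_part t b \<Gamma>) m"
  proof (rule poly_mapping_eqI)
    fix s
    have "(\<Sum>i\<in>UNIV. if s = t i then top_part t b \<Gamma> i m else 0)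
        = (if tdeg s = tdeg (b m) then (\<Sum>i\<in>UNIV. if s = t i then \<Gamma> i m else 0) else 0)"
      by (auto simp: top_part_def intro!: sum.cong sum.neutral)
    then show "lookup (hcomp (tdeg (b m)) ?g) s = lookup (border_poly t b (top_part t b \<Gamma>) m) s"
      by (auto simp: lookup_hcomp l)
  qed
  finally show "deg_form ?g = border_poly t b (top_part t b \<Gamma>) m" .
qed

lemma coords_top_part:
  fixes \<Gamma> :: "'m \<Rightarrow> 'v \<Rightarrow> 'l::field"
  assumes df: "degree_filtered t b \<Gamma>" and comm: "commuting t b \<Gamma>"
  shows "border_point.coords t b (top_part t b \<Gamma>) s $ i
    = (if tdeg (t i) = tdeg s then border_point.coords t b \<Gamma> s $ i else 0)"
proof -
  interpret p: border_point t b \<Gamma> by unfold_locales (rule comm)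
  interpret h: border_point t b "top_part t b \<Gamma>"
    by unfold_locales (rule commuting_top_part[OF df comm])
  have "\<forall>i. h.coords s $ i = (if tdeg (t i) = tdeg s then p.coords s $ i else 0)"
  proof (induction s rule: trm_induct)
    case 0
    have "h.one = p.one" by (simp add: h.one_def p.one_def)
    then show ?case by (auto simp: h.coords_0 p.coords_0 axis_def p.t_one)
  next
    case (var r s)
    show ?case
    proof
      fix i
      have "h.A r $ i $ k * h.coords s $ k
          = (if tdeg (t i) = tdeg (var_trm r + s) then p.A r $ i $ k * p.coords s $ k else 0)" for k
      proof (cases "p.A r $ i $ k = 0 \<or> p.coords s $ k = 0")
        case True then show ?thesis using var by (auto simp: matrix_top_part)
      next
        case False
        then have "tdeg (t i) \<le> Suc (tdeg (t k))" "tdeg (t k) \<le> tdeg s"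
          using matrix_degree[OF df] p.coords_degree[OF df] by blast+
        then show ?thesis using var by (auto simp: matrix_top_part)
      qed
      then show "h.coords (var_trm r + s) $ i
          = (if tdeg (t i) = tdeg (var_trm r + s) then p.coords (var_trm r + s) $ i else 0)"
        by (simp add: h.coords_var p.coords_var matrix_vector_mult_def)
    qed
  qed
  then show ?thesis by blast
qed

text \<open>
  The coordinates of a term \<open>s\<close> for \<open>\<Gamma>'\<close> are those for \<open>\<Gamma>\<close> at the \<open>t\<^sub>i\<close> of degree \<open>deg s\<close>. Hence the
  degree form of an element of \<open>I\<^sub>\<Gamma>\<close> has coordinate vector 0 for \<open>\<Gamma>'\<close>.
\<close>

lemma DF_I_point:
  fixes \<Gamma> :: "'m \<Rightarrow> 'v \<Rightarrow> 'l::field"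
  assumes df: "degree_filtered t b \<Gamma>" and comm: "commuting t b \<Gamma>"
  shows "DF (I_point t b \<Gamma>) = I_point t b (top_part t b \<Gamma>)"
proof
  interpret p: border_point t b \<Gamma> by unfold_locales (rule comm)
  interpret h: border_point t b "top_part t b \<Gamma>"
    by unfold_locales (rule commuting_top_part[OF df comm])
  show "I_point t b (top_part t b \<Gamma>) \<subseteq> DF (I_point t b \<Gamma>)"
    unfolding I_point_eq[of t b "top_part t b \<Gamma>"]
  proof (rule ideal_gen_least)
    show "is_ideal (DF (I_point t b \<Gamma>))" unfolding DF_def by (rule is_ideal_gen)
    have "border_poly t b \<Gamma> m \<in> I_point t b \<Gamma> - {0}" for m
      using deg_form_border_poly(1)[OF df] by (simp add: I_point_eq ideal_gen_base)
    then have "border_poly t b (top_part t b \<Gamma>) m \<in> deg_form ` (I_point t b \<Gamma> - {0})" for m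
      using deg_form_border_poly(2)[OF df, of m] by (metis imageI)
    then show "range (border_poly t b (top_part t b \<Gamma>)) \<subseteq> DF (I_point t b \<Gamma>)"
      unfolding DF_def by (auto intro: ideal_gen_base)
  qed
  note ch = coords_top_part[OF df comm]
  have "deg_form q \<in> I_point t b (top_part t b \<Gamma>)" if q: "q \<in> I_point t b \<Gamma>" for q
  proof -
    have "h.nf (hcomp (pdeg q) q) $ i = 0" for i
    proof -
      have "h.nf (hcomp (pdeg q) q) $ i = (\<Sum>s\<in>keys q. lookup (hcomp (pdeg q) q) s *s h.coords s) $ i"
        by (subst h.nf_superset[of "keys q"]) (auto simp: in_keys_iff lookup_hcomp split: if_splits)
      also have "\<dots> = (\<Sum>s\<in>keys q. if tdeg (t i) = pdeg q then lookup q s * p.coords s $ i else 0)"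
      proof (simp add: lookup_hcomp ch, intro sum.cong refl)
        fix s assume "s \<in> keys q"
        then have "tdeg s \<le> pdeg q" by (rule deg_le_keys[OF deg_le_pdeg])
        then show "(if tdeg s = pdeg q then lookup q s else 0) * (if tdeg (t i) = tdeg s then p.coords s $ i else 0)
            = (if tdeg (t i) = pdeg q then lookup q s * p.coords s $ i else 0)"
          using p.coords_degree[OF df, of s i] by (cases "p.coords s $ i = 0") auto
      qed
      also have "\<dots> = (if tdeg (t i) = pdeg q then p.nf q $ i else 0)" by (simp add: p.nf_component)
      also have "\<dots> = 0" using q by (simp add: p.mem_I_iff)
      finally show ?thesis .
    qed
    then show ?thesis by (simp add: h.mem_I_iff deg_form_eq vec_eq_iff)
  qed
  then show "DF (I_point t b \<Gamma>) \<subseteq> I_point t b (top_part t b \<Gamma>)"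
    unfolding DF_def by (intro ideal_gen_least h.is_ideal_I) auto
qed

end


section \<open>Symmetry of the Hilbert function\<close>

lemma underdetermined_system:
  fixes M :: "'a \<Rightarrow> 'b \<Rightarrow> 'k::field"
  assumes "finite B" "finite A" "card B < card A"
  shows "\<exists>c. (\<exists>a\<in>A. c a \<noteq> 0) \<and> (\<forall>b\<in>B. (\<Sum>a\<in>A. c a * M a b) = 0)"
  using assms
proof (induction B arbitrary: A M rule: finite_induct)
  case empty
  then have "A \<noteq> {}" by auto
  then show ?case by (intro exI[of _ "\<lambda>_. 1"]) auto
next
  case (insert b B)
  show ?case
  proof (cases "\<forall>a\<in>A. M a b = 0")
    case True
    from insert.prems insert.hyps have "card B < card A" by simp
    from insert.IH[OF insert.prems(1) this, of M] True show ?thesis by auto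
  next
    case False
    then obtain p where p: "p \<in> A" "M p b \<noteq> 0" by blast
    have "card B < card (A - {p})" using insert p by simp
    from insert.IH[of "A - {p}" "\<lambda>a b'. M a b' - M a b / M p b * M p b'", OF _ this] insert.prems(1)
    obtain c where c: "\<exists>a\<in>A - {p}. c a \<noteq> 0"
      "\<forall>b'\<in>B. (\<Sum>a\<in>A - {p}. c a * (M a b' - M a b / M p b * M p b')) = 0" by auto
    define d where "d a = (if a = p then - (\<Sum>a\<in>A - {p}. c a * M a b) / M p b else c a)" for a
    have split: "(\<Sum>a\<in>A. d a * M a b') = d p * M p b' + (\<Sum>a\<in>A - {p}. c a * M a b')" for b'
    proof -
      have "(\<Sum>a\<in>A. d a * M a b') = d p * M p b' + (\<Sum>a\<in>A - {p}. d a * M a b')"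
        using insert.prems(1) p(1) by (rule sum.remove)
      also have "(\<Sum>a\<in>A - {p}. d a * M a b') = (\<Sum>a\<in>A - {p}. c a * M a b')"
        by (intro sum.cong) (auto simp: d_def)
      finally show ?thesis .
    qed
    have "(\<Sum>a\<in>A. d a * M a b') = 0" if "b' \<in> insert b B" for b'
    proof (cases "b' = b")
      case True then show ?thesis using p(2) by (simp add: split) (simp add: d_def)
    next
      case False
      then have "(\<Sum>a\<in>A - {p}. c a * M a b') = (\<Sum>a\<in>A - {p}. c a * (M a b / M p b * M p b'))"
        using c(2) that by (simp add: right_diff_distrib sum_subtractf)
      also have "\<dots> = (\<Sum>a\<in>A - {p}. c a * M a b) / M p b * M p b'"
        by (simp add: sum_distrib_right sum_divide_distrib mult.assoc)
      finally show ?thesis by (simp add: split) (simp add: d_def)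
    qed
    moreover have "\<exists>a\<in>A. d a \<noteq> 0" using c(1) by (auto simp: d_def)
    ultimately show ?thesis by blast
  qed
qed

locale graded_point = border_point t b \<Gamma>
  for t :: "'m::finite \<Rightarrow> 'n::finite trm" and b :: "'v::finite \<Rightarrow> 'n trm"
    and \<Gamma> :: "'m \<Rightarrow> 'v \<Rightarrow> 'l::field" +
  assumes graded: "top_part t b \<Gamma> = \<Gamma>"
begin

lemma coords_graded: "coords s $ i \<noteq> 0 \<Longrightarrow> tdeg (t i) = tdeg s"
proof -
  have "degree_filtered t b \<Gamma>"
    unfolding degree_filtered_def by (subst graded[symmetric]) (simp add: top_part_def)
  from coords_top_part[OF this comm, of s i] show "coords s $ i \<noteq> 0 \<Longrightarrow> tdeg (t i) = tdeg s"
    unfolding graded by (auto split: if_splits)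
qed

lemma nf_graded:
  assumes "hom_deg d p" "nf p $ i \<noteq> 0"
  shows "tdeg (t i) = d"
proof -
  obtain s where s: "s \<in> keys p" "lookup p s * coords s $ i \<noteq> 0"
    using assms(2) unfolding nf_component by (meson sum.not_neutral_contains_not_neutral)
  have "tdeg s = d" using s(1) assms(1) unfolding hom_deg_def in_keys_iff by blast
  moreover have "tdeg (t i) = tdeg s" using s(2) by (intro coords_graded) auto
  ultimately show ?thesis by simp
qed

definition rho :: nat where "rho = Max (range (\<lambda>i. tdeg (t i)))"

lemma tdeg_le_rho: "tdeg (t i) \<le> rho"
  unfolding rho_def by (rule Max_ge) auto

lemma high_degree_in_I:
  assumes "hom_deg d p" "d > rho" shows "p \<in> I"
proof -
  have "nf p $ i = 0" for i using nf_graded[OF assms(1), of i] tdeg_le_rho[of i] assms(2) by fastforce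
  then show ?thesis by (simp add: mem_I_iff vec_eq_iff)
qed

lemma power_in_I: "Indet i ^ Suc rho \<in> I"
proof (rule high_degree_in_I)
  show "hom_deg (Suc rho) (Indet i ^ Suc rho :: ('n, 'l) mpol)"
    unfolding Indet_power by (rule hom_deg_Monom) simp
qed simp

lemma nf_Monom_mult:
  "nf (Monom w * p) $ i = (\<Sum>k\<in>UNIV. coords w $ k * nf (Monom (t k) * p) $ i)"
proof -
  have "(Monom w - lin t (coords w)) * p \<in> I"
    using nf_reduce[of "Monom w"] unfolding nf_Monom by (rule ideal_mult_right[OF is_ideal_I])
  then have "nf (Monom w * p - lin t (coords w) * p) $ i = 0"
    by (simp add: mem_I_iff left_diff_distrib)
  then show ?thesis by (simp add: lin_def sum_distrib_right mult.assoc nf_diff nf_sum nf_Const_mult)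
qed

text \<open>
  The degree \<open>rho\<close> part is contained in the socle, so the socle is spanned by the class of one
  \<open>t\<^sub>t\<^sub>o\<^sub>p\<close>. A nonzero homogeneous class can be multiplied into the socle, so the pairing of degrees
  \<open>d\<close> and \<open>rho - d\<close> given by the coordinate at \<open>t\<^sub>t\<^sub>o\<^sub>p\<close> of the product is nondegenerate.
\<close>

lemma symmetric_of_socle:
  assumes socle: "\<And>u v. (\<And>i. Indet i * u \<in> I) \<Longrightarrow> (\<And>i. Indet i * v \<in> I) \<Longrightarrow>
    \<exists>c d. (c \<noteq> 0 \<or> d \<noteq> 0) \<and> Const c * u + Const d * v \<in> I"
  shows "symmetric_HF (range t)"
proof -
  have "rho \<in> range (\<lambda>i. tdeg (t i))" unfolding rho_def by (rule Max_in) auto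
  then obtain top where top: "tdeg (t top) = rho" by auto
  have top_socle: "Indet i * Monom (t top) \<in> I" for i
  proof (rule high_degree_in_I)
    show "hom_deg (1 + rho) (Indet i * Monom (t top) :: ('n, 'l) mpol)"
      by (intro hom_deg_mult hom_deg_Indet hom_deg_Monom top)
  qed simp
  have pairing: "\<exists>k. tdeg (t k) + d = rho \<and> nf (Monom (t k) * u) $ top \<noteq> 0"
    if u: "hom_deg d u" "nf u \<noteq> 0" for u d
  proof -
    have hw: "hom_deg (tdeg w + d) (Monom w * u)" for w
      by (intro hom_deg_mult u hom_deg_Monom refl)
    \<comment> \<open>a multiple of \<open>u\<close> by a term of maximal degree among the nonzero ones is in the socle\<close>
    define P where "P n = (\<exists>w. tdeg w = n \<and> nf (Monom w * u) \<noteq> 0)" for n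
    have P0: "P 0" unfolding P_def using u(2) by (intro exI[of _ 0]) simp
    have Pb: "n \<le> rho" if Pn: "P n" for n
    proof -
      obtain w where w: "tdeg w = n" "nf (Monom w * u) \<noteq> 0" using Pn by (auto simp: P_def)
      then obtain i where "nf (Monom w * u) $ i \<noteq> 0" by (auto simp: vec_eq_iff)
      from nf_graded[OF hw this] tdeg_le_rho[of i] w(1) show ?thesis by simp
    qed
    define n where "n = (GREATEST n. P n)"
    have Pn: "P n" unfolding n_def using GreatestI_nat[of P 0 rho] P0 Pb by blast
    have nmax: "\<not> P (Suc n)"
      using Greatest_le_nat[of P "Suc n" rho] Pb unfolding n_def by (metis Suc_n_not_le_n)
    obtain w where w: "tdeg w = n" "nf (Monom w * u) \<noteq> 0" using Pn by (auto simp: P_def)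
    have ws: "Indet i * (Monom w * u) \<in> I" for i
    proof -
      have "Indet i * (Monom w * u) = Monom (var_trm i + w) * u"
        by (simp only: Indet_def Monom_add mult.assoc)
      moreover have "nf (Monom (var_trm i + w) * u) = 0"
        using nmax w(1) unfolding P_def by auto
      ultimately show ?thesis by (simp add: mem_I_iff)
    qed
    obtain c e where ce: "c \<noteq> 0 \<or> e \<noteq> 0" "Const c * (Monom w * u) + Const e * Monom (t top) \<in> I"
      using socle[OF ws top_socle] by blast
    have eq: "c * nf (Monom w * u) $ i + e * axis top 1 $ i = 0" for i
    proof -
      have "nf (Const c * (Monom w * u) + Const e * Monom (t top)) $ i = 0"
        using ce(2) by (simp add: mem_I_iff)
      then show ?thesis by (simp add: nf_add nf_Const_mult nf_Monom coords_t)
    qed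
    have c0: "c \<noteq> 0"
    proof
      assume "c = 0"
      then have "e = 0" using eq[of top] by simp
      then show False using ce(1) \<open>c = 0\<close> by simp
    qed
    have "nf (Monom w * u) $ i = 0" if "i \<noteq> top" for i
      using eq[of i] c0 that by (simp add: axis_def)
    then have nz: "nf (Monom w * u) $ top \<noteq> 0" using w(2) by (metis vec_eq_iff zero_index)
    then have deg: "tdeg w + d = rho" using nf_graded[OF hw] top by simp
    obtain k where k: "coords w $ k * nf (Monom (t k) * u) $ top \<noteq> 0"
      using nz unfolding nf_Monom_mult[of w] by (meson sum.not_neutral_contains_not_neutral)
    then have "tdeg (t k) = tdeg w" by (intro coords_graded) auto
    then show ?thesis using k deg by (intro exI[of _ k]) auto
  qed
  define B where "B d = {i. tdeg (t i) = d}" for d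
  have le: "card (B d) \<le> card (B (rho - d))" for d
  proof (rule ccontr)
    assume "\<not> card (B d) \<le> card (B (rho - d))"
    then obtain c where c: "\<exists>i\<in>B d. c i \<noteq> 0"
      "\<forall>k\<in>B (rho - d). (\<Sum>i\<in>B d. c i * nf (Monom (t k) * Monom (t i)) $ top) = 0"
      using underdetermined_system[of "B (rho - d)" "B d" "\<lambda>i k. nf (Monom (t k) * Monom (t i)) $ top"]
      by auto
    define u where "u = (\<Sum>i\<in>B d. Const (c i) * Monom (t i) :: ('n, 'l) mpol)"
    have "hom_deg d u"
      unfolding u_def hom_deg_def lookup_sum
      by (intro allI impI sum.neutral ballI) (auto simp: lookup_Const_mult lookup_Monom B_def)
    moreover have "nf u \<noteq> 0"
    proof -
      obtain i where "i \<in> B d" "c i \<noteq> 0" using c(1) by blast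
      then have "nf u $ i \<noteq> 0" unfolding u_def nf_combination by simp
      then show ?thesis by auto
    qed
    ultimately obtain k where k: "tdeg (t k) + d = rho" "nf (Monom (t k) * u) $ top \<noteq> 0"
      using pairing by blast
    have "Monom (t k) * u = (\<Sum>i\<in>B d. Const (c i) * (Monom (t k) * Monom (t i)))"
      unfolding u_def sum_distrib_left by (simp only: mult.left_commute)
    then have "nf (Monom (t k) * u) $ top = (\<Sum>i\<in>B d. c i * nf (Monom (t k) * Monom (t i)) $ top)"
      by (simp add: nf_sum nf_Const_mult)
    also have "\<dots> = 0" using c(2) k(1) by (auto simp: B_def)
    finally show False using k(2) by simp
  qed
  have HF: "HF (range t) d = card (B d)" for d
  proof -
    have "{s \<in> range t. tdeg s = d} = t ` B d" by (auto simp: B_def)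
    then show ?thesis using card_image[OF inj_on_subset[OF inj_t], of "B d"] by (simp add: HF_def)
  qed
  have "Max {i. HF (range t) i > 0} = rho"
  proof -
    have "{i. HF (range t) i > 0} = range (\<lambda>i. tdeg (t i))"
      unfolding HF by (auto simp: B_def card_gt_0_iff)
    then show ?thesis by (simp add: rho_def)
  qed
  moreover have "HF (range t) i = HF (range t) (rho - i)" if "i \<in> {1..rho}" for i
    unfolding HF using le[of i] le[of "rho - i"] that by simp
  ultimately show ?thesis unfolding symmetric_HF_def by simp
qed

end

section \<open>Maximal minors\<close>

lemma ex_strict_mono_permutation:
  fixes \<sigma> :: "'n::{finite,linorder} \<Rightarrow> 'v::linorder"
  assumes "inj \<sigma>"
  shows "\<exists>p. p permutes UNIV \<and> strict_mono (\<sigma> \<circ> p)"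
proof -
  define ys where "ys = sorted_list_of_set (range \<sigma>)"
  \<comment> \<open>the \<open>k\<close>-th smallest row index is sent to the \<open>k\<close>-th smallest value of \<open>\<sigma>\<close>\<close>
  define rank where "rank k = card {x. x < k}" for k :: 'n
  have len: "length ys = CARD('n)" using assms by (simp add: ys_def card_image)
  have rank_less: "rank k < CARD('n)" for k
    unfolding rank_def by (rule psubset_card_mono) auto
  have rank_mono: "rank k < rank l" if "k < l" for k l
    unfolding rank_def using that by (intro psubset_card_mono) auto
  have sorted: "sorted_wrt (<) ys" unfolding ys_def by (rule strict_sorted_list_of_set)
  define \<tau> where "\<tau> k = ys ! rank k" for k
  have mono: "strict_mono \<tau>"
    unfolding strict_mono_def \<tau>_def
    using sorted_wrt_nth_less[OF sorted rank_mono] rank_less len by simp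
  have "\<tau> k \<in> range \<sigma>" for k
  proof -
    have "\<tau> k \<in> set ys" unfolding \<tau>_def using rank_less len by (intro nth_mem) simp
    then show ?thesis by (simp add: ys_def)
  qed
  then have *: "\<sigma> (inv \<sigma> (\<tau> k)) = \<tau> k" for k by (rule f_inv_into_f)
  define p where "p = inv \<sigma> \<circ> \<tau>"
  have sp: "\<sigma> \<circ> p = \<tau>" by (simp add: fun_eq_iff p_def *)
  have "inj p" using strict_mono_imp_inj_on[OF mono] unfolding sp[symmetric] by (rule inj_on_imageI2)
  then have "bij p" by (simp add: finite_UNIV_inj_surj bij_def)
  then have "p permutes UNIV" by (intro bij_imp_permutes) auto
  then show ?thesis using mono sp by auto
qed

lemma minor_in_ideal:
  fixes w :: "'n::{finite,linorder} \<Rightarrow> 'v::linorder \<Rightarrow> 'a::comm_ring_1"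
  assumes I: "is_ideal I" and minors: "\<And>\<sigma>. strict_mono \<sigma> \<Longrightarrow> det (\<chi> i k. w i (\<sigma> k)) \<in> I"
  shows "det (\<chi> i k. w i (\<sigma> k)) \<in> I"
proof (cases "inj \<sigma>")
  case False
  then obtain k l where kl: "k \<noteq> l" "\<sigma> k = \<sigma> l" by (auto simp: inj_def)
  then have "det (\<chi> i k. w i (\<sigma> k)) = 0"
    by (intro det_identical_columns[of k l]) (auto simp: column_def)
  then show ?thesis by (simp add: ideal_0[OF I])
next
  case True
  then obtain p where p: "p permutes UNIV" "strict_mono (\<sigma> \<circ> p)"
    using ex_strict_mono_permutation by blast
  let ?A = "\<chi> i k. w i (\<sigma> k)"
  have "det (\<chi> i k. w i ((\<sigma> \<circ> p) k)) = of_int (sign p) * det ?A"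
    using det_permute_columns[OF p(1), of ?A] by simp
  moreover have "of_int (sign p) * of_int (sign p) = (1 :: 'a)"
    by (simp flip: of_int_mult)
  ultimately have "det ?A = of_int (sign p) * det (\<chi> i k. w i ((\<sigma> \<circ> p) k))"
    by (simp flip: mult.assoc)
  then show ?thesis using minors[OF p(2)] ideal_mult[OF I] by simp
qed

text \<open>
  A substitute for the Cauchy-Binet formula: expanding one column after the other, the determinant
  becomes a combination of determinants with columns of \<open>w\<close>, which are maximal minors up to sign,
  or 0 if a column is repeated.
\<close>

lemma det_product_in_ideal:
  fixes w :: "'n::{finite,linorder} \<Rightarrow> 'v::{finite,linorder} \<Rightarrow> 'a::comm_ring_1"
  assumes I: "is_ideal I" and minors: "\<And>\<sigma>. strict_mono \<sigma> \<Longrightarrow> det (\<chi> i k. w i (\<sigma> k)) \<in> I"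
  shows "det (\<chi> i k. \<Sum>j\<in>UNIV. w i j * T j k) \<in> I"
proof -
  let ?w = "\<lambda>j. \<chi> i. w i j"
  let ?R = "\<lambda>S \<sigma>. \<chi> k. if k \<in> S then (\<Sum>j\<in>UNIV. T j k *s ?w j) else ?w (\<sigma> k)"
  have "\<forall>\<sigma>. det (?R S \<sigma>) \<in> I" if "finite S" for S
    using that
  proof (induction S)
    case empty
    show ?case
    proof
      fix \<sigma>
      have "?R {} \<sigma> = transpose (\<chi> i k. w i (\<sigma> k))" by (simp add: transpose_def vec_eq_iff)
      then show "det (?R {} \<sigma>) \<in> I" using minor_in_ideal[OF I minors] by simp
    qed
  next
    case (insert q S)
    show ?case
    proof
      fix \<sigma>
      have "det (?R (insert q S) \<sigma>)
          = det (\<chi> k. if k = q then (\<Sum>j\<in>UNIV. T j q *s ?w j) else ?R S \<sigma> $ k)"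
        by (intro arg_cong[where f = det]) (auto simp: vec_eq_iff)
      also have "\<dots> = (\<Sum>j\<in>UNIV. det (\<chi> k. if k = q then T j q *s ?w j else ?R S \<sigma> $ k))"
        by (rule det_linear_row_sum) simp
      also have "\<dots> = (\<Sum>j\<in>UNIV. T j q * det (\<chi> k. if k = q then ?w j else ?R S \<sigma> $ k))"
        by (intro sum.cong refl det_row_mul)
      also have "\<dots> = (\<Sum>j\<in>UNIV. T j q * det (?R S (\<sigma>(q := j))))"
        using insert.hyps
        by (intro sum.cong refl arg_cong2[where f = "(*)"] arg_cong[where f = det])
          (auto simp: vec_eq_iff)
      also have "\<dots> \<in> I" by (intro ideal_sum[OF I] ideal_mult[OF I] insert.IH[rule_format])
      finally show "det (?R (insert q S) \<sigma>) \<in> I" .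
    qed
  qed
  from this[OF finite[of UNIV]] have "det (\<chi> k. (\<Sum>j\<in>UNIV. T j k *s ?w j)) \<in> I" by simp
  moreover have "(\<chi> k. (\<Sum>j\<in>UNIV. T j k *s ?w j)) = transpose (\<chi> i k. \<Sum>j\<in>UNIV. w i j * T j k)"
    by (simp add: transpose_def vec_eq_iff mult.commute)
  ultimately show ?thesis by simp
qed

lemma family_of_list:
  assumes "length fs = CARD('n::finite)"
  obtains g :: "'n::finite \<Rightarrow> 'a" where "range g = set fs"
proof -
  obtain h where h: "bij_betw h (UNIV :: 'n set) {0..<CARD('n)}"
    using ex_bij_betw_finite_nat[of "UNIV :: 'n set"] by auto
  have "range (\<lambda>k. fs ! h k) = (!) fs ` (h ` UNIV)" by (simp add: image_image)
  also have "h ` UNIV = {0..<length fs}" using h assms by (simp add: bij_betw_def)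
  also have "(!) fs ` {0..<length fs} = set fs" by (auto simp: set_conv_nth)
  finally show thesis by (rule that)
qed

text \<open>
  If \<open>f = g T\<close> generates the same ideal, then \<open>f\<^sub>k = \<Sum>\<^sub>i (w T)\<^sub>i\<^sub>k x\<^sub>i\<close>, and \<open>det (w T)\<close> is not in the
  ideal by \<open>det_notin_parameter_ideal\<close>.
\<close>

lemma nonzero_minor_of_CI:
  fixes g :: "'v::{finite,linorder} \<Rightarrow> ('n::{finite,linorder}, 'k::field) mpol"
  assumes g: "\<And>j. g j = (\<Sum>i\<in>UNIV. w i j * Indet i)" and I: "I = ideal_gen (range g)"
    and pow: "\<And>i. Indet i ^ M \<in> I" and fs: "I = ideal_gen (set fs)" "length fs = CARD('n)"
  shows "\<exists>\<sigma>. strict_mono \<sigma> \<and> det (\<chi> i k. w i (\<sigma> k)) \<notin> I"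
proof (rule ccontr)
  assume "\<not> ?thesis"
  then have minors: "\<And>\<sigma>. strict_mono \<sigma> \<Longrightarrow> det (\<chi> i k. w i (\<sigma> k)) \<in> I" by blast
  have Ii: "is_ideal I" unfolding I by (rule is_ideal_gen)
  obtain f :: "'n \<Rightarrow> ('n, 'k) mpol" where f: "range f = set fs" using family_of_list[OF fs(2)] .
  have "f k \<in> I" for k unfolding fs(1) using f by (intro ideal_gen_base) auto
  then have "\<forall>k. \<exists>T. f k = (\<Sum>j\<in>UNIV. T j * g j)" unfolding I ideal_gen_image_iff[OF finite] by blast
  from choice[OF this] obtain T where T: "\<forall>k. f k = (\<Sum>j\<in>UNIV. T k j * g j)" ..
  have "f k = (\<Sum>i\<in>UNIV. (\<Sum>j\<in>UNIV. w i j * T k j) * Indet i)" for k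
  proof -
    have "f k = (\<Sum>j\<in>UNIV. \<Sum>i\<in>UNIV. w i j * T k j * Indet i)"
      unfolding T[rule_format] g sum_distrib_left by (simp only: mult_ac)
    also have "\<dots> = (\<Sum>i\<in>UNIV. \<Sum>j\<in>UNIV. w i j * T k j * Indet i)" by (rule sum.swap)
    finally show ?thesis by (simp only: sum_distrib_right)
  qed
  then have "det (\<chi> i k. \<Sum>j\<in>UNIV. w i j * T k j) \<notin> I"
    by (rule det_notin_parameter_ideal[OF _ _ pow]) (simp add: fs f)
  then show False using det_product_in_ideal[OF Ii minors, where T = "\<lambda>j k. T k j"] by simp
qed

lemma CI_of_nonzero_minor:
  fixes g :: "'v::{finite,linorder} \<Rightarrow> ('n::{finite,linorder}, 'k::field) mpol"
  assumes g: "\<And>j. g j = (\<Sum>i\<in>UNIV. w i j * Indet i)" and I: "I = ideal_gen (range g)"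
    and hom: "\<And>j. hom_deg (d j) (g j)" "\<And>j. d j > 0"
    and pow: "\<And>i. Indet i ^ M \<in> I" and proper: "1 \<notin> I"
    and det: "det (\<chi> i k. w i (\<sigma> k)) \<notin> I"
  shows "\<exists>fs. length fs = CARD('n) \<and> (\<forall>f\<in>set fs. homogeneous f) \<and>
       regular_sequence fs \<and> I = ideal_gen (set fs)"
proof -
  have Ii: "is_ideal I" unfolding I by (rule is_ideal_gen)
  have eq: "I = ideal_gen (range (\<lambda>k. g (\<sigma> k)))"
  proof (rule generated_by_nonzero_minor[where h = "\<lambda>i k. w i (\<sigma> k)" and dg = "\<lambda>k. d (\<sigma> k)", OF _ _ Ii _ pow _ det])
    show "hcomp e p \<in> I" if "p \<in> I" for e p
      using that hom(1) unfolding I by (intro hcomp_in_ideal_gen) auto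
    show "g (\<sigma> j) \<in> I" for j unfolding I by (intro ideal_gen_base) simp
  qed (use g hom in auto)
  define xs where "xs = sorted_list_of_set (UNIV :: 'n set)"
  have xs: "distinct xs" "set xs = UNIV" by (simp_all add: xs_def)
  let ?fs = "map (\<lambda>k. g (\<sigma> k)) xs"
  have "regular_sequence ?fs"
    by (rule regular_sequence_of_parameters[where d = "\<lambda>k. d (\<sigma> k)", OF hom(1) hom(2)])
      (use pow proper xs eq in auto)
  moreover have "length ?fs = CARD('n)" by (simp add: xs_def)
  moreover have "homogeneous f" if f: "f \<in> set ?fs" for f
  proof -
    obtain k where "f = g (\<sigma> k)" using f by auto
    then show ?thesis using hom(1)[of "\<sigma> k"] unfolding homogeneous_def hom_deg_def in_keys_iff by blast
  qed
  moreover have "I = ideal_gen (set ?fs)" using eq xs by simp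
  ultimately show ?thesis by blast
qed

section \<open>Evaluation\<close>

definition ring_map :: "('a::comm_ring_1 \<Rightarrow> 'b::comm_ring_1) \<Rightarrow> bool"
  where "ring_map f \<longleftrightarrow> f 1 = 1 \<and> (\<forall>x y. f (x + y) = f x + f y) \<and> (\<forall>x y. f (x * y) = f x * f y)"

lemma ring_map_1: "ring_map f \<Longrightarrow> f 1 = 1"
  and ring_map_add: "ring_map f \<Longrightarrow> f (x + y) = f x + f y"
  and ring_map_mult: "ring_map f \<Longrightarrow> f (x * y) = f x * f y"
  by (simp_all add: ring_map_def)

lemma ring_map_0: "ring_map f \<Longrightarrow> f 0 = 0"
  using ring_map_add[of f 0 0] by simp

lemma ring_map_minus: "ring_map f \<Longrightarrow> f (- x) = - f x"
  using ring_map_add[of f x "- x"] ring_map_0[of f] by (simp add: add_eq_0_iff)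

lemma ring_map_diff: "ring_map f \<Longrightarrow> f (x - y) = f x - f y"
  using ring_map_add[of f x "- y"] by (simp add: ring_map_minus)

lemma ring_map_sum: "ring_map f \<Longrightarrow> f (sum g S) = (\<Sum>a\<in>S. f (g a))"
  by (induction S rule: infinite_finite_induct) (auto simp: ring_map_add ring_map_0)

lemma ring_map_prod: "ring_map f \<Longrightarrow> f (prod g S) = (\<Prod>a\<in>S. f (g a))"
  by (induction S rule: infinite_finite_induct) (auto simp: ring_map_mult ring_map_1)

lemma ring_map_det:
  fixes M :: "'a::comm_ring_1 ^ 'n::finite ^ 'n"
  assumes "ring_map f"
  shows "f (det M) = det (\<chi> i j. f (M $ i $ j))"
proof -
  have "f (of_int (sign p)) = of_int (sign p)" for p :: "'n \<Rightarrow> 'n"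
    by (cases rule: sign_cases[of p]) (simp_all add: ring_map_1[OF assms] ring_map_minus[OF assms])
  then show ?thesis
    unfolding det_def by (simp add: ring_map_sum[OF assms] ring_map_mult[OF assms] ring_map_prod[OF assms])
qed

lemma ring_map_ideal_gen:
  assumes f: "ring_map f"
  shows "(\<forall>x\<in>ideal_gen S. f x = 0) \<longleftrightarrow> (\<forall>x\<in>S. f x = 0)"
proof
  assume S: "\<forall>x\<in>S. f x = 0"
  have "is_ideal {x. f x = 0}"
    by (rule is_idealI) (simp_all add: ring_map_0[OF f] ring_map_add[OF f] ring_map_mult[OF f])
  from ideal_gen_least[OF this, of S] S show "\<forall>x\<in>ideal_gen S. f x = 0" by blast
qed (simp add: ideal_gen_base)

lemma ring_map_plus:
  assumes f: "ring_map f" and IJ: "is_ideal I" "is_ideal J"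
  shows "(\<forall>x\<in>I + J. f x = 0) \<longleftrightarrow> (\<forall>x\<in>I. f x = 0) \<and> (\<forall>x\<in>J. f x = 0)"
proof
  assume "\<forall>x\<in>I + J. f x = 0"
  then show "(\<forall>x\<in>I. f x = 0) \<and> (\<forall>x\<in>J. f x = 0)"
    using subset_plus_ideal[OF IJ(2), of I] subset_plus_ideal(2)[OF IJ(1), of J] by blast
next
  assume "(\<forall>x\<in>I. f x = 0) \<and> (\<forall>x\<in>J. f x = 0)"
  then show "\<forall>x\<in>I + J. f x = 0" by (auto simp: set_plus_def ring_map_add[OF f])
qed

definition trm_value :: "('c::finite \<Rightarrow> 'b::comm_ring_1) \<Rightarrow> 'c trm \<Rightarrow> 'b"
  where "trm_value \<gamma> s = (\<Prod>x\<in>UNIV. \<gamma> x ^ lookup s x)"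

lemma eval_at_superset:
  fixes p :: "('c::finite, 'a::comm_ring_1) mpol"
  assumes "ring_map \<phi>" "finite S" "keys p \<subseteq> S"
  shows "eval_at \<phi> \<gamma> p = (\<Sum>s\<in>S. \<phi> (lookup p s) * trm_value \<gamma> s)"
proof -
  have "(\<Prod>x\<in>keys s. \<gamma> x ^ lookup s x) = trm_value \<gamma> s" for s
    unfolding trm_value_def by (rule prod.mono_neutral_left) (auto simp: in_keys_iff)
  then have "eval_at \<phi> \<gamma> p = (\<Sum>s\<in>keys p. \<phi> (lookup p s) * trm_value \<gamma> s)"
    by (simp add: eval_at_def)
  also have "\<dots> = (\<Sum>s\<in>S. \<phi> (lookup p s) * trm_value \<gamma> s)"
    using assms by (intro sum.mono_neutral_left) (auto simp: in_keys_iff ring_map_0)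
  finally show ?thesis .
qed

lemma eval_at_add:
  fixes p :: "('c::finite, 'a::comm_ring_1) mpol"
  assumes \<phi>: "ring_map \<phi>"
  shows "eval_at \<phi> \<gamma> (p + q) = eval_at \<phi> \<gamma> p + eval_at \<phi> \<gamma> q"
proof -
  let ?S = "keys p \<union> keys q"
  have "eval_at \<phi> \<gamma> (p + q) = (\<Sum>s\<in>?S. \<phi> (lookup (p + q) s) * trm_value \<gamma> s)"
    using keys_add[of p q] by (intro eval_at_superset \<phi>) auto
  also have "\<dots> = (\<Sum>s\<in>?S. \<phi> (lookup p s) * trm_value \<gamma> s) + (\<Sum>s\<in>?S. \<phi> (lookup q s) * trm_value \<gamma> s)"
    by (simp add: lookup_add ring_map_add[OF \<phi>] distrib_right sum.distrib)
  also have "\<dots> = eval_at \<phi> \<gamma> p + eval_at \<phi> \<gamma> q"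
    using eval_at_superset[OF \<phi>, of ?S p] eval_at_superset[OF \<phi>, of ?S q] by simp
  finally show ?thesis .
qed

lemma eval_at_single:
  assumes \<phi>: "ring_map \<phi>"
  shows "eval_at \<phi> \<gamma> (single s c) = \<phi> c * trm_value \<gamma> (s :: 'c::finite trm)"
  using eval_at_superset[OF \<phi>, of "{s}" "single s c"] by simp

lemma ring_hom_eval_at:
  fixes \<gamma> :: "'c::finite \<Rightarrow> 'b::comm_ring_1" and \<phi> :: "'a::comm_ring_1 \<Rightarrow> 'b"
  assumes \<phi>: "ring_map \<phi>"
  shows "ring_map (eval_at \<phi> \<gamma>)"
proof -
  have v: "trm_value \<gamma> (s + u) = trm_value \<gamma> s * trm_value \<gamma> u" for s u
    by (simp add: trm_value_def lookup_add power_add prod.distrib)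
  have "eval_at \<phi> \<gamma> (p * q) = eval_at \<phi> \<gamma> p * eval_at \<phi> \<gamma> q" for p q :: "('c, 'a) mpol"
    by (rule additive_imp_multiplicative)
      (simp_all add: eval_at_add[OF \<phi>] eval_at_single[OF \<phi>] v ring_map_mult[OF \<phi>] mult_ac)
  moreover have "eval_at \<phi> \<gamma> 1 = 1"
    using eval_at_single[OF \<phi>, of \<gamma> 0 1] by (simp add: trm_value_def ring_map_1[OF \<phi>])
  ultimately show ?thesis unfolding ring_map_def by (simp add: eval_at_add[OF \<phi>])
qed

lemma eval_at_Indet:
  assumes \<phi>: "ring_map \<phi>"
  shows "eval_at \<phi> \<gamma> (Indet x :: ('c::finite, 'a::comm_ring_1) mpol) = \<gamma> x"
proof -
  have "trm_value \<gamma> (var_trm x) = (\<Prod>y\<in>UNIV. if y = x then \<gamma> x else 1)"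
    unfolding trm_value_def by (intro prod.cong) (auto simp: lookup_var_trm)
  then show ?thesis
    by (simp add: Indet_def Monom_def eval_at_single[OF \<phi>] ring_map_1[OF \<phi>])
qed

lemma eval_at_cong:
  assumes "\<And>x. x \<in> indets p \<Longrightarrow> \<gamma> x = \<delta> x"
  shows "eval_at \<phi> \<gamma> p = eval_at \<phi> \<delta> p"
  unfolding eval_at_def
proof (intro sum.cong refl arg_cong2[where f = "(*)"] prod.cong)
  fix s x assume "s \<in> keys p" "x \<in> keys s"
  then have "x \<in> indets p" by (auto simp: indets_def)
  then show "\<gamma> x ^ lookup s x = \<delta> x ^ lookup s x" using assms by simp
qed

definition coeff_map :: "('a::comm_ring_1 \<Rightarrow> 'b::comm_ring_1) \<Rightarrow> ('n, 'a) mpol \<Rightarrow> ('n, 'b) mpol"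
  where "coeff_map \<psi> p = Poly_Mapping.map \<psi> p"

lemma lookup_coeff_map: "ring_map \<psi> \<Longrightarrow> lookup (coeff_map \<psi> p) s = \<psi> (lookup p s)"
  by (simp add: coeff_map_def map.rep_eq when_def ring_map_0)

lemma coeff_map_single:
  "ring_map \<psi> \<Longrightarrow> coeff_map \<psi> (single s c) = single s (\<psi> c)"
  by (rule poly_mapping_eqI) (simp add: lookup_coeff_map lookup_single when_def ring_map_0)

lemma coeff_map_add: "ring_map \<psi> \<Longrightarrow> coeff_map \<psi> (p + q) = coeff_map \<psi> p + coeff_map \<psi> q"
  by (rule poly_mapping_eqI) (simp add: lookup_coeff_map lookup_add ring_map_add)

lemma ring_hom_coeff_map:
  fixes \<psi> :: "'a::comm_ring_1 \<Rightarrow> 'b::comm_ring_1"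
  assumes \<psi>: "ring_map \<psi>"
  shows "ring_map (coeff_map \<psi> :: ('n, 'a) mpol \<Rightarrow> ('n, 'b) mpol)"
proof -
  have "coeff_map \<psi> (p * q) = coeff_map \<psi> p * coeff_map \<psi> q" for p q :: "('n, 'a) mpol"
    by (rule additive_imp_multiplicative)
      (simp_all add: coeff_map_add[OF \<psi>] coeff_map_single[OF \<psi>] mult_single ring_map_mult[OF \<psi>])
  moreover have "coeff_map \<psi> (1 :: ('n, 'a) mpol) = 1"
    using coeff_map_single[OF \<psi>, of 0 1] by (simp add: ring_map_1[OF \<psi>])
  ultimately show ?thesis unfolding ring_map_def by (simp add: coeff_map_add[OF \<psi>])
qed

lemma coeff_map_Const: "ring_map \<psi> \<Longrightarrow> coeff_map \<psi> (Const c) = Const (\<psi> c)"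
  by (simp add: Const_def coeff_map_single)

lemma coeff_map_Monom: "ring_map \<psi> \<Longrightarrow> coeff_map \<psi> (Monom s) = Monom s"
  by (simp add: Monom_def coeff_map_single ring_map_1)


section \<open>Points of the scheme and strict complete intersections\<close>

lemma zero_on_I_B_iff:
  fixes t :: "'m::finite \<Rightarrow> 'n::finite trm" and b :: "'v::finite \<Rightarrow> 'n trm"
    and \<phi> :: "'k::field \<Rightarrow> 'l::field"
  assumes \<phi>: "ring_map \<phi>"
  shows "(\<forall>f\<in>I_B t b. eval_at \<phi> (\<lambda>(i, j). \<Gamma> i j) f = 0) \<longleftrightarrow> commuting t b \<Gamma>"
    and "(\<forall>f\<in>I_df t b. eval_at \<phi> (\<lambda>(i, j). \<Gamma> i j) f = 0) \<longleftrightarrow> degree_filtered t b \<Gamma>"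
proof -
  let ?E = "eval_at \<phi> (\<lambda>(i, j). \<Gamma> i j)"
  have E: "ring_map ?E" by (rule ring_hom_eval_at[OF \<phi>])
  have entry: "?E (mult_matrix t b r $ i $ j) = point_matrix t b \<Gamma> r $ i $ j" for r i j
    by (simp add: mult_matrix_def point_matrix_def eval_at_Indet[OF \<phi>] ring_map_0[OF E] ring_map_1[OF E])
  have prod: "?E ((mult_matrix t b r ** mult_matrix t b s) $ i $ j)
      = (point_matrix t b \<Gamma> r ** point_matrix t b \<Gamma> s) $ i $ j" for r s i j
    by (simp add: matrix_matrix_mult_def ring_map_sum[OF E] ring_map_mult[OF E] entry)
  have diff: "?E ((mult_matrix t b r ** mult_matrix t b s - mult_matrix t b s ** mult_matrix t b r) $ i $ j) = 0
      \<longleftrightarrow> (point_matrix t b \<Gamma> r ** point_matrix t b \<Gamma> s) $ i $ j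
        = (point_matrix t b \<Gamma> s ** point_matrix t b \<Gamma> r) $ i $ j" for r s i j
    by (simp add: ring_map_diff[OF E] prod)
  have "(\<forall>f\<in>{q r s i j | r s i j. True}. ?E f = 0) \<longleftrightarrow> (\<forall>r s i j. ?E (q r s i j) = 0)"
    for q :: "'n \<Rightarrow> 'n \<Rightarrow> 'm \<Rightarrow> 'm \<Rightarrow> ('m, 'v, 'k) KC" by blast
  then show "(\<forall>f\<in>I_B t b. ?E f = 0) \<longleftrightarrow> commuting t b \<Gamma>"
    unfolding I_B_def ring_map_ideal_gen[OF E] by (simp only: diff commuting_def vec_eq_iff)
  have "(\<forall>f\<in>{Indet (i, j) | i j. tdeg (t i) > tdeg (b j)}. ?E f = 0)
      \<longleftrightarrow> (\<forall>i j. tdeg (t i) > tdeg (b j) \<longrightarrow> ?E (Indet (i, j)) = 0)" by blast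
  then show "(\<forall>f\<in>I_df t b. ?E f = 0) \<longleftrightarrow> degree_filtered t b \<Gamma>"
    unfolding I_df_def ring_map_ideal_gen[OF E] degree_filtered_def
    by (simp add: eval_at_Indet[OF \<phi>])
qed

lemma is_ideal_I_B_df: "is_ideal (I_B_df t b)"
  unfolding I_B_df_def I_B_def I_df_def by (intro is_ideal_plus is_ideal_gen)

lemma zero_on_I_B_df:
  fixes t :: "'m::finite \<Rightarrow> 'n::finite trm" and b :: "'v::finite \<Rightarrow> 'n trm"
    and \<phi> :: "'k::field \<Rightarrow> 'l::field"
  assumes \<phi>: "ring_map \<phi>"
  shows "(\<forall>f\<in>I_B_df t b. eval_at \<phi> (\<lambda>(i, j). \<Gamma> i j) f = 0)
    \<longleftrightarrow> commuting t b \<Gamma> \<and> degree_filtered t b \<Gamma>"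
proof -
  have E: "ring_map (eval_at \<phi> (\<lambda>(i, j). \<Gamma> i j))" by (rule ring_hom_eval_at[OF \<phi>])
  have "is_ideal (I_B t b)" "is_ideal (I_df t b)"
    unfolding I_B_def I_df_def by (rule is_ideal_gen)+
  from ring_map_plus[OF E this] show ?thesis
    unfolding I_B_df_def zero_on_I_B_iff[OF \<phi>] .
qed

lemma coeff_map_g_hom:
  fixes t :: "'m::finite \<Rightarrow> 'n::finite trm" and b :: "'v::finite \<Rightarrow> 'n trm"
    and \<phi> :: "'k::field \<Rightarrow> 'l::field"
  assumes \<phi>: "ring_map \<phi>"
  shows "coeff_map (eval_at \<phi> (\<lambda>(i, j). top_part t b \<Gamma> i j)) (g_hom t b j)
    = border_poly t b (top_part t b \<Gamma>) j"
proof -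
  let ?E = "eval_at \<phi> (\<lambda>(i, j). top_part t b \<Gamma> i j)"
  have E: "ring_map ?E" by (rule ring_hom_eval_at[OF \<phi>])
  have C: "ring_map (coeff_map ?E :: ('n, ('m, 'v, 'k) KC) mpol \<Rightarrow> _)" by (rule ring_hom_coeff_map[OF E])
  have "(\<Sum>i\<in>{i. tdeg (t i) = tdeg (b j)}. Const (top_part t b \<Gamma> i j) * Monom (t i))
      = (\<Sum>i\<in>UNIV. Const (top_part t b \<Gamma> i j) * Monom (t i) :: ('n, 'l) mpol)"
    by (rule sum.mono_neutral_left) (auto simp: top_part_def)
  then show ?thesis
    by (simp add: g_hom_def border_poly_def ring_map_diff[OF C] ring_map_sum[OF C]
        ring_map_mult[OF C] coeff_map_Monom[OF E] coeff_map_Const[OF E] eval_at_Indet[OF \<phi>])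
qed

lemma coeff_map_U_hom_eq:
  fixes t :: "'m::finite \<Rightarrow> 'n::finite trm" and b :: "'v::finite \<Rightarrow> 'n trm"
    and \<phi> :: "'k::field \<Rightarrow> 'l::field"
  assumes \<phi>: "ring_map \<phi>" and comm: "commuting t b (top_part t b \<Gamma>)" and eq: "U_hom_eq t b f f'"
  defines "E \<equiv> eval_at \<phi> (\<lambda>(i, j). top_part t b \<Gamma> i j)"
  shows "coeff_map E f - coeff_map E f' \<in> I_point t b (top_part t b \<Gamma>)"
proof -
  let ?H = "I_point t b (top_part t b \<Gamma>)"
  have H: "is_ideal ?H" unfolding I_point_def by (rule is_ideal_gen)
  have E: "ring_map E" unfolding E_def by (rule ring_hom_eval_at[OF \<phi>])
  have C: "ring_map (coeff_map E :: ('n, ('m, 'v, 'k) KC) mpol \<Rightarrow> _)" by (rule ring_hom_coeff_map[OF E])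
  obtain p q where pq: "f - f' = p + q" "\<forall>s. lookup p s \<in> I_B_hom t b" "q \<in> ideal_gen (range (g_hom t b))"
    using eq unfolding U_hom_eq_def set_plus_def by blast
  have "\<forall>x\<in>I_B_hom t b. E x = 0"
  proof -
    have "is_ideal (I_B t b)" unfolding I_B_def by (rule is_ideal_gen)
    moreover have "\<forall>f\<in>I_B t b. E f = 0"
      unfolding E_def using zero_on_I_B_iff(1)[OF \<phi>] comm by blast
    moreover have "\<forall>x\<in>ideal_gen (Indet ` (- C_hom t b)). E x = 0"
      unfolding ring_map_ideal_gen[OF E]
      by (auto simp: E_def eval_at_Indet[OF \<phi>] C_hom_def top_part_def split: if_splits)
    ultimately show ?thesis
      unfolding I_B_hom_def using ring_map_plus[OF E _ is_ideal_gen] by blast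
  qed
  then have "coeff_map E p = 0"
    using pq(2) by (intro poly_mapping_eqI) (simp add: lookup_coeff_map[OF E])
  moreover have "coeff_map E q \<in> ?H"
  proof -
    obtain c where "q = (\<Sum>j\<in>UNIV. c j * g_hom t b j)"
      using pq(3) unfolding ideal_gen_image_iff[OF finite] by blast
    moreover have "coeff_map E (g_hom t b j) = border_poly t b (top_part t b \<Gamma>) j" for j
      unfolding E_def by (rule coeff_map_g_hom[OF \<phi>])
    ultimately have "coeff_map E q = (\<Sum>j\<in>UNIV. coeff_map E (c j) * border_poly t b (top_part t b \<Gamma>) j)"
      by (simp add: ring_map_sum[OF C] ring_map_mult[OF C])
    then show ?thesis
      using H by (simp add: ideal_sum ideal_mult I_point_eq ideal_gen_base)
  qed
  ultimately have "coeff_map E (f - f') \<in> ?H" unfolding pq(1) by (simp add: ring_map_add[OF C])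
  then show ?thesis by (simp add: ring_map_diff[OF C])
qed

text \<open>
  On the degree filtered part of the scheme, \<open>J\<close> vanishes at \<open>\<Gamma>\<close> iff \<open>I\<^sub>\<Gamma>\<close> is not a strict complete
  intersection (the fact \<open>key\<close>). For a symmetric Hilbert function this is Wiebe's criterion for the
  degree form ideal; otherwise no strict complete intersection occurs at all.
\<close>

lemma points_represent_non_CI:
  fixes t :: "'m::{finite,linorder} \<Rightarrow> 'n::{finite,linorder} trm"
    and b :: "'v::{finite,linorder} \<Rightarrow> 'n trm"
    and h :: "'n \<Rightarrow> 'v \<Rightarrow> ('n, ('m, 'v, 'k::field) KC) mpol"
    and W :: "('n, ('m, 'v, 'k) KC) mpol ^ 'v::{finite,linorder} ^ 'n::{finite,linorder}"
    and a :: "'m \<Rightarrow> ('n \<Rightarrow> 'v) \<Rightarrow> ('m, 'v, 'k) KC"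
    and J :: "('m, 'v, 'k) KC set" and \<phi> :: "'k \<Rightarrow> 'l::field"
  assumes "inj t" and "order_ideal (range t)" and "inj b" and "range b = border (range t)"
    and nonsym: "\<not> symmetric_HF (range t) \<Longrightarrow> J = I_B_df t b"
    and sym: "symmetric_HF (range t) \<Longrightarrow>
      (\<forall>j. g_hom t b j = (\<Sum>i\<in>UNIV. h i j * Indet i)) \<and>
      W = (\<chi> i j. h i j) \<and>
      (\<forall>\<sigma>. strict_mono \<sigma> \<longrightarrow>
         U_hom_eq t b (max_minor W \<sigma>) (\<Sum>i\<in>UNIV. Const (a i \<sigma>) * Monom (t i)) \<and>
         (\<forall>i. indets (a i \<sigma>) \<subseteq> C_hom t b)) \<and>
      J = I_B_df t b + ideal_gen {a i \<sigma> | i \<sigma>. strict_mono \<sigma>}"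
    and \<phi>: "ring_map \<phi>"
  shows "I_point t b ` rational_points \<phi> J =
      {I. zero_dim_scheme I \<and> has_df_border_basis t I \<and> \<not> strict_CI I}"
proof -
  interpret order_border t b by unfold_locales fact+
  have key: "(\<forall>f\<in>J. eval_at \<phi> (\<lambda>(i, j). \<Gamma> i j) f = 0) \<longleftrightarrow> \<not> strict_CI (I_point t b \<Gamma>)"
    if comm: "commuting t b \<Gamma>" and df: "degree_filtered t b \<Gamma>" for \<Gamma>
  proof -
    let ?\<Gamma> = "top_part t b \<Gamma>" and ?g = "border_poly t b (top_part t b \<Gamma>)"
    define H where "H = I_point t b ?\<Gamma>"
    have DF: "DF (I_point t b \<Gamma>) = H" unfolding H_def by (rule DF_I_point[OF df comm])
    interpret hp: graded_point t b ?\<Gamma>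
      by unfold_locales (use commuting_top_part[OF df comm] in \<open>auto simp: top_part_def fun_eq_iff\<close>)
    have Hg: "H = ideal_gen (range ?g)" unfolding H_def by (rule I_point_eq)
    have pow: "Indet i ^ Suc hp.rho \<in> H" for i unfolding H_def by (rule hp.power_in_I)
    have proper: "1 \<notin> H" unfolding H_def by (rule hp.one_notin_I)
    have CI_sym: "symmetric_HF (range t)" if CI: "strict_CI (I_point t b \<Gamma>)"
    proof -
      obtain fs where fs: "length fs = CARD('n)" "H = ideal_gen (set fs)"
        using CI unfolding strict_CI_def DF by blast
      obtain f :: "'n \<Rightarrow> ('n, 'l) mpol" where f: "range f = set fs" using family_of_list[OF fs(1)] .
      have Hf: "H = ideal_gen (range f)" using fs f by simp
      show ?thesis
        by (rule hp.symmetric_of_socle) (rule socle_dim_le_1[OF Hf pow, unfolded H_def], auto)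
    qed
    define E where "E = eval_at \<phi> (\<lambda>(i, j). \<Gamma> i j)"
    have E: "ring_map E" unfolding E_def by (rule ring_hom_eval_at[OF \<phi>])
    have E_df: "\<forall>f\<in>I_B_df t b. E f = 0"
      unfolding E_def zero_on_I_B_df[OF \<phi>] using comm df by blast
    show ?thesis
    proof (cases "symmetric_HF (range t)")
      case False
      then show ?thesis using CI_sym E_df nonsym unfolding E_def by blast
    next
      case True
      note S = sym[OF True]
      define E' where "E' = eval_at \<phi> (\<lambda>(i, j). ?\<Gamma> i j)"
      have E': "ring_map E'" unfolding E'_def by (rule ring_hom_eval_at[OF \<phi>])
      let ?C = "coeff_map E' :: ('n, ('m, 'v, 'k) KC) mpol \<Rightarrow> ('n, 'l) mpol"
      have C: "ring_map ?C" by (rule ring_hom_coeff_map[OF E'])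
      have gw: "?g j = (\<Sum>i\<in>UNIV. ?C (h i j) * Indet i)" for j
      proof -
        have "?g j = ?C (g_hom t b j)" unfolding E'_def by (rule coeff_map_g_hom[OF \<phi>, symmetric])
        then show ?thesis using S
          by (simp add: ring_map_sum[OF C] ring_map_mult[OF C] Indet_def coeff_map_Monom[OF E'])
      qed
      have minor: "det (\<chi> i k. ?C (h i (\<sigma> k))) \<in> H \<longleftrightarrow> (\<forall>i. E (a i \<sigma>) = 0)" if \<sigma>: "strict_mono \<sigma>" for \<sigma>
      proof -
        have EE: "E' (a i \<sigma>) = E (a i \<sigma>)" for i
          unfolding E_def E'_def
        proof (rule eval_at_cong)
          fix x assume "x \<in> indets (a i \<sigma>)"
          then have "x \<in> C_hom t b" using S \<sigma> by blast
          then show "(case x of (i, j) \<Rightarrow> ?\<Gamma> i j) = (case x of (i, j) \<Rightarrow> \<Gamma> i j)"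
            by (auto simp: C_hom_def top_part_def)
        qed
        have "?C (max_minor W \<sigma>) = det (\<chi> i k. ?C (h i (\<sigma> k)))"
          using S by (simp add: max_minor_def ring_map_det[OF C])
        moreover have "?C (\<Sum>i\<in>UNIV. Const (a i \<sigma>) * Monom (t i)) = lin t (\<chi> i. E' (a i \<sigma>))"
          by (simp add: lin_def ring_map_sum[OF C] ring_map_mult[OF C] coeff_map_Const[OF E'] coeff_map_Monom[OF E'])
        moreover have "U_hom_eq t b (max_minor W \<sigma>) (\<Sum>i\<in>UNIV. Const (a i \<sigma>) * Monom (t i))"
          using S \<sigma> by blast
        from coeff_map_U_hom_eq[OF \<phi> hp.comm this]
        have "?C (max_minor W \<sigma>) - ?C (\<Sum>i\<in>UNIV. Const (a i \<sigma>) * Monom (t i)) \<in> H"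
          unfolding E'_def H_def .
        ultimately have "det (\<chi> i k. ?C (h i (\<sigma> k))) \<in> H
            \<longleftrightarrow> lin t (\<chi> i. E' (a i \<sigma>)) \<in> H"
          using ideal_cong[OF hp.is_ideal_I] unfolding H_def by simp
        also have "\<dots> \<longleftrightarrow> (\<forall>i. E' (a i \<sigma>) = 0)"
          unfolding H_def hp.mem_I_iff hp.nf_lin by (simp add: vec_eq_iff)
        finally show ?thesis by (simp only: EE)
      qed
      have "strict_CI (I_point t b \<Gamma>) \<longleftrightarrow> (\<exists>\<sigma>. strict_mono \<sigma> \<and> det (\<chi> i k. ?C (h i (\<sigma> k))) \<notin> H)"
      proof
        assume "strict_CI (I_point t b \<Gamma>)"
        then obtain fs where fs: "length fs = CARD('n)" "H = ideal_gen (set fs)"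
          unfolding strict_CI_def DF by blast
        show "\<exists>\<sigma>. strict_mono \<sigma> \<and> det (\<chi> i k. ?C (h i (\<sigma> k))) \<notin> H"
          by (rule nonzero_minor_of_CI[OF gw Hg pow fs(2,1)])
      next
        assume "\<exists>\<sigma>. strict_mono \<sigma> \<and> det (\<chi> i k. ?C (h i (\<sigma> k))) \<notin> H"
        then obtain \<sigma> where d: "det (\<chi> i k. ?C (h i (\<sigma> k))) \<notin> H" by blast
        show "strict_CI (I_point t b \<Gamma>)"
          unfolding strict_CI_def DF
          by (rule CI_of_nonzero_minor[OF gw Hg hom_deg_border_poly_top_part tdeg_b_pos pow proper d])
      qed
      also have "\<dots> \<longleftrightarrow> \<not> (\<forall>x\<in>{a i \<sigma> | i \<sigma>. strict_mono \<sigma>}. E x = 0)"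
        using minor by blast
      also have "(\<forall>x\<in>{a i \<sigma> | i \<sigma>. strict_mono \<sigma>}. E x = 0) \<longleftrightarrow> (\<forall>x\<in>J. E x = 0)"
      proof -
        have J: "J = I_B_df t b + ideal_gen {a i \<sigma> | i \<sigma>. strict_mono \<sigma>}" using S by blast
        show ?thesis
          unfolding J ring_map_plus[OF E is_ideal_I_B_df is_ideal_gen] ring_map_ideal_gen[OF E]
          using E_df by blast
      qed
      finally show ?thesis unfolding E_def by blast
    qed
  qed
  have sub: "I_B_df t b \<subseteq> J"
    using nonsym sym subset_plus_ideal(1)[OF is_ideal_gen] by (cases "symmetric_HF (range t)") auto
  have pts: "\<Gamma> \<in> rational_points \<phi> J \<longleftrightarrow>
      commuting t b \<Gamma> \<and> degree_filtered t b \<Gamma> \<and> \<not> strict_CI (I_point t b \<Gamma>)" for \<Gamma>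
    using zero_on_I_B_df[OF \<phi>, of t b \<Gamma>] sub key[of \<Gamma>] unfolding rational_points_def by blast
  show ?thesis
  proof (intro equalityI subsetI)
    fix I assume "I \<in> I_point t b ` rational_points \<phi> J"
    then obtain \<Gamma> where G: "I = I_point t b \<Gamma>" "commuting t b \<Gamma>" "degree_filtered t b \<Gamma>"
      "\<not> strict_CI (I_point t b \<Gamma>)" using pts by blast
    interpret border_point t b \<Gamma> by unfold_locales (rule G(2))
    show "I \<in> {I. zero_dim_scheme I \<and> has_df_border_basis t I \<and> \<not> strict_CI I}"
      using zero_dim df_border_basis[OF G(3)] G by simp
  next
    fix I :: "('n, 'l) mpol set"
    assume I: "I \<in> {I. zero_dim_scheme I \<and> has_df_border_basis t I \<and> \<not> strict_CI I}"
    then have "is_ideal I" by (simp add: zero_dim_scheme_def)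
    then obtain \<Gamma> where "commuting t b \<Gamma>" "degree_filtered t b \<Gamma>" "I = I_point t b \<Gamma>"
      using point_of_df_border_basis[of I] I by blast
    then show "I \<in> I_point t b ` rational_points \<phi> J" using pts I by blast
  qed
qed

theorem mainTheorem5:
  fixes t :: "'m::{finite,linorder} \<Rightarrow> 'n::{finite,linorder} trm"
    and b :: "'v::{finite,linorder} \<Rightarrow> 'n trm"
    and h :: "'n \<Rightarrow> 'v \<Rightarrow> ('n, ('m, 'v, 'k::field) KC) mpol"
    and W :: "('n, ('m, 'v, 'k) KC) mpol ^ 'v::{finite,linorder} ^ 'n::{finite,linorder}"
    and a :: "'m \<Rightarrow> ('n \<Rightarrow> 'v) \<Rightarrow> ('m, 'v, 'k) KC"
    and J :: "('m, 'v, 'k) KC set"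
  assumes "inj t" and "order_ideal (range t)" and "mono (\<lambda>i. tdeg (t i))"
    and "inj b" and "range b = border (range t)"
    and "\<not> symmetric_HF (range t) \<Longrightarrow> J = I_B_df t b"
    and "symmetric_HF (range t) \<Longrightarrow>
      (\<forall>j. g_hom t b j = (\<Sum>i\<in>UNIV. h i j * Indet i)) \<and>
      W = (\<chi> i j. h i j) \<and>
      (\<forall>\<sigma>. strict_mono \<sigma> \<longrightarrow>
         U_hom_eq t b (max_minor W \<sigma>) (\<Sum>i\<in>UNIV. Const (a i \<sigma>) * Monom (t i)) \<and>
         (\<forall>i. indets (a i \<sigma>) \<subseteq> C_hom t b)) \<and>
      J = I_B_df t b + ideal_gen {a i \<sigma> | i \<sigma>. strict_mono \<sigma>}"
  shows "is_ideal J \<and> I_B_df t b \<subseteq> J \<and>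
    I_point t b ` rational_points id J =
      {I. zero_dim_scheme I \<and> has_df_border_basis t I \<and> \<not> strict_CI I} \<and>
    (\<forall>\<phi> :: 'k \<Rightarrow> 'l::field. field_embedding \<phi> \<longrightarrow>
      I_point t b ` rational_points \<phi> J =
        {I. zero_dim_scheme I \<and> has_df_border_basis t I \<and> \<not> strict_CI I})"
proof (intro conjI allI impI)
  have "is_ideal J \<and> I_B_df t b \<subseteq> J"
  proof (cases "symmetric_HF (range t)")
    case True
    have "J = I_B_df t b + ideal_gen {a i \<sigma> | i \<sigma>. strict_mono \<sigma>}" using assms(7)[OF True] by blast
    then show ?thesis
      by (auto simp: is_ideal_plus[OF is_ideal_I_B_df is_ideal_gen]
          intro: subsetD[OF subset_plus_ideal(1)[OF is_ideal_gen]])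
  next
    case False
    then show ?thesis using assms(6) is_ideal_I_B_df by simp
  qed
  then show "is_ideal J" "I_B_df t b \<subseteq> J" by blast+
  have hom: "ring_map (id :: 'k \<Rightarrow> 'k)" by (simp add: ring_map_def)
  show "I_point t b ` rational_points id J =
      {I. zero_dim_scheme I \<and> has_df_border_basis t I \<and> \<not> strict_CI I}"
    by (rule points_represent_non_CI[where h = h and W = W and a = a, OF assms(1,2,4,5) _ _ hom])
      (erule assms(6), erule assms(7))
  fix \<phi> :: "'k \<Rightarrow> 'l"
  assume "field_embedding \<phi>"
  then have hom: "ring_map \<phi>" by (simp add: ring_map_def field_embedding_def)
  show "I_point t b ` rational_points \<phi> J =
      {I. zero_dim_scheme I \<and> has_df_border_basis t I \<and> \<not> strict_CI I}"
    by (rule points_represent_non_CI[where h = h and W = W and a = a, OF assms(1,2,4,5) _ _ hom])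
      (erule assms(6), erule assms(7))
qed

end
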